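(* For every vexillary signed permutation $w$ there is a strict partition $\lambda(w)$ such that $G^C_w=GQ^{(\beta)}_{\lambda(w)}$.
   Context: **Signed permutations.** $W_n$ is the group of bijections $w$ of $\{-n,\dots,-1,1,\dots,n\}$ with $w(-i)=-w(i)$, written in one-line notation $w(1)\cdots w(n)$ with $\bar a=-a$; Coxeter generators $s_0=(-1\ 1)$, $s_i=(-i{-}1\ \,{-}i)(i\ \,i{+}1)$ for $1\le i\le n-1$; $\ell(w)$ is Coxeter length. $w\in W_n$ contains $v\in W_m$ as a pattern if there is a length-$m$ subsequence $w'$ of $w(1)\cdots w(n)$ such that for all $i,j\in[m]$, $w'(i)$ and $v(i)$ have the same sign, and $|w'(i)|<|w'(j)|$ iff $|v(i)|<|v(j)|$. $w$ is vexillary if it contains none of the 18 patterns $\bar132,\ \bar231,\ 3\bar12,\ 321,\ \bar321,\ 32\bar1,\ \bar32\bar1,\ 2143,\ 2\bar34\bar1,\ \bar2\bar34\bar1,\ 2413,\ 3142,\ 3\bar41\bar2,\ \bar3\bar41\bar2,\ 3\bar4\bar1\bar2,\ \bar3\bar4\bar1\bar2,\ \bar41\bar23,\ \bar4\bar1\bar23.$ **$G^C_w$.** Let $u_0,\dots,u_{n-1}$ be noncommuting variables (commuting with $\beta$ and $x_1,x_2,\dots$) with $u_i^2=\beta u_i$, $u_1u_0u_1u_0=u_0u_1u_0u_1$, $u_iu_{i+1}u_i=u_{i+1}u_iu_{i+1}$ ($i>0$), $u_iu_j=u_ju_i$ ($|i-j|>1$). For $w\in W_n$ with reduced word $(a_1,\dots,a_\ell)$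 put $u_w=u_{a_1}\cdots u_{a_\ell}$. $G^C_w$ (the type C $K$-Stanley symmetric function) is the coefficient of $u_w$ in $$\prod_{i\ge1}(1+x_iu_{n-1})\cdots(1+x_iu_1)(1+x_iu_0)(1+x_iu_0)(1+x_iu_1)\cdots(1+x_iu_{n-1}),$$ the product taken in order $i=1,2,\dots$ from left to right. **$GQ$.** A strict partition is $\lambda=(\lambda_1>\dots>\lambda_k>0)$, with shifted diagram $D_\lambda=\{(i,j):1\le i\le k,\ i\le j\le\lambda_i+i-1\}$. Order $\mathbb{Z}\setminus\{0\}$ by $\bar1\prec1\prec\bar2\prec2\prec\cdots$. A shifted set-valued semistandard tableau of shape $\lambda$ is a filling $T$ of $D_\lambda$ by finite nonempty subsets of $\mathbb{Z}\setminus\{0\}$ with $\max T_{ij}\preceq\min T_{i+1,j}$, equality allowed only for negative values, and $\max T_{ij}\preceq\min T_{i,j+1}$, equality allowed only for positive values ($\max,\min$ with respect to $\prec$). With $|T|=\sum|T_{ij}|$ and $x^T=\prod_{(i,j)}\prod_{s\in T_{ij}}x_{|s|}$, set $GQ^{(\beta)}_\lambda=\sum_T\beta^{|T|-|\lambda|}x^T$. *)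

theory Defs
  imports
    "HOL-Library.Poly_Mapping"
    "HOL-Library.Sublist"
    "HOL-Combinatorics.Permutations"
    "HOL-Computational_Algebra.Polynomial"
begin

section \<open>Signed permutations\<close>

text \<open>
  The Coxeter group \<open>W\<^sub>n\<close>. Its elements are extended by the identity outside
  \<open>{-n..n} - {0}\<close>, so that they are determined by their one-line notation.
\<close>

definition signed_perms :: "nat \<Rightarrow> (int \<Rightarrow> int) set" where
  "signed_perms n = {w. w permutes ({- int n..int n} - {0}) \<and> (\<forall>i. w (- i) = - w i)}"

definition cox_gen :: "nat \<Rightarrow> int \<Rightarrow> int" where
  "cox_gen i =
     (if i = 0 then Transposition.transpose (- 1) 1
      else Transposition.transpose (- int i - 1) (- int i)
             \<circ> Transposition.transpose (int i) (int i + 1))"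

definition word_perm :: "nat list \<Rightarrow> int \<Rightarrow> int" where
  "word_perm a = foldr (\<lambda>i v. cox_gen i \<circ> v) a id"

definition cox_length :: "nat \<Rightarrow> (int \<Rightarrow> int) \<Rightarrow> nat" where
  "cox_length n w = (LEAST l. \<exists>a. set a \<subseteq> {..<n} \<and> word_perm a = w \<and> length a = l)"

definition is_reduced_word :: "nat \<Rightarrow> (int \<Rightarrow> int) \<Rightarrow> nat list \<Rightarrow> bool" where
  "is_reduced_word n w a \<longleftrightarrow>
     set a \<subseteq> {..<n} \<and> word_perm a = w \<and> length a = cox_length n w"

definition one_line :: "nat \<Rightarrow> (int \<Rightarrow> int) \<Rightarrow> int list" where
  "one_line n w = map (\<lambda>i. w (int i)) [1..<Suc n]"

text \<open>Both arguments are signed permutations in one-line notation, pattern second.\<close>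

definition contains_pattern :: "int list \<Rightarrow> int list \<Rightarrow> bool" where
  "contains_pattern w v \<longleftrightarrow>
     (\<exists>w'. subseq w' w \<and> length w' = length v \<and>
        (\<forall>i < length v. sgn (w' ! i) = sgn (v ! i)) \<and>
        (\<forall>i < length v. \<forall>j < length v.
            \<bar>w' ! i\<bar> < \<bar>w' ! j\<bar> \<longleftrightarrow> \<bar>v ! i\<bar> < \<bar>v ! j\<bar>))"

definition vexillary_patterns :: "int list set" where
  "vexillary_patterns =
     {[-1, 3, 2], [-2, 3, 1], [3, -1, 2], [3, 2, 1], [-3, 2, 1], [3, 2, -1], [-3, 2, -1],
      [2, 1, 4, 3], [2, -3, 4, -1], [-2, -3, 4, -1], [2, 4, 1, 3], [3, 1, 4, 2],
      [3, -4, 1, -2], [-3, -4, 1, -2], [3, -4, -1, -2], [-3, -4, -1, -2],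
      [-4, 1, -2, 3], [-4, -1, -2, 3]}"

definition vexillary :: "nat \<Rightarrow> (int \<Rightarrow> int) \<Rightarrow> bool" where
  "vexillary n w \<longleftrightarrow> (\<forall>v \<in> vexillary_patterns. \<not> contains_pattern (one_line n w) v)"


section \<open>Power series in \<open>x\<^sub>1, x\<^sub>2, \<dots>\<close> over \<open>\<int>[\<beta>]\<close>\<close>

text \<open>
  A monomial is its exponent vector. The type also has a variable \<open>x\<^sub>0\<close>, which occurs in none
  of the series below.
\<close>

type_synonym monomial = "nat \<Rightarrow>\<^sub>0 nat"
type_synonym power_series = "monomial \<Rightarrow> int poly"

abbreviation beta :: "int poly" where
  "beta \<equiv> [:0, 1:]"


section \<open>The algebra generated by \<open>u\<^sub>0, \<dots>, u\<^sub>n\<^sub>-\<^sub>1\<close>\<close>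

text \<open>
  Finitely supported functions on the free monoid, with convolution product, form the free
  associative algebra \<open>\<int>[\<beta>]\<langle>u\<^sub>0, u\<^sub>1, \<dots>\<rangle>\<close>. The monoid is written additively because
  this is what the product on \<^typ>\<open>'a \<Rightarrow>\<^sub>0 'b\<close> expects.
\<close>

datatype u_word = Word (letters: "nat list")

instantiation u_word :: monoid_add
begin

definition zero_u_word :: u_word where
  "0 = Word []"

definition plus_u_word :: "u_word \<Rightarrow> u_word \<Rightarrow> u_word" where
  "v + w = Word (letters v @ letters w)"

instance
  by standard (simp_all add: zero_u_word_def plus_u_word_def)

end

type_synonym free_alg = "u_word \<Rightarrow>\<^sub>0 int poly"

definition scalar :: "int poly \<Rightarrow> free_alg" where
  "scalar c = Poly_Mapping.single 0 c"

definition u_gen :: "nat \<Rightarrow> free_alg" where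
  "u_gen i = Poly_Mapping.single (Word [i]) 1"

definition free_alg_on :: "nat \<Rightarrow> free_alg set" where
  "free_alg_on n = {f. \<forall>a \<in> Poly_Mapping.keys f. set (letters a) \<subseteq> {..<n}}"

definition relators :: "nat \<Rightarrow> free_alg set" where
  "relators n =
     {u_gen i * u_gen i - scalar beta * u_gen i | i. i < n} \<union>
     (if 1 < n
      then {u_gen 1 * u_gen 0 * u_gen 1 * u_gen 0 - u_gen 0 * u_gen 1 * u_gen 0 * u_gen 1}
      else {}) \<union>
     {u_gen i * u_gen (i + 1) * u_gen i - u_gen (i + 1) * u_gen i * u_gen (i + 1)
        | i. 0 < i \<and> i + 1 < n} \<union>
     {u_gen i * u_gen j - u_gen j * u_gen i | i j. i < n \<and> j < n \<and> \<bar>int i - int j\<bar> > 1}"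

text \<open>The two-sided ideal of \<^term>\<open>free_alg_on n\<close> generated by \<^term>\<open>relators n\<close>.\<close>

inductive_set relation_ideal :: "nat \<Rightarrow> free_alg set" for n :: nat where
  zero: "0 \<in> relation_ideal n"
| add: "f \<in> relation_ideal n \<Longrightarrow> g \<in> relation_ideal n \<Longrightarrow> f + g \<in> relation_ideal n"
| mult: "r \<in> relators n \<Longrightarrow> f \<in> free_alg_on n \<Longrightarrow> g \<in> free_alg_on n \<Longrightarrow>
           f * r * g \<in> relation_ideal n"

definition u_perm :: "nat \<Rightarrow> (int \<Rightarrow> int) \<Rightarrow> free_alg" where
  "u_perm n w = prod_list (map u_gen (SOME a. is_reduced_word n w a))"

text \<open>
  The coefficient of \<open>u\<^sub>w\<close> in the class of \<open>h\<close> modulo the relations, that is, in the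
  expansion of this class in the basis \<open>(u\<^sub>v)\<close> indexed by \<open>v \<in> W\<^sub>n\<close>.
\<close>

definition u_coeff :: "nat \<Rightarrow> free_alg \<Rightarrow> (int \<Rightarrow> int) \<Rightarrow> int poly" where
  "u_coeff n h =
     (THE c. (\<forall>v. v \<notin> signed_perms n \<longrightarrow> c v = 0) \<and>
        h - (\<Sum>v\<in>signed_perms n. scalar (c v) * u_perm n v) \<in> relation_ideal n)"


section \<open>Type C \<open>K\<close>-Stanley symmetric functions\<close>

text \<open>
  Polynomials in the central variables \<open>x\<^sub>i\<close> with coefficients in the free algebra.
\<close>

definition x_factor :: "nat \<Rightarrow> nat \<Rightarrow> monomial \<Rightarrow>\<^sub>0 free_alg" where
  "x_factor n i =
     prod_list (map (\<lambda>a. 1 + Poly_Mapping.single (Poly_Mapping.single i 1) (u_gen a))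
       (rev [0..<n] @ [0..<n]))"

definition partial_product :: "nat \<Rightarrow> nat \<Rightarrow> monomial \<Rightarrow>\<^sub>0 free_alg" where
  "partial_product n N = prod_list (map (x_factor n) [1..<Suc N])"

text \<open>
  The infinite product is the coefficientwise limit of its partial products; the coefficient of
  each monomial is eventually constant.
\<close>

definition product_coeff :: "nat \<Rightarrow> monomial \<Rightarrow> free_alg" where
  "product_coeff n m =
     (THE h. \<forall>\<^sub>F N in sequentially. Poly_Mapping.lookup (partial_product n N) m = h)"

definition GC :: "nat \<Rightarrow> (int \<Rightarrow> int) \<Rightarrow> power_series" where
  "GC n w = (\<lambda>m. u_coeff n (product_coeff n m) w)"


section \<open>The functions \<open>GQ\<close>\<close>

definition strict_partition :: "nat list \<Rightarrow> bool" where
  "strict_partition lam \<longleftrightarrow> sorted_wrt (>) lam \<and> (\<forall>p \<in> set lam. 0 < p)"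

text \<open>Rows and columns are numbered from 1, list positions from 0.\<close>

definition shifted_diagram :: "nat list \<Rightarrow> (nat \<times> nat) set" where
  "shifted_diagram lam =
     {(i, j). 1 \<le> i \<and> i \<le> length lam \<and> i \<le> j \<and> j \<le> lam ! (i - 1) + i - 1}"

text \<open>
  The order \<open>-1 \<prec> 1 \<prec> -2 \<prec> 2 \<prec> \<dots>\<close> on the nonzero integers is the usual order of ranks.
\<close>

definition prec_rank :: "int \<Rightarrow> int" where
  "prec_rank s = (if s < 0 then 2 * \<bar>s\<bar> - 1 else 2 * \<bar>s\<bar>)"

definition prec_max :: "int set \<Rightarrow> int" where
  "prec_max S = arg_max_on prec_rank S"

definition prec_min :: "int set \<Rightarrow> int" where
  "prec_min S = arg_min_on prec_rank S"

text \<open>Tableaux are extended by the empty set outside the diagram.\<close>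

definition set_valued_tableaux :: "nat list \<Rightarrow> (nat \<times> nat \<Rightarrow> int set) set" where
  "set_valued_tableaux lam =
     {T. (\<forall>b. b \<notin> shifted_diagram lam \<longrightarrow> T b = {}) \<and>
         (\<forall>b \<in> shifted_diagram lam. finite (T b) \<and> T b \<noteq> {} \<and> 0 \<notin> T b) \<and>
         (\<forall>i j. (i, j) \<in> shifted_diagram lam \<and> (i + 1, j) \<in> shifted_diagram lam \<longrightarrow>
            prec_rank (prec_max (T (i, j))) < prec_rank (prec_min (T (i + 1, j))) \<or>
            prec_max (T (i, j)) = prec_min (T (i + 1, j)) \<and> prec_max (T (i, j)) < 0) \<and>
         (\<forall>i j. (i, j) \<in> shifted_diagram lam \<and> (i, j + 1) \<in> shifted_diagram lam \<longrightarrow>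
            prec_rank (prec_max (T (i, j))) < prec_rank (prec_min (T (i, j + 1))) \<or>
            prec_max (T (i, j)) = prec_min (T (i, j + 1)) \<and> prec_max (T (i, j)) > 0)}"

definition tableau_size :: "nat list \<Rightarrow> (nat \<times> nat \<Rightarrow> int set) \<Rightarrow> nat" where
  "tableau_size lam T = (\<Sum>b\<in>shifted_diagram lam. card (T b))"

definition tableau_monomial :: "nat list \<Rightarrow> (nat \<times> nat \<Rightarrow> int set) \<Rightarrow> monomial" where
  "tableau_monomial lam T =
     (\<Sum>b\<in>shifted_diagram lam. \<Sum>s\<in>T b. Poly_Mapping.single (nat \<bar>s\<bar>) 1)"

text \<open>
  For every monomial the sum is finite: the entries of a contributing tableau are bounded by the
  largest index of a variable occurring in the monomial.
\<close>

definition GQ :: "nat list \<Rightarrow> power_series" where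
  "GQ lam =
     (\<lambda>m. \<Sum>T | T \<in> set_valued_tableaux lam \<and> tableau_monomial lam T = m.
        beta ^ (tableau_size lam T - sum_list lam))"

end

theory Submission
  imports Defs
begin

text \<open>
  The coefficients of the product are computed by letting the \<open>u\<^sub>i\<close> act on functions on the group.
  Write \<open>g = w\<^sup>-\<^sup>1\<close> and fix a position \<open>k > 0\<close>. A hop moves the entry of \<open>g\<close> at position
  \<open>k\<close> to another position along a Bruhat covering. The operators \<open>1 + \<beta> \<cdot> hop\<close>, multiplied over
  all hops to the right, intertwine the factors of the product with deformed factors, and so do those
  for all hops to the left, with deformed factors that agree up to a change of one equivariant
  parameter. Hence both products of hops give the same value of the generating function: a transition
  equation.

  For vexillary \<open>w\<close>, at the last descent of \<open>g\<close>, only one hop is possible on either side, so the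
  transition equation identifies \<open>G\<^sup>C\<close> of \<open>w\<close> with that of another vexillary element, for which
  the last descent comes earlier or is followed by fewer smaller entries. This ends with a \<open>g\<close> that
  is increasing on the positive integers. In that case \<open>w\<close> corresponds to the strict partition formed
  by the positions of its negative entries, \<open>u\<^sub>c\<close> adds a box of content \<open>c\<close>, and the factors of one
  variable \<open>x\<^sub>N\<close> insert the letter \<open>-N\<close> by decreasing content and then the letter \<open>N\<close> by
  increasing content.
\<close>

section \<open>Signed permutations as odd bijections\<close>

text \<open>In the \<beta> term of the deformed factors, comparisons of \<open>k\<close> with the
  positions already hopped over are inverted. After all hops to the right, \<open>k\<close> acts as
  the largest value; after all hops to the left, as the smallest. Either way this term sees only
  where \<open>k\<close> stands in \<open>w\<close>, and the two versions differ by a ratio 1 +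
  \<beta> x between neighbouring places. This is the equivariant parameter. It becomes invisible
  when factors of size \<open>Suc q\<close> are compared on \<open>signed_perms q\<close>, where
  \<open>k\<close> never reaches the places with special weights.

  At the element \<open>u\<close> below \<open>g\<close> the transition equation reads G(u) +
  \<beta> G(g) = G(u) + \<beta> G(h), so that \<beta> cancels and no sum of several terms arises.
  The 18 patterns are hard to follow through such a step; \<open>vex\<close> is an invariant that
  survives it. It speaks of the sequence indexed by all integers, in which a positive inversion and
  its mirror image always form 2143; hence its exception for positive entries. A hop may lead to a
  place outside the current group, so the rank grows during the reduction.\<close>

definition odd_perm :: "(int \<Rightarrow> int) \<Rightarrow> bool" where
  "odd_perm w \<longleftrightarrow> bij w \<and> (\<forall>x. w (- x) = - w x)"

lemma odd_perm_minus: "odd_perm w \<Longrightarrow> w (- x) = - w x"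
  by (simp add: odd_perm_def)

lemma odd_perm_0: "odd_perm w \<Longrightarrow> w 0 = 0"
  using odd_perm_minus[of w 0] by simp

lemma odd_perm_bij: "odd_perm w \<Longrightarrow> bij w"
  by (simp add: odd_perm_def)

lemma odd_perm_eq_iff: "odd_perm w \<Longrightarrow> w x = w y \<longleftrightarrow> x = y"
  by (meson bij_def inj_eq odd_perm_def)

lemma odd_perm_eq_minus_iff: "odd_perm w \<Longrightarrow> w x = - w y \<longleftrightarrow> x = - y"
  by (metis odd_perm_eq_iff odd_perm_minus)

lemma odd_perm_eq_0_iff: "odd_perm w \<Longrightarrow> w x = 0 \<longleftrightarrow> x = 0"
  by (metis odd_perm_eq_iff odd_perm_0)

lemma odd_perm_id: "odd_perm id"
  by (simp add: odd_perm_def)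

lemma odd_perm_comp: "odd_perm v \<Longrightarrow> odd_perm w \<Longrightarrow> odd_perm (v \<circ> w)"
  by (simp add: odd_perm_def bij_comp)

lemma odd_perm_inv_eq_iff: "odd_perm w \<Longrightarrow> inv w y = x \<longleftrightarrow> w x = y"
  by (metis bij_inv_eq_iff odd_perm_def)

lemma odd_perm_inv_f: "odd_perm w \<Longrightarrow> inv w (w x) = x"
  by (simp add: odd_perm_inv_eq_iff)

lemma odd_perm_f_inv: "odd_perm w \<Longrightarrow> w (inv w x) = x"
  by (metis odd_perm_inv_eq_iff)

lemma odd_perm_inv: assumes "odd_perm w" shows "odd_perm (inv w)"
proof -
  have "inv w (- x) = - inv w x" for x
    by (simp add: odd_perm_inv_eq_iff[OF assms] odd_perm_minus[OF assms] odd_perm_f_inv[OF assms])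
  then show ?thesis using assms by (simp add: odd_perm_def bij_imp_bij_inv)
qed

lemma odd_perm_inv_inv: "odd_perm w \<Longrightarrow> inv (inv w) = w"
  by (simp add: inv_inv_eq odd_perm_bij)

lemma odd_perm_inv_comp: "odd_perm v \<Longrightarrow> odd_perm w \<Longrightarrow> inv (v \<circ> w) = inv w \<circ> inv v"
  by (simp add: o_inv_distrib odd_perm_bij)

section \<open>Reflections and Coxeter generators\<close>

text \<open>All reflections in one formula: a sign change for \<open>q = - p\<close>, otherwise two
  simultaneous transpositions.\<close>

definition swp :: "int \<Rightarrow> int \<Rightarrow> int \<Rightarrow> int" where
  "swp p q v = (if v = p then q else if v = q then p
     else if v = - p then - q else if v = - q then - p else v)"

lemma swp_swp: "p \<noteq> 0 \<Longrightarrow> q \<noteq> 0 \<Longrightarrow> swp p q (swp p q v) = v"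
  by (auto simp: swp_def)

lemma swp_comp_swp: "p \<noteq> 0 \<Longrightarrow> q \<noteq> 0 \<Longrightarrow> swp p q \<circ> swp p q = id"
  by (rule ext) (simp add: swp_swp)

lemma swp_commute: "swp p q = swp q p"
  by (rule ext) (auto simp: swp_def)

lemma swp_uminus: "p \<noteq> 0 \<Longrightarrow> q \<noteq> 0 \<Longrightarrow> swp (- p) (- q) = swp p q"
  by (rule ext) (auto simp: swp_def)

lemma odd_perm_swp: assumes "p \<noteq> 0" "q \<noteq> 0" shows "odd_perm (swp p q)"
proof -
  have "bij (swp p q)"
    by (rule o_bij[of "swp p q"]) (use assms in \<open>simp_all add: swp_comp_swp\<close>)
  then show ?thesis using assms by (auto simp: odd_perm_def swp_def)
qed

lemma inv_swp: "p \<noteq> 0 \<Longrightarrow> q \<noteq> 0 \<Longrightarrow> inv (swp p q) = swp p q"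
  by (rule inv_equality) (simp_all add: swp_swp)

lemma odd_perm_comp_swp: "odd_perm z \<Longrightarrow> z \<circ> swp x y = swp (z x) (z y) \<circ> z"
  by (rule ext) (auto simp: swp_def odd_perm_eq_iff odd_perm_minus odd_perm_eq_minus_iff)

text \<open>The generator \<open>s\<^sub>i\<close> exchanges the positions \<open>lo i < up i\<close>, neighbours among the nonzero
  integers.\<close>

definition lo :: "nat \<Rightarrow> int" where "lo i = (if i = 0 then - 1 else int i)"
definition up :: "nat \<Rightarrow> int" where "up i = int i + 1"

lemma lo_less_up: "lo i < up i" by (simp add: lo_def up_def)
lemma lo_nz [simp]: "lo i \<noteq> 0" and up_nz [simp]: "up i \<noteq> 0" and up_pos [simp]: "up i > 0"
  by (auto simp: lo_def up_def)

lemma cox_gen_eq: "cox_gen i = swp (lo i) (up i)"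
  by (rule ext) (auto simp: cox_gen_def swp_def lo_def up_def transpose_def)

lemma odd_perm_cox_gen: "odd_perm (cox_gen i)"
  by (simp add: cox_gen_eq odd_perm_swp)

lemma cox_gen_cox_gen: "cox_gen i \<circ> cox_gen i = id"
  by (simp add: cox_gen_eq swp_comp_swp)

lemma comp_cox_gen_cox_gen: "w \<circ> cox_gen i \<circ> cox_gen i = w"
  by (simp add: comp_assoc cox_gen_cox_gen)

lemma cox_gen_lo [simp]: "cox_gen i (lo i) = up i" and cox_gen_up [simp]: "cox_gen i (up i) = lo i"
  by (auto simp: cox_gen_eq swp_def lo_def up_def)

lemma comp_cox_gen_eq: "odd_perm w \<Longrightarrow> w \<circ> cox_gen i = swp (w (lo i)) (w (up i)) \<circ> w"
  by (simp add: cox_gen_eq odd_perm_comp_swp)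

lemma cox_gen_conj_swp:
  "cox_gen i \<circ> swp x y \<circ> cox_gen i = swp (cox_gen i x) (cox_gen i y)"
  by (simp add: odd_perm_comp_swp[OF odd_perm_cox_gen] comp_assoc cox_gen_cox_gen)

section \<open>The nested groups of signed permutations\<close>

text \<open>In this form the groups are visibly nested, so the rank can be raised without touching
  the element.\<close>

lemma signed_perms_iff:
  "w \<in> signed_perms n \<longleftrightarrow> odd_perm w \<and> (\<forall>x. int n < \<bar>x\<bar> \<longrightarrow> w x = x)"
proof
  assume w: "w \<in> signed_perms n"
  have "w x = x" if "int n < \<bar>x\<bar>" for x
    by (rule permutes_not_in[of w "{- int n..int n} - {0}"])
       (use w that in \<open>auto simp: signed_perms_def\<close>)
  moreover have "bij w" using w permutes_bij by (auto simp: signed_perms_def)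
  ultimately show "odd_perm w \<and> (\<forall>x. int n < \<bar>x\<bar> \<longrightarrow> w x = x)"
    using w by (auto simp: signed_perms_def odd_perm_def)
next
  assume w: "odd_perm w \<and> (\<forall>x. int n < \<bar>x\<bar> \<longrightarrow> w x = x)"
  then have "w permutes ({- int n..int n} - {0})"
    unfolding permutes_def using odd_perm_0[of w] odd_perm_bij[of w] by (auto simp: bij_iff)
  then show "w \<in> signed_perms n" using w by (auto simp: signed_perms_def odd_perm_def)
qed

lemma signed_perms_odd: "w \<in> signed_perms n \<Longrightarrow> odd_perm w"
  by (simp add: signed_perms_iff)

lemma signed_perms_mono: "n \<le> m \<Longrightarrow> w \<in> signed_perms n \<Longrightarrow> w \<in> signed_perms m"
  by (auto simp: signed_perms_iff)

lemma signed_perms_comp: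
  "v \<in> signed_perms n \<Longrightarrow> w \<in> signed_perms n \<Longrightarrow> v \<circ> w \<in> signed_perms n"
  by (auto simp: signed_perms_iff odd_perm_comp)

lemma signed_perms_swp:
  "p \<noteq> 0 \<Longrightarrow> q \<noteq> 0 \<Longrightarrow> \<bar>p\<bar> \<le> int n \<Longrightarrow> \<bar>q\<bar> \<le> int n \<Longrightarrow> swp p q \<in> signed_perms n"
  by (auto simp: signed_perms_iff odd_perm_swp swp_def)

lemma signed_perms_cox_gen: "i < n \<Longrightarrow> cox_gen i \<in> signed_perms n"
  unfolding cox_gen_eq by (rule signed_perms_swp) (auto simp: lo_def up_def)

lemma signed_perms_id: "id \<in> signed_perms n"
  by (simp add: signed_perms_iff odd_perm_id)

lemma signed_perms_inv: assumes "w \<in> signed_perms n" shows "inv w \<in> signed_perms n"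
  using assms odd_perm_inv_eq_iff by (auto simp: signed_perms_iff odd_perm_inv)

lemma signed_perms_abs_le:
  assumes "w \<in> signed_perms n" "\<bar>x\<bar> \<le> int n" shows "\<bar>w x\<bar> \<le> int n"
proof (rule ccontr)
  assume n: "\<not> \<bar>w x\<bar> \<le> int n"
  then have "w (w x) = w x" using assms by (auto simp: signed_perms_iff)
  then have "w x = x" using assms by (simp add: signed_perms_iff odd_perm_eq_iff)
  then show False using assms n by simp
qed

lemma finite_signed_perms: "finite (signed_perms n)"
  by (rule finite_subset[OF _ finite_permutations[of "{- int n..int n} - {0}"]])
     (auto simp: signed_perms_def)

section \<open>The action of the algebra on functions on the group\<close>

text \<open>A function \<open>f\<close> stands for the formal sum of the \<open>f(w) u\<^sub>w\<close>; then \<open>dd \<beta> i\<close> is right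
  multiplication by \<open>u\<^sub>i\<close>.\<close>

definition dd :: "'a::comm_ring_1 \<Rightarrow> nat \<Rightarrow> ((int \<Rightarrow> int) \<Rightarrow> 'a) \<Rightarrow> (int \<Rightarrow> int) \<Rightarrow> 'a" where
  "dd \<beta> i f w =
     (if odd_perm w \<and> w (up i) < w (lo i) then f (w \<circ> cox_gen i) + \<beta> * f w else 0)"

definition dlt :: "(int \<Rightarrow> int) \<Rightarrow> (int \<Rightarrow> int) \<Rightarrow> 'a::comm_ring_1" where
  "dlt v w = (if w = v then 1 else 0)"

lemma dd_add: "dd \<beta> i (\<lambda>w. f w + g w) = (\<lambda>w. dd \<beta> i f w + dd \<beta> i g w)"
  by (rule ext) (simp add: dd_def algebra_simps)

lemma dd_mult: "dd \<beta> i (\<lambda>w. c * f w) = (\<lambda>w. c * dd \<beta> i f w)"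
  by (rule ext) (simp add: dd_def algebra_simps)

lemma desc_comp_cox_gen: "odd_perm w \<Longrightarrow> (w \<circ> cox_gen i) (up i) < (w \<circ> cox_gen i) (lo i) \<longleftrightarrow> \<not> w (up i) < w (lo i)"
  using lo_less_up[of i] by (auto simp: not_less order_less_le odd_perm_eq_iff)

lemma dd_dd: "dd \<beta> i (dd \<beta> i f) = (\<lambda>w. \<beta> * dd \<beta> i f w)"
proof
  fix w :: "int \<Rightarrow> int"
  show "dd \<beta> i (dd \<beta> i f) w = \<beta> * dd \<beta> i f w"
    using desc_comp_cox_gen[of w i]
    by (cases "odd_perm w") (simp_all add: dd_def odd_perm_comp odd_perm_cox_gen)
qed

lemma dd_commute:
  assumes "1 < \<bar>int i - int j\<bar>"
  shows "dd \<beta> i (dd \<beta> j f) = dd \<beta> j (dd \<beta> i f)"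
proof
  fix w :: "int \<Rightarrow> int"
  have e: "cox_gen i (up j) = up j" "cox_gen i (lo j) = lo j" "cox_gen j (up i) = up i" "cox_gen j (lo i) = lo i"
    using assms by (auto simp: cox_gen_eq swp_def lo_def up_def)
  have c: "cox_gen i \<circ> cox_gen j = cox_gen j \<circ> cox_gen i"
    using odd_perm_comp_swp[OF odd_perm_cox_gen, of i "lo j" "up j"] e
    by (simp add: cox_gen_eq[of j])
  have "w \<circ> cox_gen i \<circ> cox_gen j = w \<circ> cox_gen j \<circ> cox_gen i"
    by (simp only: comp_assoc c)
  then show "dd \<beta> i (dd \<beta> j f) w = dd \<beta> j (dd \<beta> i f) w"
    by (simp add: dd_def odd_perm_comp odd_perm_cox_gen e algebra_simps)
qed

text \<open>The elements \<open>w\<close>, \<open>w1\<close>, ..., \<open>w5\<close> form a coset of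
  the subgroup generated by the two reflections. On this coset both sides depend only on the
  relative order of three entries.\<close>

lemma dd_braid3:
  assumes "0 < i"
  shows "dd \<beta> i (dd \<beta> (i + 1) (dd \<beta> i f)) = dd \<beta> (i + 1) (dd \<beta> i (dd \<beta> (i + 1) f))"
proof
  fix w :: "int \<Rightarrow> int"
  let ?s = "cox_gen i" and ?t = "cox_gen (i + 1)"
  have e: "?s (int i) = int i + 1" "?s (int i + 1) = int i" "?s (int i + 2) = int i + 2"
    "?t (int i) = int i" "?t (int i + 1) = int i + 2" "?t (int i + 2) = int i + 1"
    using assms by (auto simp: cox_gen_eq swp_def lo_def up_def)
  have l: "lo i = int i" "up i = int i + 1" "lo (i + 1) = int i + 1" "up (i + 1) = int i + 2"
    using assms by (auto simp: lo_def up_def)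
  have "?s \<circ> ?t \<circ> ?s = swp (int i) (int i + 2)"
    using cox_gen_conj_swp[of i "lo (i + 1)" "up (i + 1)"] e l by (simp only: cox_gen_eq[of "i + 1"])
  moreover have "?t \<circ> ?s \<circ> ?t = swp (int i) (int i + 2)"
    using cox_gen_conj_swp[of "i + 1" "lo i" "up i"] e l by (simp only: cox_gen_eq[of i])
  ultimately have wc: "w \<circ> ?s \<circ> ?t \<circ> ?s = w \<circ> ?t \<circ> ?s \<circ> ?t"
    by (metis comp_assoc)
  show "dd \<beta> i (dd \<beta> (i + 1) (dd \<beta> i f)) w = dd \<beta> (i + 1) (dd \<beta> i (dd \<beta> (i + 1) f)) w"
  proof (cases "odd_perm w")
    case True
    define p q t where pqt: "p = w (int i)" "q = w (int i + 1)" "t = w (int i + 2)"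
    define w1 w2 where w12: "w1 = w \<circ> ?s" "w2 = w \<circ> ?t"
    define w3 w4 where w34: "w3 = w1 \<circ> ?t" "w4 = w2 \<circ> ?s"
    define w5 where w5: "w5 = w3 \<circ> ?s"
    have ne: "p \<noteq> q" "p \<noteq> t" "q \<noteq> t"
      using True by (simp_all add: odd_perm_eq_iff pqt)
    have o: "odd_perm w" "odd_perm w1" "odd_perm w2" "odd_perm w3" "odd_perm w4" "odd_perm w5"
      using True by (simp_all add: w12 w34 w5 odd_perm_comp odd_perm_cox_gen)
    have v: "w (int i) = p" "w (int i + 1) = q" "w (int i + 2) = t"
      "w1 (int i) = q" "w1 (int i + 1) = p" "w1 (int i + 2) = t"
      "w2 (int i) = p" "w2 (int i + 1) = t" "w2 (int i + 2) = q"
      "w3 (int i) = q" "w3 (int i + 1) = t" "w3 (int i + 2) = p"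
      "w4 (int i) = t" "w4 (int i + 1) = p" "w4 (int i + 2) = q"
      "w5 (int i) = t" "w5 (int i + 1) = q" "w5 (int i + 2) = p"
      unfolding w5 w34 w12 comp_apply e pqt by (rule refl)+
    have c: "w \<circ> ?s = w1" "w1 \<circ> ?s = w" "w \<circ> ?t = w2" "w2 \<circ> ?t = w" "w1 \<circ> ?t = w3" "w3 \<circ> ?t = w1"
      "w2 \<circ> ?s = w4" "w4 \<circ> ?s = w2" "w3 \<circ> ?s = w5" "w5 \<circ> ?s = w3" "w4 \<circ> ?t = w5" "w5 \<circ> ?t = w4"
      unfolding w5 w34 w12 
      by (rule refl | simp only: comp_cox_gen_cox_gen | simp only: wc comp_cox_gen_cox_gen)+
    \<comment> \<open>Unfolding only at the six elements of the coset; by \<open>c\<close> every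
      product with a generator is again one of them.\<close>
    note E = dd_def[of \<beta> i _ w] dd_def[of \<beta> i _ w1] dd_def[of \<beta> i _ w2]
      dd_def[of \<beta> i _ w3] dd_def[of \<beta> i _ w4] dd_def[of \<beta> i _ w5]
      dd_def[of \<beta> "i + 1" _ w] dd_def[of \<beta> "i + 1" _ w1] dd_def[of \<beta> "i + 1" _ w2]
      dd_def[of \<beta> "i + 1" _ w3] dd_def[of \<beta> "i + 1" _ w4] dd_def[of \<beta> "i + 1" _ w5]
    note E' = E[unfolded l v c, simplified o simp_thms]
    \<comment> \<open>Each comparison is kept in one orientation, so that every case below decides
      all descents.\<close>
    have sg: "q < p \<longleftrightarrow> \<not> p < q" "t < p \<longleftrightarrow> \<not> p < t" "t < q \<longleftrightarrow> \<not> q < t"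
      using ne by presburger+
    note E2 = E'[unfolded sg]
    consider "p < q" "q < t" "p < t" | "p < q" "\<not> q < t" "p < t" | "p < q" "\<not> q < t" "\<not> p < t"
      | "\<not> p < q" "q < t" "p < t" | "\<not> p < q" "q < t" "\<not> p < t" | "\<not> p < q" "\<not> q < t" "\<not> p < t"
      by linarith
    then show ?thesis
      by cases (simp_all only: E2 if_True if_False not_False_eq_True, simp_all add: algebra_simps)
  qed (simp add: dd_def)
qed

text \<open>The coset has eight elements here. By oddness all descents are governed by the signs of
  \<open>p\<close> and \<open>q\<close> and by the comparisons of \<open>p\<close> and
  \<open>- p\<close> with \<open>q\<close>; contradictory combinations of the four are
  discarded.\<close>

lemma dd_braid4:
  "dd \<beta> 0 (dd \<beta> 1 (dd \<beta> 0 (dd \<beta> 1 f))) = dd \<beta> 1 (dd \<beta> 0 (dd \<beta> 1 (dd \<beta> 0 f)))"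
proof
  fix w :: "int \<Rightarrow> int"
  let ?s = "cox_gen 0" and ?t = "cox_gen 1"
  have e: "?s (-1) = 1" "?s 1 = -1" "?s 2 = 2" "?s (-2) = -2"
    "?t (-1) = -2" "?t 1 = 2" "?t 2 = 1" "?t (-2) = -1"
    by (auto simp: cox_gen_eq swp_def lo_def up_def)
  have l: "lo 0 = -1" "up 0 = 1" "lo 1 = 1" "up 1 = 2"
    by (auto simp: lo_def up_def)
  have sts: "?s \<circ> ?t \<circ> ?s = swp (-1) 2"
    using cox_gen_conj_swp[of 0 "lo 1" "up 1"] e l by (simp only: cox_gen_eq[of 1])
  have "swp (-2) 1 = swp (-1) 2"
    using swp_uminus[of 2 "-1"] swp_commute[of 2 "-1"] by simp
  then have "?t \<circ> swp (-1) 2 = swp (-1) 2 \<circ> ?t"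
    using odd_perm_comp_swp[OF odd_perm_cox_gen, of 1 "-1" 2] e by simp
  then have wc: "w \<circ> ?s \<circ> ?t \<circ> ?s \<circ> ?t = w \<circ> ?t \<circ> ?s \<circ> ?t \<circ> ?s"
    using sts by (metis comp_assoc)
  show "dd \<beta> 0 (dd \<beta> 1 (dd \<beta> 0 (dd \<beta> 1 f))) w = dd \<beta> 1 (dd \<beta> 0 (dd \<beta> 1 (dd \<beta> 0 f))) w"
  proof (cases "odd_perm w")
    case True
    define p q where pq: "p = w 1" "q = w 2"
    define w1 w2 where w12: "w1 = w \<circ> ?s" "w2 = w \<circ> ?t"
    define w3 w4 where w34: "w3 = w1 \<circ> ?t" "w4 = w2 \<circ> ?s"
    define w5 w6 where w56: "w5 = w3 \<circ> ?s" "w6 = w4 \<circ> ?t"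
    define w7 where w7: "w7 = w5 \<circ> ?t"
    have n: "w (-1) = - w 1" "w (-2) = - w 2" using odd_perm_minus[OF True] by blast+
    have ne: "p \<noteq> q" "p \<noteq> - q" "p \<noteq> 0" "q \<noteq> 0"
      using odd_perm_eq_iff[OF True] odd_perm_eq_minus_iff[OF True] odd_perm_eq_0_iff[OF True]
      by (auto simp: pq)
    have o: "odd_perm w" "odd_perm w1" "odd_perm w2" "odd_perm w3" "odd_perm w4" "odd_perm w5"
      "odd_perm w6" "odd_perm w7"
      using True by (simp_all add: w12 w34 w56 w7 odd_perm_comp odd_perm_cox_gen)
    have v: "w (-1) = -p" "w 1 = p" "w 2 = q" "w1 (-1) = p" "w1 1 = -p" "w1 2 = q"
      "w2 (-1) = -q" "w2 1 = q" "w2 2 = p" "w3 (-1) = -q" "w3 1 = q" "w3 2 = -p"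
      "w4 (-1) = q" "w4 1 = -q" "w4 2 = p" "w5 (-1) = q" "w5 1 = -q" "w5 2 = -p"
      "w6 (-1) = -p" "w6 1 = p" "w6 2 = -q" "w7 (-1) = p" "w7 1 = -p" "w7 2 = -q"
      unfolding w7 w56 w34 w12 comp_apply e pq n by (rule refl)+
    have c: "w \<circ> ?s = w1" "w1 \<circ> ?s = w" "w \<circ> ?t = w2" "w2 \<circ> ?t = w" "w1 \<circ> ?t = w3" "w3 \<circ> ?t = w1"
      "w2 \<circ> ?s = w4" "w4 \<circ> ?s = w2" "w3 \<circ> ?s = w5" "w5 \<circ> ?s = w3" "w4 \<circ> ?t = w6" "w6 \<circ> ?t = w4"
      "w5 \<circ> ?t = w7" "w7 \<circ> ?t = w5" "w6 \<circ> ?s = w7" "w7 \<circ> ?s = w6"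
      unfolding w7 w56 w34 w12 
      by (rule refl | simp only: comp_cox_gen_cox_gen | simp only: wc comp_cox_gen_cox_gen)+
    note E = dd_def[of \<beta> 0 _ w] dd_def[of \<beta> 0 _ w1] dd_def[of \<beta> 0 _ w2] dd_def[of \<beta> 0 _ w3]
      dd_def[of \<beta> 0 _ w4] dd_def[of \<beta> 0 _ w5] dd_def[of \<beta> 0 _ w6] dd_def[of \<beta> 0 _ w7]
      dd_def[of \<beta> 1 _ w] dd_def[of \<beta> 1 _ w1] dd_def[of \<beta> 1 _ w2] dd_def[of \<beta> 1 _ w3]
      dd_def[of \<beta> 1 _ w4] dd_def[of \<beta> 1 _ w5] dd_def[of \<beta> 1 _ w6] dd_def[of \<beta> 1 _ w7]
    note E' = E[unfolded l v c, simplified o simp_thms]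
    have cmp: "p < - p \<longleftrightarrow> p < 0" "- p < p \<longleftrightarrow> 0 < p" "q < - q \<longleftrightarrow> q < 0" "- q < q \<longleftrightarrow> 0 < q"
      by presburger+
    have sg: "p < 0 \<longleftrightarrow> \<not> 0 < p" "q < 0 \<longleftrightarrow> \<not> 0 < q" "q < p \<longleftrightarrow> \<not> p < q" "- p < - q \<longleftrightarrow> \<not> p < q" "- q < - p \<longleftrightarrow> p < q"
      "q < - p \<longleftrightarrow> \<not> - p < q" "p < - q \<longleftrightarrow> \<not> - p < q" "- q < p \<longleftrightarrow> - p < q"
      using ne by presburger+
    note E2 = E'[unfolded cmp sg]
    show ?thesis
      by (cases "0 < p"; cases "0 < q"; cases "p < q"; cases "- p < q"; (linarith
          | (simp only: E2 if_True if_False not_False_eq_True, simp add: algebra_simps; fail)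
          | (simp only: E2 if_True if_False not_False_eq_True; fail)))
  qed (simp add: dd_def)
qed

section \<open>The free algebra as a ring of operators\<close>

definition wact :: "nat list \<Rightarrow> ((int \<Rightarrow> int) \<Rightarrow> int poly) \<Rightarrow> (int \<Rightarrow> int) \<Rightarrow> int poly" where
  "wact a f = fold (dd beta) a f"

definition act :: "free_alg \<Rightarrow> ((int \<Rightarrow> int) \<Rightarrow> int poly) \<Rightarrow> (int \<Rightarrow> int) \<Rightarrow> int poly" where
  "act h f w = (\<Sum>a\<in>Poly_Mapping.keys h. Poly_Mapping.lookup h a * wact (letters a) f w)"

lemma wact_append: "wact (a @ b) f = wact b (wact a f)"
  by (simp add: wact_def)

lemma wact_add: "wact a (\<lambda>w. f w + g w) = (\<lambda>w. wact a f w + wact a g w)"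
  by (induction a arbitrary: f g) (simp_all add: wact_def dd_add)

lemma wact_mult: "wact a (\<lambda>w. c * f w) = (\<lambda>w. c * wact a f w)"
  by (induction a arbitrary: f) (simp_all add: wact_def dd_mult)

lemma act_superset:
  assumes "finite A" "Poly_Mapping.keys h \<subseteq> A"
  shows "act h f w = (\<Sum>a\<in>A. Poly_Mapping.lookup h a * wact (letters a) f w)"
  unfolding act_def by (rule sum.mono_neutral_left) (use assms in \<open>auto simp: in_keys_iff\<close>)

lemma act_add: "act (h + h') f = (\<lambda>w. act h f w + act h' f w)"
proof
  fix w
  let ?A = "Poly_Mapping.keys h \<union> Poly_Mapping.keys h'"
  show "act (h + h') f w = act h f w + act h' f w"
    using Poly_Mapping.keys_add[of h h']
    by (simp add: act_superset[of ?A] lookup_add algebra_simps sum.distrib)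
qed

lemma act_single: "act (Poly_Mapping.single a c) f = (\<lambda>w. c * wact (letters a) f w)"
proof
  fix w
  show "act (Poly_Mapping.single a c) f w = c * wact (letters a) f w"
    by (subst act_superset[of "{a}"]) auto
qed

lemma act_zero: "act 0 f = (\<lambda>w. 0)"
  by (rule ext) (simp add: act_def)

lemma act_diff: "act (h - h') f = (\<lambda>w. act h f w - act h' f w)"
proof
  fix w
  have "act (h - h' + h') f w = act (h - h') f w + act h' f w" by (simp only: act_add)
  then show "act (h - h') f w = act h f w - act h' f w" by simp
qed

lemma act_fun_add: "act h (\<lambda>w. f w + g w) = (\<lambda>w. act h f w + act h g w)"
  by (rule ext) (simp add: act_def wact_add algebra_simps sum.distrib)

lemma act_fun_mult: "act h (\<lambda>w. c * f w) = (\<lambda>w. c * act h f w)"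
  by (rule ext) (simp add: act_def wact_mult sum_distrib_left mult.left_commute)

lemma poly_mapping_eq_sum_single:
  "h = (\<Sum>a\<in>Poly_Mapping.keys h. Poly_Mapping.single a (Poly_Mapping.lookup h a))"
  by (rule poly_mapping_eqI)
     (simp add: lookup_sum lookup_single when_def in_keys_iff sum.delta)

lemma poly_mapping_sum_induct [case_names zero add single]:
  fixes P :: "('a \<Rightarrow>\<^sub>0 'b::comm_monoid_add) \<Rightarrow> bool"
  assumes "P 0" "\<And>h h'. P h \<Longrightarrow> P h' \<Longrightarrow> P (h + h')" "\<And>a c. P (Poly_Mapping.single a c)"
  shows "P h"
proof -
  have "P (\<Sum>a\<in>A. Poly_Mapping.single a (Poly_Mapping.lookup h a))" if "finite A" for A
    using that by induction (auto intro: assms)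
  then show ?thesis using poly_mapping_eq_sum_single[of h] by (metis finite_keys)
qed

text \<open>Multiplication is on the right, so the left factor acts first.\<close>

lemma act_mult: "act (h * h') f = act h' (act h f)"
proof (induction h rule: poly_mapping_sum_induct)
  case (single a c)
  show ?case
  proof (induction h' rule: poly_mapping_sum_induct)
    case (single b d)
    show ?case
      by (simp add: mult_single act_single plus_u_word_def wact_append wact_mult mult_ac)
  qed (simp_all add: act_zero act_add ring_distribs)
next
  case zero
  have "act h' (\<lambda>w. 0) = (\<lambda>w. 0)" using act_fun_mult[of h' 0 f] by simp
  then show ?case by (simp add: act_zero)
qed (simp add: ring_distribs act_add act_fun_add)

lemma act_u_gen: "act (u_gen i) f = dd beta i f"
  by (simp add: u_gen_def act_single wact_def)

lemma act_scalar: "act (scalar c) f = (\<lambda>w. c * f w)"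
  by (simp add: scalar_def act_single wact_def zero_u_word_def)

lemma act_relator: "r \<in> relators n \<Longrightarrow> act r f = (\<lambda>w. 0)"
  unfolding relators_def
  by (auto simp: act_diff act_mult act_u_gen act_scalar dd_dd dd_mult dd_braid4 dd_braid3 dd_commute
      simp flip: One_nat_def simp del: mult_pCons_left split: if_splits)

text \<open>Whatever is read off through the action depends only on the class modulo the relations.
  This is what makes the basis elements independent.\<close>

lemma act_relation_ideal: "h \<in> relation_ideal n \<Longrightarrow> act h f = (\<lambda>w. 0)"
proof (induction arbitrary: f rule: relation_ideal.induct)
  case (mult r p q)
  have "act q (\<lambda>w. 0) = (\<lambda>w. 0)" using act_fun_mult[of q 0 f] by simp
  then show ?case by (simp add: act_mult act_relator[OF mult(1)])
qed (simp_all add: act_zero act_add)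

section \<open>Words\<close>

lemma word_perm_Nil: "word_perm [] = id"
  by (simp add: word_perm_def)

lemma word_perm_Cons: "word_perm (i # a) = cox_gen i \<circ> word_perm a"
  by (simp add: word_perm_def)

lemma word_perm_append: "word_perm (a @ b) = word_perm a \<circ> word_perm b"
  by (induction a) (simp_all add: word_perm_Nil word_perm_Cons comp_assoc)

lemma word_perm_snoc: "word_perm (a @ [i]) = word_perm a \<circ> cox_gen i"
  by (simp add: word_perm_append word_perm_Nil word_perm_Cons)

lemma word_perm_signed: "set a \<subseteq> {..<n} \<Longrightarrow> word_perm a \<in> signed_perms n"
  by (induction a)
     (auto simp: word_perm_Nil word_perm_Cons signed_perms_id intro: signed_perms_comp signed_perms_cox_gen)

lemma odd_perm_word_perm: "odd_perm (word_perm a)"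
  by (induction a)
     (auto simp only: word_perm_Nil word_perm_Cons intro: odd_perm_id odd_perm_comp odd_perm_cox_gen)

section \<open>Exchange property and reduced words\<close>

lemma cox_gen_reverses:
  assumes "p \<noteq> 0" "q \<noteq> 0" "p < q" "cox_gen i q < cox_gen i p"
  shows "p = lo i \<and> q = up i \<or> p = - up i \<and> q = - lo i"
  using assms unfolding cox_gen_eq swp_def lo_def up_def by (auto split: if_splits)

abbreviation desc :: "(int \<Rightarrow> int) \<Rightarrow> nat \<Rightarrow> bool" where
  "desc w i \<equiv> w (up i) < w (lo i)"

text \<open>Some letter creates the descent by multiplication on the left. Since it reverses the
  order of the entries at \<open>lo i\<close> and \<open>up i\<close>, these are the values it
  exchanges, up to sign. Multiplying by \<open>cox_gen i\<close> on the right undoes this, so the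
  letter can be deleted.\<close>

lemma exchange:
  "desc (word_perm a) i \<Longrightarrow>
     \<exists>b. set b \<subseteq> set a \<and> length b < length a \<and> word_perm b = word_perm a \<circ> cox_gen i"
proof (induction a)
  case Nil
  then show ?case using lo_less_up[of i] by (simp add: word_perm_Nil)
next
  case (Cons j a)
  let ?z = "word_perm a"
  note z = odd_perm_word_perm[of a]
  show ?case
  proof (cases "desc ?z i")
    case True
    then obtain b where "set b \<subseteq> set a" "length b < length a" "word_perm b = ?z \<circ> cox_gen i"
      using Cons.IH by blast
    then show ?thesis
      by (intro exI[of _ "j # b"]) (auto simp: word_perm_Cons comp_assoc)
  next
    case False
    have ne: "?z (lo i) \<noteq> 0" "?z (up i) \<noteq> 0" using odd_perm_eq_0_iff[OF z] by simp_all
    have "?z (lo i) < ?z (up i)"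
      using False odd_perm_eq_iff[OF z, of "lo i" "up i"] lo_less_up[of i] by linarith
    then have "?z (lo i) = lo j \<and> ?z (up i) = up j \<or> ?z (lo i) = - up j \<and> ?z (up i) = - lo j"
      using Cons.prems ne by (intro cox_gen_reverses) (auto simp: word_perm_Cons)
    then have "swp (?z (lo i)) (?z (up i)) = cox_gen j"
      by (auto simp: cox_gen_eq swp_uminus swp_commute)
    then have "?z \<circ> cox_gen i = cox_gen j \<circ> ?z" by (simp add: comp_cox_gen_eq[OF z])
    then have "word_perm (j # a) \<circ> cox_gen i = ?z"
      by (simp add: word_perm_Cons comp_assoc) (simp add: comp_assoc[symmetric] cox_gen_cox_gen)
    then show ?thesis by (intro exI[of _ a]) auto
  qed
qed

text \<open>Without descents the entries increase along -1, 1, 2, ..., n. Counting up from 0 gives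
  \<open>k <= v k\<close>, and counting down from \<open>n\<close> gives the opposite
  inequality.\<close>

lemma no_desc_imp_id:
  assumes "v \<in> signed_perms n" "\<And>i. i < n \<Longrightarrow> \<not> desc v i"
  shows "v = id"
proof -
  note o = signed_perms_odd[OF assms(1)]
  have lt: "v (lo i) < v (up i)" if "i < n" for i
    using assms(2)[OF that] odd_perm_eq_iff[OF o, of "lo i" "up i"] lo_less_up[of i] by linarith
  have ge: "int k \<le> v (int k)" if "k \<le> n" for k
    using that
  proof (induction k)
    case 0
    then show ?case by (simp add: odd_perm_0[OF o])
  next
    case (Suc k)
    show ?case
    proof (cases "k = 0")
      case True
      then show ?thesis using lt[of 0] Suc.prems odd_perm_minus[OF o, of 1] by (simp add: lo_def up_def)
    next
      case False
      then show ?thesis using lt[of k] Suc by (simp add: lo_def up_def add.commute)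
    qed
  qed
  have up: "v (int (n - j)) \<le> int (n - j)" if "j < n" for j
    using that
  proof (induction j)
    case 0
    then show ?case using signed_perms_abs_le[OF assms(1), of "int n"] by simp
  next
    case (Suc j)
    have "v (int (n - Suc j)) < v (int (n - Suc j) + 1)"
      using lt[of "n - Suc j"] Suc.prems by (simp add: lo_def up_def)
    moreover have "int (n - Suc j) + 1 = int (n - j)" using Suc.prems by simp
    ultimately show ?case using Suc by simp
  qed
  have pos: "v (int k) = int k" if "k \<le> n" for k
    using ge[OF that] up[of "n - k"] that odd_perm_0[OF o] by (cases "k = 0") (auto intro: antisym)
  show ?thesis
  proof
    fix x
    consider "int n < \<bar>x\<bar>" | k where "k \<le> n" "x = int k" | k where "k \<le> n" "x = - int k"
      by (metis abs_minus_commute abs_of_nat int_cases2 linorder_not_less nat_int_comparison(3) abs_minus_cancel)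
    then show "v x = id x"
      using assms(1) pos odd_perm_minus[OF o] by cases (auto simp: signed_perms_iff)
  qed
qed

lemma word_exists:
  assumes "v \<in> signed_perms n"
  shows "\<exists>a. set a \<subseteq> {..<n} \<and> word_perm a = v"
proof -
  \<comment> \<open>Up to a constant this is minus the sum of \<open>j * v j\<close>. Removing a
    descent moves the larger entry to the larger index or makes \<open>v 1\<close> positive; both
    decrease \<open>M\<close>.\<close>
  define M where "M v = (\<Sum>j=1..n. int j * (int n - v (int j)))" for v :: "int \<Rightarrow> int"
  show ?thesis using assms
  proof (induction "nat (M v)" arbitrary: v rule: less_induct)
    case less
    note o = signed_perms_odd[OF less.prems]
    show ?case
    proof (cases "\<exists>i<n. desc v i")
      case False
      then have "v = id" using no_desc_imp_id[OF less.prems] by blast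
      then show ?thesis by (intro exI[of _ "[]"]) (simp add: word_perm_Nil)
    next
      case True
      then obtain i where i: "i < n" "desc v i" by blast
      let ?v = "v \<circ> cox_gen i"
      have v': "?v \<in> signed_perms n"
        by (rule signed_perms_comp[OF less.prems signed_perms_cox_gen[OF i(1)]])
      have nn: "0 \<le> int j * (int n - u (int j))" if "j \<in> {1..n}" "u \<in> signed_perms n" for j u
        using signed_perms_abs_le[OF that(2), of "int j"] that(1) by simp
      have lt: "M ?v < M v"
      proof (cases "i = 0")
        case True
        have s: "cox_gen 0 (int j) = (if j = 1 then - 1 else int j)" for j
          by (auto simp: cox_gen_eq swp_def lo_def up_def)
        have "M ?v < M v" unfolding M_def
        proof (rule sum_strict_mono_ex1)
          show "\<forall>j\<in>{1..n}. int j * (int n - ?v (int j)) \<le> int j * (int n - v (int j))"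
            "\<exists>j\<in>{1..n}. int j * (int n - ?v (int j)) < int j * (int n - v (int j))"
            using i True odd_perm_minus[OF o, of 1]
            by (auto simp: s lo_def up_def intro!: bexI[of _ 1])
        qed simp
        then show ?thesis .
      next
        case False
        have s: "cox_gen i (int j) = (if j = i then int i + 1 else if j = i + 1 then int i else int j)" for j
          using False by (auto simp: cox_gen_eq swp_def lo_def up_def)
        have split: "(\<Sum>j=1..n. h j) = (\<Sum>j\<in>{1..n} - {i, i + 1}. h j) + (h i + h (i + 1))" for h :: "nat \<Rightarrow> int"
          using i(1) False by (subst sum.subset_diff[of "{i, i + 1}"]) auto
        have "(\<Sum>j\<in>{1..n} - {i, i + 1}. int j * (int n - ?v (int j)))
            = (\<Sum>j\<in>{1..n} - {i, i + 1}. int j * (int n - v (int j)))"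
          by (rule sum.cong) (auto simp: s)
        moreover have "int i * (int n - ?v (int i)) + int (i + 1) * (int n - ?v (int (i + 1)))
            < int i * (int n - v (int i)) + int (i + 1) * (int n - v (int (i + 1)))"
        proof -
          have "?v (int i) = v (int (i + 1))" "?v (int (i + 1)) = v (int i)"
            using False by (auto simp: cox_gen_eq swp_def lo_def up_def add.commute)
          moreover have "v (int (i + 1)) < v (int i)"
            using i False by (simp add: lo_def up_def add.commute)
          ultimately show ?thesis by (simp only: of_nat_add of_nat_1) (simp add: algebra_simps)
        qed
        ultimately show ?thesis unfolding M_def split by linarith
      qed
      have "0 \<le> M ?v" unfolding M_def by (rule sum_nonneg) (use nn[OF _ v'] in auto)
      then have "nat (M ?v) < nat (M v)" using lt by simp
      then obtain a where "set a \<subseteq> {..<n}" "word_perm a = ?v" using less.hyps v' by blast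
      then show ?thesis using i(1)
        by (intro exI[of _ "a @ [i]"]) (simp add: word_perm_snoc comp_cox_gen_cox_gen)
    qed
  qed
qed

lemma cox_length_le: "set a \<subseteq> {..<n} \<Longrightarrow> cox_length n (word_perm a) \<le> length a"
  unfolding cox_length_def by (rule Least_le) blast

lemma reduced_exists: assumes "v \<in> signed_perms n" shows "\<exists>a. is_reduced_word n v a"
proof -
  obtain a where "set a \<subseteq> {..<n}" "word_perm a = v" using word_exists[OF assms] by blast
  then have "\<exists>l a. set a \<subseteq> {..<n} \<and> word_perm a = v \<and> length a = l" by blast
  from LeastI_ex[OF this] show ?thesis unfolding is_reduced_word_def cox_length_def by blast
qed

text \<open>Every word of \<open>v \<circ> cox_gen i\<close> has a descent at \<open>i\<close>, and
  the exchange property shortens it to a word of \<open>v\<close>. So it is longer than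
  \<open>a\<close>.\<close>

lemma reduced_snoc:
  assumes a: "is_reduced_word n v a" and nd: "\<not> desc v i" and i: "i < n"
  shows "is_reduced_word n (v \<circ> cox_gen i) (a @ [i])"
proof -
  have w: "word_perm (a @ [i]) = v \<circ> cox_gen i" and s: "set (a @ [i]) \<subseteq> {..<n}"
    and va: "word_perm a = v"
    using a i by (auto simp: is_reduced_word_def word_perm_snoc)
  have vo: "odd_perm v" using va odd_perm_word_perm by blast
  have "v \<circ> cox_gen i \<in> signed_perms n" using word_perm_signed[OF s] w by simp
  then obtain b where b: "is_reduced_word n (v \<circ> cox_gen i) b" using reduced_exists by blast
  have "desc (word_perm b) i"
    using b nd desc_comp_cox_gen[OF vo, of i] by (auto simp: is_reduced_word_def)
  then obtain c where c: "set c \<subseteq> set b" "length c < length b" "word_perm c = word_perm b \<circ> cox_gen i"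
    using exchange by blast
  have "word_perm c = v" using c(3) b by (simp add: is_reduced_word_def comp_cox_gen_cox_gen)
  moreover have "set c \<subseteq> {..<n}" using c(1) b by (auto simp: is_reduced_word_def)
  ultimately have "length a < length b"
    using cox_length_le[of c n] c(2) a by (auto simp: is_reduced_word_def)
  moreover have "length b \<le> length (a @ [i])"
    using cox_length_le[OF s] w b by (simp add: is_reduced_word_def)
  ultimately show ?thesis using b w s by (auto simp: is_reduced_word_def)
qed

lemma reduced_butlast:
  assumes a: "is_reduced_word n v (a @ [i])"
  shows "is_reduced_word n (v \<circ> cox_gen i) a" "desc v i" "i < n"
proof -
  have w: "word_perm a = v \<circ> cox_gen i" and s: "set a \<subseteq> {..<n}" and va: "v = word_perm (a @ [i])"
    and l: "length a < cox_length n v"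
    using a by (auto simp: is_reduced_word_def word_perm_snoc comp_cox_gen_cox_gen)
  show i: "i < n" using a by (auto simp: is_reduced_word_def)
  have vo: "odd_perm v" using va odd_perm_word_perm by blast
  show "desc v i"
  proof (rule ccontr)
    assume "\<not> desc v i"
    then have "desc (word_perm a) i" using w desc_comp_cox_gen[OF vo, of i] by simp
    then obtain c where c: "set c \<subseteq> set a" "length c < length a" "word_perm c = word_perm a \<circ> cox_gen i"
      using exchange by blast
    then have "word_perm c = v" using w by (simp add: comp_cox_gen_cox_gen)
    then show False using cox_length_le[of c n] c s l by auto
  qed
  have "v \<circ> cox_gen i \<in> signed_perms n" using word_perm_signed[OF s] w by simp
  then obtain b where b: "is_reduced_word n (v \<circ> cox_gen i) b" using reduced_exists by blast
  have "word_perm (b @ [i]) = v" using b by (simp add: is_reduced_word_def word_perm_snoc comp_cox_gen_cox_gen)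
  then have "cox_length n v \<le> length (b @ [i])"
    using cox_length_le[of "b @ [i]" n] b i by (auto simp: is_reduced_word_def)
  moreover have "length b \<le> length a" using b cox_length_le[OF s] w by (simp add: is_reduced_word_def)
  ultimately show "is_reduced_word n (v \<circ> cox_gen i) a"
    using a b w s by (auto simp: is_reduced_word_def)
qed

lemma reduced_snoc_desc:
  assumes "is_reduced_word n (v \<circ> cox_gen i) a" "desc v i" "i < n" "odd_perm v"
  shows "is_reduced_word n v (a @ [i])"
proof -
  have "\<not> desc (v \<circ> cox_gen i) i" using desc_comp_cox_gen[OF assms(4), of i] assms(2) by blast
  from reduced_snoc[OF assms(1) this assms(3)] show ?thesis unfolding comp_cox_gen_cox_gen .
qed

lemma reduced_desc:
  assumes "v \<in> signed_perms n" "desc v i" "i < n"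
  shows "\<exists>c. is_reduced_word n v (c @ [i])"
proof -
  note o = signed_perms_odd[OF assms(1)]
  obtain c where "is_reduced_word n (v \<circ> cox_gen i) c"
    using reduced_exists signed_perms_comp[OF assms(1) signed_perms_cox_gen[OF assms(3)]] by blast
  then show ?thesis using reduced_snoc_desc assms o by blast
qed

text \<open>Each letter of a reduced word raises the length, so the \<beta> term of
  \<open>dd\<close> never fires and a point mass moves to a point mass.\<close>

lemma wact_reduced: "is_reduced_word n v a \<Longrightarrow> wact a (dlt id) = dlt v"
proof (induction a arbitrary: v rule: rev_induct)
  case Nil
  then show ?case by (simp add: wact_def is_reduced_word_def word_perm_Nil)
next
  case (snoc i a)
  note r = reduced_butlast[OF snoc.prems]
  have o: "odd_perm v" using snoc.prems odd_perm_word_perm by (auto simp: is_reduced_word_def)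
  have eq: "w \<circ> cox_gen i = v \<circ> cox_gen i \<longleftrightarrow> w = v" for w
    by (metis comp_cox_gen_cox_gen)
  have ne: "v \<noteq> v \<circ> cox_gen i" by (metis comp_apply cox_gen_lo less_irrefl r(2))
  have "\<not> desc (v \<circ> cox_gen i) i" using desc_comp_cox_gen[OF o, of i] r(2) by blast
  then have "dd beta i (dlt (v \<circ> cox_gen i)) w = dlt v w" for w
    using o r(2) eq[of w] ne by (auto simp: dd_def dlt_def)
  then have "dd beta i (dlt (v \<circ> cox_gen i)) = dlt v" by blast
  moreover have "wact (a @ [i]) (dlt id) = dd beta i (wact a (dlt id))" by (simp add: wact_def)
  ultimately show ?case using snoc.IH[OF r(1)] by (simp only:)
qed


section \<open>The basis of the algebra\<close>

definition uw :: "nat list \<Rightarrow> free_alg" where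
  "uw a = Poly_Mapping.single (Word a) 1"

lemma uw_Nil: "uw [] = 1"
  by (simp add: uw_def flip: zero_u_word_def)

lemma uw_append: "uw (a @ b) = uw a * uw b"
  by (simp add: uw_def mult_single plus_u_word_def)

lemma uw_single: "uw [i] = u_gen i"
  by (simp add: uw_def u_gen_def)

lemma uw_Cons: "uw (i # a) = u_gen i * uw a"
  using uw_append[of "[i]" a] by (simp add: uw_single)

lemma u_perm_eq: "u_perm n v = uw (SOME a. is_reduced_word n v a)"
proof -
  have "prod_list (map u_gen a) = uw a" for a
    by (induction a) (simp_all add: uw_Nil uw_Cons)
  then show ?thesis by (simp add: u_perm_def)
qed

lemma free_alg_on_uw: "set a \<subseteq> {..<n} \<Longrightarrow> uw a \<in> free_alg_on n"
  by (auto simp: free_alg_on_def uw_def)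

lemma free_alg_on_scalar: "scalar c \<in> free_alg_on n"
  by (auto simp: free_alg_on_def scalar_def zero_u_word_def split: if_splits)

lemma free_alg_on_mult: "f \<in> free_alg_on n \<Longrightarrow> g \<in> free_alg_on n \<Longrightarrow> f * g \<in> free_alg_on n"
  using Poly_Mapping.keys_mult[of f g] by (fastforce simp: free_alg_on_def plus_u_word_def)

lemma free_alg_on_1: "1 \<in> free_alg_on n"
  using free_alg_on_uw[of "[]" n] by (simp add: uw_Nil)

lemma free_alg_on_add: "f \<in> free_alg_on n \<Longrightarrow> g \<in> free_alg_on n \<Longrightarrow> f + g \<in> free_alg_on n"
  using Poly_Mapping.keys_add[of f g] by (fastforce simp: free_alg_on_def)

lemma free_alg_on_0: "0 \<in> free_alg_on n"
  by (simp add: free_alg_on_def)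

lemma relation_ideal_mult:
  assumes "h \<in> relation_ideal n" "f \<in> free_alg_on n" "g \<in> free_alg_on n"
  shows "f * h * g \<in> relation_ideal n"
  using assms(1)
proof induction
  case zero
  then show ?case by (simp add: relation_ideal.zero)
next
  case (add h h')
  then show ?case using relation_ideal.add by (simp add: algebra_simps)
next
  case (mult r p q)
  have "(f * p) * r * (q * g) \<in> relation_ideal n"
    by (intro relation_ideal.mult mult free_alg_on_mult assms)
  then show ?case by (simp add: mult.assoc)
qed

definition eqv :: "nat \<Rightarrow> free_alg \<Rightarrow> free_alg \<Rightarrow> bool" where
  "eqv n f g \<longleftrightarrow> f - g \<in> relation_ideal n"

lemma eqv_refl: "eqv n f f"
  by (simp add: eqv_def relation_ideal.zero)

lemma scalar_central: "scalar c * h = h * scalar c"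
proof (induction h rule: poly_mapping_sum_induct)
  case (single a d)
  then show ?case by (simp add: scalar_def mult_single mult.commute)
qed (simp_all add: algebra_simps)

lemma relation_ideal_uminus: "h \<in> relation_ideal n \<Longrightarrow> - h \<in> relation_ideal n"
proof -
  assume "h \<in> relation_ideal n"
  then have "scalar (-1) * h * 1 \<in> relation_ideal n"
    by (intro relation_ideal_mult free_alg_on_scalar free_alg_on_1)
  moreover have "scalar (-1) = - 1"
    by (simp add: scalar_def single_uminus flip: single_one)
  ultimately show ?thesis by simp
qed

lemma eqv_sym: "eqv n f g \<Longrightarrow> eqv n g f"
  using relation_ideal_uminus by (fastforce simp: eqv_def)

lemma eqv_trans [trans]: "eqv n f g \<Longrightarrow> eqv n g h \<Longrightarrow> eqv n f h"
  using relation_ideal.add by (fastforce simp: eqv_def)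

lemma eqv_add: "eqv n f g \<Longrightarrow> eqv n f' g' \<Longrightarrow> eqv n (f + f') (g + g')"
  using relation_ideal.add[of "f - g" n "f' - g'"] by (simp add: eqv_def algebra_simps)

lemma eqv_mult:
  assumes "eqv n f g" "p \<in> free_alg_on n" "q \<in> free_alg_on n"
  shows "eqv n (p * f * q) (p * g * q)"
  using relation_ideal_mult[of "f - g" n p q] assms by (simp add: eqv_def algebra_simps)

lemma eqv_right: "eqv n f g \<Longrightarrow> q \<in> free_alg_on n \<Longrightarrow> eqv n (f * q) (g * q)"
  using eqv_mult[of n f g 1 q] by (simp add: free_alg_on_1)

lemma eqv_left: "eqv n f g \<Longrightarrow> p \<in> free_alg_on n \<Longrightarrow> eqv n (p * f) (p * g)"
  using eqv_mult[of n f g p 1] by (simp add: free_alg_on_1)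

lemma eqv_relator: "f - g \<in> relators n \<Longrightarrow> eqv n f g"
  using relation_ideal.mult[of "f - g" n 1 1] by (simp add: eqv_def free_alg_on_1)

lemma eqv_square: "i < n \<Longrightarrow> eqv n (uw [i, i]) (scalar beta * uw [i])"
  by (rule eqv_relator) (auto simp: relators_def uw_Cons uw_Nil)

lemma eqv_comm: "i < n \<Longrightarrow> j < n \<Longrightarrow> 1 < \<bar>int i - int j\<bar> \<Longrightarrow> eqv n (uw [i, j]) (uw [j, i])"
  by (rule eqv_relator) (auto simp: relators_def uw_Cons uw_Nil)

lemma eqv_braid3: "0 < i \<Longrightarrow> i + 1 < n \<Longrightarrow> eqv n (uw [i, i + 1, i]) (uw [i + 1, i, i + 1])"
  by (rule eqv_relator) (auto simp: relators_def uw_Cons uw_Nil mult.assoc)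

lemma eqv_braid4: "1 < n \<Longrightarrow> eqv n (uw [1, 0, 1, 0]) (uw [0, 1, 0, 1])"
  by (rule eqv_relator) (auto simp: relators_def uw_Cons uw_Nil mult.assoc)

section \<open>Braid relations between reduced words\<close>

lemma cox_gen_values:
  "0 < i \<Longrightarrow> cox_gen i (int i) = int i + 1" "0 < i \<Longrightarrow> cox_gen i (int i + 1) = int i"
  "0 < i \<Longrightarrow> cox_gen i (int i + 2) = int i + 2"
  "0 < i \<Longrightarrow> cox_gen (i + 1) (int i) = int i" "0 < i \<Longrightarrow> cox_gen (i + 1) (int i + 1) = int i + 2"
  "0 < i \<Longrightarrow> cox_gen (i + 1) (int i + 2) = int i + 1"
  "cox_gen 0 (-1) = 1" "cox_gen 0 1 = -1" "cox_gen 0 2 = 2" "cox_gen 0 (-2) = -2"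
  "cox_gen 1 (-1) = -2" "cox_gen 1 1 = 2" "cox_gen 1 2 = 1" "cox_gen 1 (-2) = -1"
  by (auto simp: cox_gen_eq swp_def lo_def up_def)

text \<open>With descents at both places, either alternating sequence of three letters can be
  stripped from \<open>v\<close>. By the braid relation in the group both leave the same element, of
  which \<open>c\<close> is a reduced word.\<close>

lemma reduced_braid3:
  assumes "0 < i" "i + 1 < n" "v \<in> signed_perms n" "desc v i" "desc v (i + 1)"
  shows "\<exists>c. is_reduced_word n v ((c @ [i, i + 1]) @ [i]) \<and> is_reduced_word n v ((c @ [i + 1, i]) @ [i + 1])"
proof -
  let ?s = "cox_gen i" and ?t = "cox_gen (i + 1)"
  note e = cox_gen_values(1-6)[OF assms(1)]
  have l: "lo i = int i" "up i = int i + 1" "lo (i + 1) = int i + 1" "up (i + 1) = int i + 2"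
    using assms(1) by (auto simp: lo_def up_def)
  have sp: "?s \<in> signed_perms n" "?t \<in> signed_perms n"
    using assms(2) signed_perms_cox_gen[of i n] signed_perms_cox_gen[of "i + 1" n] by auto
  have "?s \<circ> ?t \<circ> ?s = ?t \<circ> ?s \<circ> ?t"
    using cox_gen_conj_swp[of i "lo (i + 1)" "up (i + 1)"] cox_gen_conj_swp[of "i + 1" "lo i" "up i"] e l
    by (simp only: cox_gen_eq[of "i + 1"] cox_gen_eq[of i])
  then have wc: "v \<circ> ?s \<circ> ?t \<circ> ?s = v \<circ> ?t \<circ> ?s \<circ> ?t" by (simp only: comp_assoc)
  obtain c where c: "is_reduced_word n (v \<circ> ?s \<circ> ?t \<circ> ?s) c"
    using reduced_exists[OF signed_perms_comp[OF signed_perms_comp[OF signed_perms_comp[OF assms(3) sp(1)] sp(2)] sp(1)]]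
    by blast
  have o: "odd_perm v" "odd_perm (v \<circ> ?s)" "odd_perm (v \<circ> ?s \<circ> ?t)" "odd_perm (v \<circ> ?t)" "odd_perm (v \<circ> ?t \<circ> ?s)"
    by (intro odd_perm_comp odd_perm_cox_gen signed_perms_odd[OF assms(3)])+
  have d: "desc (v \<circ> ?s) (i + 1)" "desc (v \<circ> ?s \<circ> ?t) i" "desc (v \<circ> ?t) i" "desc (v \<circ> ?t \<circ> ?s) (i + 1)"
    using assms(4,5) unfolding l comp_apply e by auto
  have i: "i < n" using assms(2) by simp
  have "is_reduced_word n v (((c @ [i]) @ [i + 1]) @ [i])"
    by (intro reduced_snoc_desc c assms i o d)
  moreover have "is_reduced_word n v (((c @ [i + 1]) @ [i]) @ [i + 1])"
    by (intro reduced_snoc_desc c[unfolded wc] assms i o d)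
  ultimately show ?thesis by (intro exI[of _ c]) simp
qed

lemma reduced_braid4:
  assumes "1 < n" "v \<in> signed_perms n" "desc v 0" "desc v 1"
  shows "\<exists>c. is_reduced_word n v ((c @ [1, 0, 1]) @ [0]) \<and> is_reduced_word n v ((c @ [0, 1, 0]) @ [1])"
proof -
  let ?s = "cox_gen 0" and ?t = "cox_gen 1"
  note e = cox_gen_values(7-14)
  have l: "lo 0 = -1" "up 0 = 1" "lo 1 = 1" "up 1 = 2"
    by (auto simp: lo_def up_def)
  have sp: "?s \<in> signed_perms n" "?t \<in> signed_perms n"
    using assms(1) signed_perms_cox_gen[of 0 n] signed_perms_cox_gen[of 1 n] by auto
  have sts: "?s \<circ> ?t \<circ> ?s = swp (-1) 2"
    using cox_gen_conj_swp[of 0 "lo 1" "up 1"] e l by (simp only: cox_gen_eq[of 1])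
  have "swp (-2) 1 = swp (-1) 2"
    using swp_uminus[of 2 "-1"] swp_commute[of 2 "-1"] by simp
  then have "?t \<circ> swp (-1) 2 = swp (-1) 2 \<circ> ?t"
    using odd_perm_comp_swp[OF odd_perm_cox_gen, of 1 "-1" 2] e by simp
  then have wc: "v \<circ> ?s \<circ> ?t \<circ> ?s \<circ> ?t = v \<circ> ?t \<circ> ?s \<circ> ?t \<circ> ?s"
    using sts by (metis comp_assoc)
  obtain c where c: "is_reduced_word n (v \<circ> ?s \<circ> ?t \<circ> ?s \<circ> ?t) c"
    using reduced_exists[OF signed_perms_comp[OF signed_perms_comp[OF signed_perms_comp[OF signed_perms_comp
      [OF assms(2) sp(1)] sp(2)] sp(1)] sp(2)]] by blast
  note vo = signed_perms_odd[OF assms(2)]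
  have o: "odd_perm v" "odd_perm (v \<circ> ?s)" "odd_perm (v \<circ> ?s \<circ> ?t)" "odd_perm (v \<circ> ?s \<circ> ?t \<circ> ?s)"
    "odd_perm (v \<circ> ?t)" "odd_perm (v \<circ> ?t \<circ> ?s)" "odd_perm (v \<circ> ?t \<circ> ?s \<circ> ?t)"
    by (intro odd_perm_comp odd_perm_cox_gen vo)+
  have n: "v (-1) = - v 1" "v (-2) = - v 2" using odd_perm_minus[OF vo] by blast+
  have d: "desc (v \<circ> ?s) 1" "desc (v \<circ> ?s \<circ> ?t) 0" "desc (v \<circ> ?s \<circ> ?t \<circ> ?s) 1"
    "desc (v \<circ> ?t) 0" "desc (v \<circ> ?t \<circ> ?s) 1" "desc (v \<circ> ?t \<circ> ?s \<circ> ?t) 0"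
    using assms(3,4) unfolding l comp_apply e n by auto
  have i: "0 < n" using assms(1) by simp
  have "is_reduced_word n v ((((c @ [1]) @ [0]) @ [1]) @ [0])"
    by (intro reduced_snoc_desc c assms i o d)
  moreover have "is_reduced_word n v ((((c @ [0]) @ [1]) @ [0]) @ [1])"
    by (intro reduced_snoc_desc c[unfolded wc] assms i o d)
  ultimately show ?thesis by (intro exI[of _ c]) simp
qed

text \<open>Matsumoto's theorem: two different final letters of reduced words of \<open>v\<close> are both descents
  of \<open>v\<close>, so \<open>v\<close> also has reduced words ending in the two sides of a braid relation.\<close>

lemma reduced_words_eqv:
  "is_reduced_word n v a \<Longrightarrow> is_reduced_word n v b \<Longrightarrow> eqv n (uw a) (uw b)"
proof (induction "length a" arbitrary: v a b)
  case 0
  then show ?case by (simp add: is_reduced_word_def eqv_refl)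
next
  case (Suc l)
  have lb: "length b = Suc l" using Suc.prems Suc.hyps(2) by (simp add: is_reduced_word_def)
  obtain a' i where a: "a = a' @ [i]" using Suc.hyps(2) by (cases a rule: rev_cases) auto
  obtain b' j where b: "b = b' @ [j]" using lb by (cases b rule: rev_cases) auto
  note ra = reduced_butlast[OF Suc.prems(1)[unfolded a]]
  note rb = reduced_butlast[OF Suc.prems(2)[unfolded b]]
  have vs: "v \<in> signed_perms n"
    using Suc.prems(1) word_perm_signed by (auto simp: is_reduced_word_def)
  note o = signed_perms_odd[OF vs]
  have IHa: "eqv n (uw (a' @ [i])) (uw (c @ [i]))" if "is_reduced_word n v (c @ [i])" for c
    using eqv_right[OF Suc.hyps(1)[OF _ ra(1) reduced_butlast(1)[OF that]] free_alg_on_uw[of "[i]" n]]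
      Suc.hyps(2) a ra(3) by (simp add: uw_append)
  have IHb: "eqv n (uw (b' @ [j])) (uw (c @ [j]))" if "is_reduced_word n v (c @ [j])" for c
    using eqv_right[OF Suc.hyps(1)[OF _ rb(1) reduced_butlast(1)[OF that]] free_alg_on_uw[of "[j]" n]]
      lb b rb(3) by (simp add: uw_append)
  \<comment> \<open>The induction hypothesis leads from \<open>a\<close> to a word with the same
    last letter, and likewise from \<open>b\<close>; the two intermediate words differ by one
    relation at the end.\<close>
  have fin: ?case if "is_reduced_word n v ((c @ p) @ [i])" "is_reduced_word n v ((c @ q) @ [j])"
    "eqv n (uw (p @ [i])) (uw (q @ [j]))" for c p q
  proof -
    have "set c \<subseteq> {..<n}" using that(1) by (auto simp: is_reduced_word_def)
    from eqv_left[OF that(3) free_alg_on_uw[OF this]]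
    have "eqv n (uw ((c @ p) @ [i])) (uw ((c @ q) @ [j]))" by (simp add: uw_append mult.assoc)
    with IHa[OF that(1)] IHb[OF that(2)] show ?thesis
      unfolding a b by (meson eqv_sym eqv_trans)
  qed
  have cas: ?case if ij: "i = j"
    using IHa[of b'] Suc.prems(2) ij a b by simp
  have red: "\<exists>c. is_reduced_word n u c" if "u \<in> signed_perms n" for u
    using reduced_exists[OF that] .
  show ?case
  proof (cases "i = j")
    case True
    then show ?thesis by (rule cas)
  next
    case False
    consider (far) "1 < \<bar>int i - int j\<bar>" | (up3) "0 < i" "j = i + 1" | (dn3) "0 < j" "i = j + 1"
      | (up4) "i = 0" "j = 1" | (dn4) "i = 1" "j = 0"
      using False by linarith
    then show ?thesis
    proof cases
      case far
      have e: "cox_gen i (up j) = up j" "cox_gen i (lo j) = lo j" "cox_gen j (up i) = up i" "cox_gen j (lo i) = lo i"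
        using far by (auto simp: cox_gen_eq swp_def lo_def up_def)
      have cm: "cox_gen i \<circ> cox_gen j = cox_gen j \<circ> cox_gen i"
        using odd_perm_comp_swp[OF odd_perm_cox_gen, of i "lo j" "up j"] e by (simp add: cox_gen_eq[of j])
      let ?u = "v \<circ> cox_gen i \<circ> cox_gen j"
      have u2: "?u = v \<circ> cox_gen j \<circ> cox_gen i" by (simp only: comp_assoc cm)
      have "?u \<in> signed_perms n"
        by (intro signed_perms_comp vs signed_perms_cox_gen ra rb)
      then obtain c where c: "is_reduced_word n ?u c" using red by blast
      have os: "odd_perm (v \<circ> cox_gen i)" "odd_perm (v \<circ> cox_gen j)"
        using o odd_perm_comp odd_perm_cox_gen by blast+
      have d: "desc (v \<circ> cox_gen i) j" "desc (v \<circ> cox_gen j) i"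
        using ra(2) rb(2) e unfolding comp_apply by auto
      have r1: "is_reduced_word n v ((c @ [j]) @ [i])"
        by (intro reduced_snoc_desc c ra rb o os d)
      have r2: "is_reduced_word n v ((c @ [i]) @ [j])"
        by (intro reduced_snoc_desc c[unfolded u2] ra rb o os d)
      have "1 < \<bar>int j - int i\<bar>" using far by linarith
      then show ?thesis using fin[OF r1 r2] eqv_comm[OF rb(3) ra(3)] by simp
    next
      case up3
      obtain c where "is_reduced_word n v ((c @ [i, i + 1]) @ [i])" "is_reduced_word n v ((c @ [i + 1, i]) @ [j])"
        using reduced_braid3[of i n v] vs ra(2,3) rb(2,3) up3 unfolding up3 by blast
      moreover have "eqv n (uw ([i, i + 1] @ [i])) (uw ([i + 1, i] @ [j]))"
        using eqv_braid3[of i n] up3 ra(3) rb(3) by simp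
      ultimately show ?thesis by (rule fin)
    next
      case dn3
      obtain c where "is_reduced_word n v ((c @ [j + 1, j]) @ [i])" "is_reduced_word n v ((c @ [j, j + 1]) @ [j])"
        using reduced_braid3[of j n v] vs ra(2,3) rb(2,3) dn3 unfolding dn3 by blast
      moreover have "eqv n (uw ([j + 1, j] @ [i])) (uw ([j, j + 1] @ [j]))"
        using eqv_sym[OF eqv_braid3[of j n]] dn3 ra(3) rb(3) by simp
      ultimately show ?thesis by (rule fin)
    next
      case up4
      obtain c where "is_reduced_word n v ((c @ [1, 0, 1]) @ [i])" "is_reduced_word n v ((c @ [0, 1, 0]) @ [j])"
        using reduced_braid4[of n v] vs ra(2,3) rb(2,3) up4 unfolding up4 by blast
      moreover have "eqv n (uw ([1, 0, 1] @ [i])) (uw ([0, 1, 0] @ [j]))"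
        using eqv_braid4[of n] up4 ra(3) rb(3) by simp
      ultimately show ?thesis by (rule fin)
    next
      case dn4
      obtain c where "is_reduced_word n v ((c @ [0, 1, 0]) @ [i])" "is_reduced_word n v ((c @ [1, 0, 1]) @ [j])"
        using reduced_braid4[of n v] vs ra(2,3) rb(2,3) dn4 unfolding dn4 by blast
      moreover have "eqv n (uw ([0, 1, 0] @ [i])) (uw ([1, 0, 1] @ [j]))"
        using eqv_sym[OF eqv_braid4[of n]] dn4 ra(3) rb(3) by simp
      ultimately show ?thesis by (rule fin)
    qed
  qed
qed


section \<open>Spanning and uniqueness of coefficients\<close>

lemma u_perm_eqv:
  assumes "is_reduced_word n v a" shows "eqv n (uw a) (u_perm n v)"
  unfolding u_perm_eq by (rule reduced_words_eqv[OF assms someI[of "is_reduced_word n v", OF assms]])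

text \<open>Letters multiply as in the Demazure product: a letter either lengthens \<open>v\<close>,
  or it is absorbed by a reduced word of \<open>v\<close> ending in it, at the cost of one factor
  \<open>beta\<close>.\<close>

lemma word_eqv_u_perm:
  "set a \<subseteq> {..<n} \<Longrightarrow> \<exists>k. \<exists>v\<in>signed_perms n. eqv n (uw a) (scalar (beta ^ k) * u_perm n v)"
proof (induction a rule: rev_induct)
  case Nil
  have "is_reduced_word n id []"
    using cox_length_le[of "[]" n] by (simp add: is_reduced_word_def word_perm_Nil)
  then have "eqv n (uw []) (scalar (beta ^ 0) * u_perm n id)"
    using u_perm_eqv[of n id "[]"] by (simp add: scalar_def)
  then show ?case using signed_perms_id by blast
next
  case (snoc i a)
  then obtain k v where v: "v \<in> signed_perms n" "eqv n (uw a) (scalar (beta ^ k) * u_perm n v)" by auto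
  have i: "i < n" "uw [i] \<in> free_alg_on n" using snoc.prems free_alg_on_uw[of "[i]" n] by auto
  have *: "eqv n (uw (a @ [i])) (scalar (beta ^ k) * (u_perm n v * uw [i]))"
    using eqv_right[OF v(2) i(2)] by (simp add: uw_append mult.assoc)
  obtain b where b: "is_reduced_word n v b" using reduced_exists[OF v(1)] by blast
  show ?case
  proof (cases "desc v i")
    case False
    have "eqv n (u_perm n v * uw [i]) (uw b * uw [i])"
      by (rule eqv_right[OF eqv_sym[OF u_perm_eqv[OF b]] i(2)])
    also have "eqv n (uw b * uw [i]) (u_perm n (v \<circ> cox_gen i))"
      using u_perm_eqv[OF reduced_snoc[OF b False i(1)]] by (simp add: uw_append)
    finally have "eqv n (uw (a @ [i])) (scalar (beta ^ k) * u_perm n (v \<circ> cox_gen i))"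
      using * eqv_left[OF _ free_alg_on_scalar] eqv_trans by blast
    then show ?thesis using signed_perms_comp[OF v(1) signed_perms_cox_gen[OF i(1)]] by blast
  next
    case True
    obtain c where c: "is_reduced_word n v (c @ [i])" using reduced_desc[OF v(1) True i(1)] by blast
    have cs: "uw c \<in> free_alg_on n" using c by (intro free_alg_on_uw) (auto simp: is_reduced_word_def)
    have "eqv n (u_perm n v * uw [i]) (uw (c @ [i]) * uw [i])"
      by (rule eqv_right[OF eqv_sym[OF u_perm_eqv[OF c]] i(2)])
    also have "uw (c @ [i]) * uw [i] = uw c * uw [i, i]"
      by (simp flip: uw_append)
    also have "eqv n (uw c * uw [i, i]) (uw c * (scalar beta * uw [i]))"
      by (rule eqv_left[OF eqv_square[OF i(1)] cs])
    also have "uw c * (scalar beta * uw [i]) = scalar beta * uw (c @ [i])"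
      by (simp only: mult.assoc[symmetric] scalar_central[of beta "uw c"] uw_append)
    also have "eqv n (scalar beta * uw (c @ [i])) (scalar beta * u_perm n v)"
      by (rule eqv_left[OF u_perm_eqv[OF c] free_alg_on_scalar])
    finally have "eqv n (uw (a @ [i])) (scalar (beta ^ k) * (scalar beta * u_perm n v))"
      using * eqv_left[OF _ free_alg_on_scalar] eqv_trans by blast
    moreover have "scalar (beta ^ k) * scalar beta = scalar (beta ^ Suc k)"
      by (simp add: scalar_def mult_single mult.commute)
    ultimately have "eqv n (uw (a @ [i])) (scalar (beta ^ Suc k) * u_perm n v)"
      by (simp only: mult.assoc[symmetric])
    then show ?thesis using v(1) by blast
  qed
qed

lemma scalar_add: "scalar (c + d) = scalar c + scalar d"
  by (simp add: scalar_def single_add)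

lemma scalar_mult: "scalar (c * d) = scalar c * scalar d"
  by (simp add: scalar_def mult_single)

lemma scalar_0: "scalar 0 = 0"
  by (simp add: scalar_def)

lemma spanned:
  assumes "h \<in> free_alg_on n"
  shows "\<exists>c. (\<forall>v. v \<notin> signed_perms n \<longrightarrow> c v = 0) \<and>
    eqv n h (\<Sum>v\<in>signed_perms n. scalar (c v) * u_perm n v)"
proof -
  define P where "P h \<longleftrightarrow> (\<exists>c. (\<forall>v. v \<notin> signed_perms n \<longrightarrow> c v = 0) \<and>
    eqv n h (\<Sum>v\<in>signed_perms n. scalar (c v) * u_perm n v))" for h
  have add: "P (f + g)" if "P f" "P g" for f g
  proof -
    obtain c where "\<forall>v. v \<notin> signed_perms n \<longrightarrow> c v = 0"
      "eqv n f (\<Sum>v\<in>signed_perms n. scalar (c v) * u_perm n v)"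
      using \<open>P f\<close> unfolding P_def by blast
    moreover obtain d where "\<forall>v. v \<notin> signed_perms n \<longrightarrow> d v = 0"
      "eqv n g (\<Sum>v\<in>signed_perms n. scalar (d v) * u_perm n v)"
      using \<open>P g\<close> unfolding P_def by blast
    ultimately show ?thesis unfolding P_def
      using eqv_add[of n f _ g "\<Sum>v\<in>signed_perms n. scalar (d v) * u_perm n v"]
      by (intro exI[of _ "\<lambda>v. c v + d v"]) (auto simp: scalar_add ring_distribs sum.distrib)
  qed
  have word: "P (Poly_Mapping.single a x)" if lt: "set (letters a) \<subseteq> {..<n}" for a x
  proof -
    obtain k v where v: "v \<in> signed_perms n" "eqv n (uw (letters a)) (scalar (beta ^ k) * u_perm n v)"
      using word_eqv_u_perm[OF lt] by blast
    have "Poly_Mapping.single a x = scalar x * uw (letters a)"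
      by (simp add: scalar_def uw_def mult_single zero_u_word_def plus_u_word_def)
    then have "eqv n (Poly_Mapping.single a x) (scalar (x * beta ^ k) * u_perm n v)"
      using eqv_left[OF v(2) free_alg_on_scalar[of x]] by (simp add: scalar_mult mult.assoc)
    moreover have "(\<Sum>u\<in>signed_perms n. scalar (if u = v then x * beta ^ k else 0) * u_perm n u)
        = scalar (x * beta ^ k) * u_perm n v"
      using v(1) finite_signed_perms
      by (subst sum.remove[of _ v]) (auto simp: scalar_0 intro!: sum.neutral)
    ultimately show ?thesis unfolding P_def using v(1)
      by (intro exI[of _ "\<lambda>u. if u = v then x * beta ^ k else 0"]) auto
  qed
  have zero: "P 0" unfolding P_def
    by (intro exI[of _ "\<lambda>v. 0"]) (simp add: scalar_0 eqv_refl)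
  have "P (\<Sum>a\<in>A. Poly_Mapping.single a (Poly_Mapping.lookup h a))"
    if "finite A" "A \<subseteq> Poly_Mapping.keys h" for A
    using that
  proof induction
    case (insert a A)
    have "set (letters a) \<subseteq> {..<n}" using insert.prems assms by (auto simp: free_alg_on_def)
    then show ?case using insert by (auto intro!: add word)
  qed (simp add: zero)
  then have "P h" using poly_mapping_eq_sum_single[of h] by (metis finite_keys order_refl)
  then show ?thesis unfolding P_def .
qed

text \<open>Acting on the point mass at the identity sends \<open>u_perm n v\<close> to the point
  mass at \<open>v\<close> and kills the ideal, so any expansion has these coefficients. Together
  with \<open>spanned\<close> this justifies the definite description.\<close>

lemma u_coeff_eq:
  assumes "h \<in> free_alg_on n" "w \<in> signed_perms n"
  shows "u_coeff n h w = act h (dlt id) w"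
proof -
  let ?Q = "\<lambda>c. (\<forall>v. v \<notin> signed_perms n \<longrightarrow> c v = 0) \<and>
    h - (\<Sum>v\<in>signed_perms n. scalar (c v) * u_perm n v) \<in> relation_ideal n"
  let ?c = "\<lambda>v. if v \<in> signed_perms n then act h (dlt id) v else 0"
  have act_u_perm: "act (u_perm n v) (dlt id) = dlt v" if "v \<in> signed_perms n" for v
    using reduced_exists[OF that] wact_reduced someI_ex[of "is_reduced_word n v"]
    by (auto simp: u_perm_eq uw_def act_single)
  have act_sum: "act (\<Sum>v\<in>A. g v) f w = (\<Sum>v\<in>A. act (g v) f w)" for A g f w
    by (induction A rule: infinite_finite_induct) (simp_all add: act_zero act_add)
  have uniq: "c = ?c" if c: "?Q c" for c
  proof
    fix v
    show "c v = ?c v"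
    proof (cases "v \<in> signed_perms n")
      case True
      have "act h (dlt id) v = act (\<Sum>v\<in>signed_perms n. scalar (c v) * u_perm n v) (dlt id) v"
        using act_relation_ideal[of _ n "dlt id"] c act_diff
        by (metis (no_types, lifting) eq_iff_diff_eq_0)
      also have "\<dots> = (\<Sum>u\<in>signed_perms n. c u * dlt u v)"
      proof -
        have "scalar x * u_perm n u = u_perm n u * scalar x" for x u by (rule scalar_central)
        then show ?thesis
          by (simp add: act_sum act_mult act_scalar act_u_perm)
      qed
      also have "\<dots> = c v"
        using True finite_signed_perms
        by (simp add: dlt_def if_distrib[of "(*) _"] sum.delta' cong: if_cong)
      finally show ?thesis using True by simp
    qed (use c in simp)
  qed
  obtain c where c: "?Q c" using spanned[OF assms(1)] unfolding eqv_def by blast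
  have "u_coeff n h = c"
    unfolding u_coeff_def
  proof (rule the_equality, rule c)
    fix d
    assume "?Q d"
    then have "d = ?c" by (rule uniq)
    then show "d = c" using uniq[OF c] by simp
  qed
  then show ?thesis using assms(2) uniq[OF c] by simp
qed

section \<open>The generating function\<close>

definition opx :: "'a::comm_ring_1 \<Rightarrow> 'a \<Rightarrow> nat \<Rightarrow> ((int \<Rightarrow> int) \<Rightarrow> 'a) \<Rightarrow> (int \<Rightarrow> int) \<Rightarrow> 'a" where
  "opx \<beta> x i f w = f w + x * dd \<beta> i f w"

definition factor :: "'a::comm_ring_1 \<Rightarrow> 'a \<Rightarrow> nat \<Rightarrow> ((int \<Rightarrow> int) \<Rightarrow> 'a) \<Rightarrow> (int \<Rightarrow> int) \<Rightarrow> 'a" where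
  "factor \<beta> x n = fold (opx \<beta> x) (rev [0..<n] @ [0..<n])"

type_synonym ser = "monomial \<Rightarrow>\<^sub>0 int poly"

definition bR :: ser where "bR = Poly_Mapping.single 0 beta"
definition xv :: "nat \<Rightarrow> ser" where "xv i = Poly_Mapping.single (Poly_Mapping.single i 1) 1"

text \<open>Cutting off after \<open>N\<close> variables yields polynomials, in which nonzero
  factors can be cancelled; a coefficient of the infinite product is found in any sufficiently long
  partial product.\<close>

definition FF :: "nat \<Rightarrow> nat \<Rightarrow> (int \<Rightarrow> int) \<Rightarrow> ser" where
  "FF n N = fold (\<lambda>i. factor bR (xv i) n) [1..<Suc N] (dlt id)"

lemma FF_0: "FF n 0 = dlt id"
  by (simp add: FF_def)

lemma FF_Suc: "FF n (Suc N) = factor bR (xv (Suc N)) n (FF n N)"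
  by (simp add: FF_def)

lemma lookup_times_single_add:
  fixes H :: "monomial \<Rightarrow>\<^sub>0 'b::semiring_0"
  shows "Poly_Mapping.lookup (H * Poly_Mapping.single k u) (m + k) = Poly_Mapping.lookup H m * u"
  by (induction H rule: poly_mapping_sum_induct)
     (auto simp: mult_single lookup_single lookup_add ring_distribs when_def)

lemma lookup_times_single_none:
  fixes H :: "monomial \<Rightarrow>\<^sub>0 'b::semiring_0"
  assumes "\<And>m'. m \<noteq> m' + k"
  shows "Poly_Mapping.lookup (H * Poly_Mapping.single k u) m = 0"
  using assms
  by (induction H rule: poly_mapping_sum_induct)
     (auto simp: mult_single lookup_single lookup_add ring_distribs when_def)

lemma lookup_bR_times: "Poly_Mapping.lookup (bR * g) m = beta * Poly_Mapping.lookup g m"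
  using lookup_times_single_add[of g 0 beta m] by (simp only: bR_def mult.commute add_0_right)

text \<open>Links two orders of expansion: by monomials with coefficients in the algebra, and by
  group elements with polynomial coefficients.\<close>

definition represents :: "(monomial \<Rightarrow>\<^sub>0 free_alg) \<Rightarrow> ((int \<Rightarrow> int) \<Rightarrow> ser) \<Rightarrow> bool" where
  "represents H f \<longleftrightarrow>
     (\<forall>m w. Poly_Mapping.lookup (f w) m = act (Poly_Mapping.lookup H m) (dlt id) w)"

lemma represents_1: "represents 1 (dlt id)"
proof -
  have 1: "act 1 f = f" for f
    using act_scalar[of 1 f] by (simp add: scalar_def)
  show ?thesis
    by (auto simp: represents_def dlt_def lookup_one when_def act_zero 1)
qed

lemma represents_dd:
  assumes "represents H f"
  shows "Poly_Mapping.lookup (dd bR a f w) m = act (Poly_Mapping.lookup H m * u_gen a) (dlt id) w"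
  using assms by (simp add: represents_def dd_def lookup_add lookup_bR_times act_mult act_u_gen del: mult_pCons_left)

lemma represents_step:
  assumes "represents H f"
  shows "represents (H * (1 + Poly_Mapping.single (Poly_Mapping.single i 1) (u_gen a))) (opx bR (xv i) a f)"
  unfolding represents_def
proof (intro allI)
  fix m w
  let ?k = "Poly_Mapping.single i (1::nat)"
  have e: "opx bR (xv i) a f w = f w + dd bR a f w * Poly_Mapping.single ?k 1"
    by (simp add: opx_def xv_def mult.commute)
  have h: "H * (1 + Poly_Mapping.single ?k (u_gen a)) = H + H * Poly_Mapping.single ?k (u_gen a)"
    by (simp add: ring_distribs)
  have "Poly_Mapping.lookup (dd bR a f w * Poly_Mapping.single ?k 1) m
      = act (Poly_Mapping.lookup (H * Poly_Mapping.single ?k (u_gen a)) m) (dlt id) w"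
  proof (cases "\<exists>m'. m = m' + ?k")
    case True
    then obtain m' where m: "m = m' + ?k" by blast
    show ?thesis
      unfolding m lookup_times_single_add using represents_dd[OF assms, of a w m'] by simp
  next
    case False
    then have "\<And>m'. m \<noteq> m' + ?k" by blast
    then show ?thesis by (simp add: lookup_times_single_none act_zero)
  qed
  then show "Poly_Mapping.lookup (opx bR (xv i) a f w) m
      = act (Poly_Mapping.lookup (H * (1 + Poly_Mapping.single ?k (u_gen a))) m) (dlt id) w"
    using assms unfolding e h by (simp add: represents_def lookup_add act_add)
qed

lemma represents_factor:
  assumes "represents H f"
  shows "represents (H * x_factor n i) (factor bR (xv i) n f)"
proof -
  have "represents (H * prod_list (map (\<lambda>a. 1 + Poly_Mapping.single (Poly_Mapping.single i 1) (u_gen a)) as))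
      (fold (opx bR (xv i)) as f)" for as
    using assms
  proof (induction as arbitrary: H f)
    case (Cons a as)
    show ?case using Cons.IH[OF represents_step[OF Cons.prems]] by (simp add: mult.assoc)
  qed simp
  then show ?thesis by (simp only: x_factor_def factor_def)
qed

lemma partial_product_Suc: "partial_product n (Suc N) = partial_product n N * x_factor n (Suc N)"
  by (simp add: partial_product_def)

lemma represents_FF: "represents (partial_product n N) (FF n N)"
proof (induction N)
  case 0
  then show ?case using represents_1 by (simp add: partial_product_def FF_0)
next
  case (Suc N)
  then show ?case using represents_factor by (simp add: partial_product_Suc FF_Suc)
qed

text \<open>A monomial free of the variable can only pick up the constant term 1 of each factor;
  hence the coefficients stabilise.\<close>

lemma lookup_times_x_factor:
  assumes "Poly_Mapping.lookup m i = 0"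
  shows "Poly_Mapping.lookup (H * x_factor n i) m = Poly_Mapping.lookup H m"
proof -
  have no: "m \<noteq> m' + Poly_Mapping.single i 1" for m'
    using assms by (auto simp: lookup_add)
  have "Poly_Mapping.lookup (H * prod_list (map (\<lambda>a. 1 + Poly_Mapping.single (Poly_Mapping.single i 1) (u_gen a)) as)) m
      = Poly_Mapping.lookup H m" for as
  proof (induction as arbitrary: H)
    case (Cons a as)
    let ?s = "Poly_Mapping.single (Poly_Mapping.single i 1) (u_gen a)"
    have "Poly_Mapping.lookup (H * (1 + ?s)) m = Poly_Mapping.lookup H m"
      using lookup_times_single_none[OF no, of H "u_gen a"] by (simp add: ring_distribs lookup_add)
    then show ?case using Cons.IH[of "H * (1 + ?s)"] by (simp add: mult.assoc)
  qed simp
  then show ?thesis by (simp only: x_factor_def)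
qed

lemma lookup_partial_product_stable:
  assumes "\<forall>i\<in>Poly_Mapping.keys m. i \<le> N" "N \<le> M"
  shows "Poly_Mapping.lookup (partial_product n M) m = Poly_Mapping.lookup (partial_product n N) m"
  using assms(2)
proof (induction M rule: dec_induct)
  case (step M)
  have "Poly_Mapping.lookup m (Suc M) = 0"
    using assms(1) step.hyps by (metis in_keys_iff not_less_eq_eq le_trans)
  then show ?case using step by (simp add: partial_product_Suc lookup_times_x_factor)
qed simp

lemma product_coeff_eq:
  assumes "\<forall>i\<in>Poly_Mapping.keys m. i \<le> N"
  shows "product_coeff n m = Poly_Mapping.lookup (partial_product n N) m"
proof -
  have ev: "\<forall>\<^sub>F M in sequentially. Poly_Mapping.lookup (partial_product n M) m
      = Poly_Mapping.lookup (partial_product n N) m"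
    unfolding eventually_sequentially using lookup_partial_product_stable[OF assms] by blast
  show ?thesis unfolding product_coeff_def
  proof (rule the_equality)
    fix h
    assume "\<forall>\<^sub>F M in sequentially. Poly_Mapping.lookup (partial_product n M) m = h"
    with ev have "\<forall>\<^sub>F M in sequentially. h = Poly_Mapping.lookup (partial_product n N) m"
      by eventually_elim simp
    then show "h = Poly_Mapping.lookup (partial_product n N) m" by simp
  qed (rule ev)
qed

lemma free_alg_on_lookup_step:
  fixes H :: "monomial \<Rightarrow>\<^sub>0 free_alg"
  assumes "\<And>m. Poly_Mapping.lookup H m \<in> free_alg_on n" "a < n"
  shows "Poly_Mapping.lookup (H * (1 + Poly_Mapping.single (Poly_Mapping.single i 1) (u_gen a))) m
    \<in> free_alg_on n"
proof -
  let ?k = "Poly_Mapping.single i (1::nat)"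
  have "Poly_Mapping.lookup (H * Poly_Mapping.single ?k (u_gen a)) m \<in> free_alg_on n"
  proof (cases "\<exists>m'. m = m' + ?k")
    case True
    then obtain m' where m: "m = m' + ?k" by blast
    have "u_gen a \<in> free_alg_on n" using assms(2) free_alg_on_uw[of "[a]" n] by (simp add: uw_single)
    then show ?thesis unfolding m lookup_times_single_add by (rule free_alg_on_mult[OF assms(1)])
  next
    case False
    then have "\<And>m'. m \<noteq> m' + ?k" by blast
    then show ?thesis by (simp add: lookup_times_single_none free_alg_on_0)
  qed
  then show ?thesis using assms(1)[of m] by (simp add: ring_distribs lookup_add free_alg_on_add)
qed

lemma free_alg_on_partial_product: "Poly_Mapping.lookup (partial_product n N) m \<in> free_alg_on n"
proof (induction N arbitrary: m)
  case 0
  then show ?case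
    by (simp add: partial_product_def lookup_one when_def free_alg_on_1 free_alg_on_0)
next
  case (Suc N)
  have *: "Poly_Mapping.lookup (H * prod_list (map (\<lambda>a. 1 + Poly_Mapping.single (Poly_Mapping.single i 1) (u_gen a)) as)) m
      \<in> free_alg_on n" if "\<And>m. Poly_Mapping.lookup H m \<in> free_alg_on n" "set as \<subseteq> {..<n}"
    for "as" i m and H :: "monomial \<Rightarrow>\<^sub>0 free_alg"
    using that
  proof (induction as arbitrary: H m)
    case (Cons a as)
    show ?case using Cons.IH[OF free_alg_on_lookup_step[OF Cons.prems(1)], of a i] Cons.prems(2)
      by (simp add: mult.assoc)
  qed simp
  show ?case unfolding partial_product_Suc x_factor_def by (rule *[OF Suc]) auto
qed

lemma GC_eq_lookup_FF:
  assumes "w \<in> signed_perms n" "\<forall>i\<in>Poly_Mapping.keys m. i \<le> N"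
  shows "GC n w m = Poly_Mapping.lookup (FF n N w) m"
  using represents_FF[of n N] u_coeff_eq[OF free_alg_on_partial_product assms(1), of N m]
  by (simp add: GC_def product_coeff_eq[OF assms(2)] represents_def)

section \<open>Transitions\<close>

text \<open>\<open>cov g x y\<close>: exchanging the entries of \<open>g\<close> at the positions \<open>x < y\<close> is a covering in the
  Bruhat order of all permutations of the integers.\<close>

definition cov :: "(int \<Rightarrow> int) \<Rightarrow> int \<Rightarrow> int \<Rightarrow> bool" where
  "cov g x y \<longleftrightarrow> x < y \<and> g x < g y \<and> (\<forall>j. x < j \<and> j < y \<longrightarrow> \<not> (g x < g j \<and> g j < g y))"

text \<open>The window of values is separated from the entries at the ends of the window of
  positions, so that the two windows can be varied independently.\<close>

definition none :: "(int \<Rightarrow> int) \<Rightarrow> int \<Rightarrow> int \<Rightarrow> int \<Rightarrow> int \<Rightarrow> bool" where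
  "none g x y a b \<longleftrightarrow> (\<forall>j. x < j \<and> j < y \<longrightarrow> \<not> (a < g j \<and> g j < b))"

lemma cov_none: "cov g x y \<longleftrightarrow> x < y \<and> g x < g y \<and> none g x y (g x) (g y)"
  by (simp add: cov_def none_def)

section \<open>Coverings and exchange of neighbouring values\<close>

lemma none_comp:
  assumes "\<And>v. a' < s v \<and> s v < b' \<longleftrightarrow> a < v \<and> v < b"
  shows "none (s \<circ> g) x y a' b' \<longleftrightarrow> none g x y a b"
  using assms by (simp add: none_def)

text \<open>A value window larger by the single value \<open>e\<close> adds one condition, on the
  place \<open>p\<close> where \<open>e\<close> occurs.\<close>

lemma none_comp_insert:
  assumes "\<And>v. a' < s v \<and> s v < b' \<longleftrightarrow> a < v \<and> v < b \<or> v = e" "\<And>j. g j = e \<longleftrightarrow> j = p"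
  shows "none (s \<circ> g) x y a' b' \<longleftrightarrow> none g x y a b \<and> \<not> (x < p \<and> p < y)"
  using assms by (simp add: none_def) blast

lemma none_insert:
  assumes "\<And>v. a' < v \<and> v < b' \<longleftrightarrow> a < v \<and> v < b \<or> v = e" "\<And>j. g j = e \<longleftrightarrow> j = p"
  shows "none g x y a' b' \<longleftrightarrow> none g x y a b \<and> \<not> (x < p \<and> p < y)"
  using none_comp_insert[of a' "\<lambda>v. v" b' a b e g p x y] assms by (simp add: comp_def)

text \<open>The neighbouring values \<open>L\<close> and \<open>U\<close> stand at \<open>A\<close>
  and \<open>A'\<close>, and one end of the covering is one of these places. Replacing
  \<open>g\<close> by \<open>s \<circ> g\<close> changes the value window at this end by at most one
  value. Its place must avoid the interval between \<open>x\<close> and \<open>y\<close>, and the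
  extra comparisons of places on the two sides say just that.\<close>

lemma cov_cox_gen_pair:
  fixes L U :: int
  assumes U: "U = L + 1" and A: "\<And>j. g j = L \<longleftrightarrow> j = A" and A': "\<And>j. g j = U \<longleftrightarrow> j = A'"
    and sL: "s L = U" and sU: "s U = L"
    and s1: "\<And>v. U < s v \<longleftrightarrow> U < v" and s2: "\<And>v. s v < L \<longleftrightarrow> v < L" and s3: "\<And>v. s v = U \<longleftrightarrow> v = L" and s4: "\<And>v. s v = L \<longleftrightarrow> v = U"
    and xy: "x < y"
    and c: "c \<noteq> L" "c \<noteq> U" "s c = c" "\<And>v. s v < c \<longleftrightarrow> v < c" "\<And>v. c < s v \<longleftrightarrow> c < v"
  shows "x = A \<Longrightarrow> g y = c \<Longrightarrow> cov g x y \<and> A' < y \<longleftrightarrow> A' < A \<and> cov (s \<circ> g) x y"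
    "x = A' \<Longrightarrow> g y = c \<Longrightarrow> cov g x y \<and> y < A \<longleftrightarrow> A' < A \<and> cov (s \<circ> g) x y"
    "y = A \<Longrightarrow> g x = c \<Longrightarrow> cov g x y \<and> A' < x \<longleftrightarrow> A' < A \<and> cov (s \<circ> g) x y"
    "y = A' \<Longrightarrow> g x = c \<Longrightarrow> cov g x y \<and> x < A \<longleftrightarrow> A' < A \<and> cov (s \<circ> g) x y"
proof -
  have gA: "g A = L" "g A' = U" using A A' by blast+
  have lt: "L < s v \<longleftrightarrow> U < v \<or> v = L" "s v < U \<longleftrightarrow> v < L \<or> v = U" for v
    using s1[of v] s2[of v] s3[of v] s4[of v] U by linarith+
  show "cov g x y \<and> A' < y \<longleftrightarrow> A' < A \<and> cov (s \<circ> g) x y" if x: "x = A" and y: "g y = c"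
  proof (cases "U < c")
    case True
    have gx: "g x = L" using that gA by simp
    have "none g x y L c \<longleftrightarrow> none g x y U c \<and> \<not> (x < A' \<and> A' < y)"
      by (rule none_insert[OF _ A']) (use U True in auto)
    moreover have "L < c" using True U by simp
    ultimately have c1: "cov g x y \<longleftrightarrow> none g x y U c \<and> \<not> (x < A' \<and> A' < y)"
      using xy by (simp add: cov_none y gx)
    have "none (s \<circ> g) x y U c \<longleftrightarrow> none g x y U c"
      by (rule none_comp) (simp add: s1 c(4))
    moreover have "(s \<circ> g) x = U" "(s \<circ> g) y = c" by (simp_all add: x y gA sL c(3))
    ultimately have c2: "cov (s \<circ> g) x y \<longleftrightarrow> none g x y U c"
      using xy True by (simp only: cov_none simp_thms)
    have "A' \<noteq> A" "A' \<noteq> y" using gA y c(2) U by auto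
    then show ?thesis unfolding c1 c2 using x xy by auto
  next
    case False
    then have "c < L" "c < U" using U c(1,2) by linarith+
    then have "\<not> cov g x y" "\<not> cov (s \<circ> g) x y" by (simp_all add: cov_def x y gA sL c(3))
    then show ?thesis by blast
  qed
  show "cov g x y \<and> y < A \<longleftrightarrow> A' < A \<and> cov (s \<circ> g) x y" if x: "x = A'" and y: "g y = c"
  proof (cases "U < c")
    case True
    have gx: "g x = U" using that gA by simp
    have "none (s \<circ> g) x y L c \<longleftrightarrow> none g x y U c \<and> \<not> (x < A \<and> A < y)"
      by (rule none_comp_insert[OF _ A]) (simp add: lt c(4,5), use U True in auto)
    moreover have "(s \<circ> g) x = L" "(s \<circ> g) y = c" by (simp_all add: x y gA sU c(3))
    moreover have "L < c" using True U by simp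
    ultimately have c2: "cov (s \<circ> g) x y \<longleftrightarrow> none g x y U c \<and> \<not> (x < A \<and> A < y)"
      using xy by (simp only: cov_none simp_thms)
    have c1: "cov g x y \<longleftrightarrow> none g x y U c"
      using xy True by (simp add: cov_none y gx)
    have "A' \<noteq> A" "A \<noteq> y" using gA y c(1) U by auto
    then show ?thesis unfolding c1 c2 using x xy by auto
  next
    case False
    then have "c < L" "c < U" using U c(1,2) by linarith+
    then have "\<not> cov g x y" "\<not> cov (s \<circ> g) x y" by (simp_all add: cov_def x y gA sU c(3))
    then show ?thesis by blast
  qed
  show "cov g x y \<and> A' < x \<longleftrightarrow> A' < A \<and> cov (s \<circ> g) x y" if y: "y = A" and x: "g x = c"
  proof (cases "c < L")
    case True
    have gx: "g y = L" using that gA by simp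
    have "none (s \<circ> g) x y c U \<longleftrightarrow> none g x y c L \<and> \<not> (x < A' \<and> A' < y)"
      by (rule none_comp_insert[OF _ A']) (simp add: lt c(4,5), use U True in auto)
    moreover have "(s \<circ> g) y = U" "(s \<circ> g) x = c" by (simp_all add: x y gA sL c(3))
    moreover have "c < U" using True U by simp
    ultimately have c2: "cov (s \<circ> g) x y \<longleftrightarrow> none g x y c L \<and> \<not> (x < A' \<and> A' < y)"
      using xy by (simp only: cov_none simp_thms)
    have c1: "cov g x y \<longleftrightarrow> none g x y c L"
      using xy True by (simp add: cov_none x gx)
    have "A' \<noteq> A" "A' \<noteq> x" using gA x c(2) U by auto
    then show ?thesis unfolding c1 c2 using y xy by auto
  next
    case False
    then have "L < c" "U < c" using U c(1,2) by linarith+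
    then have "\<not> cov g x y" "\<not> cov (s \<circ> g) x y" by (simp_all add: cov_def x y gA sL c(3))
    then show ?thesis by blast
  qed
  show "cov g x y \<and> x < A \<longleftrightarrow> A' < A \<and> cov (s \<circ> g) x y" if y: "y = A'" and x: "g x = c"
  proof (cases "c < L")
    case True
    have gx: "g y = U" using that gA by simp
    have "none g x y c U \<longleftrightarrow> none g x y c L \<and> \<not> (x < A \<and> A < y)"
      by (rule none_insert[OF _ A]) (use U True in auto)
    moreover have "c < U" using True U by simp
    ultimately have c1: "cov g x y \<longleftrightarrow> none g x y c L \<and> \<not> (x < A \<and> A < y)"
      using xy by (simp add: cov_none x gx)
    have "none (s \<circ> g) x y c L \<longleftrightarrow> none g x y c L"
      by (rule none_comp) (simp add: s2 c(5))
    moreover have "(s \<circ> g) y = L" "(s \<circ> g) x = c" by (simp_all add: x y gA sU c(3))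
    ultimately have c2: "cov (s \<circ> g) x y \<longleftrightarrow> none g x y c L"
      using xy True by (simp only: cov_none simp_thms)
    have "A' \<noteq> A" "A \<noteq> x" using gA x c(1) U by auto
    then show ?thesis unfolding c1 c2 using y xy by auto
  next
    case False
    then have "L < c" "U < c" using U c(1,2) by linarith+
    then have "\<not> cov g x y" "\<not> cov (s \<circ> g) x y" by (simp_all add: cov_def x y gA sU c(3))
    then show ?thesis by blast
  qed
qed

lemma cox_gen_pos_facts:
  assumes "0 < i"
  shows "cox_gen i (int i) = int i + 1" "cox_gen i (int i + 1) = int i"
    "cox_gen i (- int i) = - int i - 1" "cox_gen i (- int i - 1) = - int i"
    "int i + 1 < cox_gen i v \<longleftrightarrow> int i + 1 < v" "cox_gen i v < int i \<longleftrightarrow> v < int i"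
    "cox_gen i v = int i + 1 \<longleftrightarrow> v = int i" "cox_gen i v = int i \<longleftrightarrow> v = int i + 1"
    "- int i < cox_gen i v \<longleftrightarrow> - int i < v" "cox_gen i v < - int i - 1 \<longleftrightarrow> v < - int i - 1"
    "cox_gen i v = - int i \<longleftrightarrow> v = - int i - 1" "cox_gen i v = - int i - 1 \<longleftrightarrow> v = - int i"
  using assms unfolding cox_gen_eq swp_def lo_def up_def by auto

lemma cox_gen_pos_other:
  assumes "0 < i" "c \<noteq> int i" "c \<noteq> int i + 1" "c \<noteq> - int i" "c \<noteq> - int i - 1"
  shows "cox_gen i c = c" "cox_gen i v < c \<longleftrightarrow> v < c" "c < cox_gen i v \<longleftrightarrow> c < v"
  using assms unfolding cox_gen_eq swp_def lo_def up_def by auto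

lemma cox_gen_0_other:
  assumes "c \<noteq> 1" "c \<noteq> - 1" "c \<noteq> 0"
  shows "cox_gen 0 c = c" "cox_gen 0 v < c \<longleftrightarrow> v < c" "c < cox_gen 0 v \<longleftrightarrow> c < v"
  using assms unfolding cox_gen_eq swp_def lo_def up_def by auto

lemma swp_values:
  "swp p q p = q" "swp p q q = p"
  "p \<noteq> 0 \<Longrightarrow> q \<noteq> - p \<Longrightarrow> swp p q (- p) = - q" "q \<noteq> 0 \<Longrightarrow> p \<noteq> - q \<Longrightarrow> swp p q (- q) = - p"
  "v \<noteq> p \<Longrightarrow> v \<noteq> q \<Longrightarrow> v \<noteq> - p \<Longrightarrow> v \<noteq> - q \<Longrightarrow> swp p q v = v"
  by (auto simp: swp_def)

lemma cov_cox_gen_other: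
  assumes "s (g x) = g x" "s (g y) = g y" "\<And>v. s v < g y \<longleftrightarrow> v < g y" "\<And>v. g x < s v \<longleftrightarrow> g x < v"
  shows "cov (s \<circ> g) x y \<longleftrightarrow> cov g x y"
  using assms by (simp add: cov_def)

text \<open>Read for \<open>g = inv w\<close>, where \<open>\<alpha>\<close> and
  \<open>\<alpha>'\<close> are the entries of \<open>w\<close> at \<open>i\<close> and
  \<open>i + 1\<close>. Left: the reflection gives a covering and leaves a descent at
  \<open>i\<close>. Right: \<open>i\<close> is a descent, and the reflection gives a covering once
  it is removed. The hypotheses \<open>np\<close> exclude that the reflection acts as the generator
  itself.\<close>

lemma cov_cox_gen:
  fixes \<alpha> \<alpha>' x y :: int
  assumes i: "0 < i"
    and g: "\<And>j. g j = int i \<longleftrightarrow> j = \<alpha>" "\<And>j. g j = int i + 1 \<longleftrightarrow> j = \<alpha>'"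
      "\<And>j. g j = - int i \<longleftrightarrow> j = - \<alpha>" "\<And>j. g j = - int i - 1 \<longleftrightarrow> j = - \<alpha>'" "g 0 = 0"
    and xy: "x < y" "x \<noteq> - y" "x \<noteq> 0" "y \<noteq> 0"
    and np: "\<not> (x = \<alpha> \<and> y = \<alpha>')" "\<not> (x = \<alpha>' \<and> y = \<alpha>)" "\<not> (x = - \<alpha> \<and> y = - \<alpha>')" "\<not> (x = - \<alpha>' \<and> y = - \<alpha>)"
  shows "cov g x y \<and> swp x y \<alpha>' < swp x y \<alpha> \<longleftrightarrow> \<alpha>' < \<alpha> \<and> cov (cox_gen i \<circ> g) x y"
proof -
  note f = cox_gen_pos_facts[OF i] and oth = cox_gen_pos_other[OF i]
  have v: "g \<alpha> = int i" "g \<alpha>' = int i + 1" "g (- \<alpha>) = - int i" "g (- \<alpha>') = - int i - 1"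
    using g by blast+
  have a: "\<alpha> \<noteq> \<alpha>'" "\<alpha> \<noteq> - \<alpha>'" "- \<alpha> \<noteq> \<alpha>'" "\<alpha> \<noteq> 0" "\<alpha>' \<noteq> 0"
  proof -
    show "\<alpha> \<noteq> \<alpha>'" using v(1,2) by (intro notI) simp
    show "\<alpha> \<noteq> - \<alpha>'" using v(1,4) i by (intro notI) simp
    then show "- \<alpha> \<noteq> \<alpha>'" by linarith
    show "\<alpha> \<noteq> 0" using v(1) g(5) i by (intro notI) simp
    show "\<alpha>' \<noteq> 0" using v(2) g(5) i by (intro notI) simp
  qed
  note P = cov_cox_gen_pair[of "int i + 1" "int i" g \<alpha> \<alpha>' "cox_gen i" x y, OF refl g(1,2) f(1,2,5,6,7,8) xy(1)]
  have U2: "- int i = (- int i - 1) + 1" by simp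
  note Q = cov_cox_gen_pair[of "- int i" "- int i - 1" g "- \<alpha>'" "- \<alpha>" "cox_gen i" x y, OF U2 g(4,3) f(4,3,9,10,11,12) xy(1)]
  \<comment> \<open>The value 0 at position 0 obstructs every exchange across 0 in both position and
    value.\<close>
  have zero_blocks: "\<not> cov h x y" if "x < 0" "0 < y" "h x < 0" "0 < h y" "h 0 = 0" for h
    using that by (auto simp: cov_def intro!: exI[of _ 0])
  define X where "X \<longleftrightarrow> x = \<alpha> \<or> x = \<alpha>' \<or> x = - \<alpha> \<or> x = - \<alpha>'"
  define Y where "Y \<longleftrightarrow> y = \<alpha> \<or> y = \<alpha>' \<or> y = - \<alpha> \<or> y = - \<alpha>'"
  have nX: "g x \<noteq> int i" "g x \<noteq> int i + 1" "g x \<noteq> - int i" "g x \<noteq> - int i - 1" if "\<not> X"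
    using that unfolding X_def g by blast+
  have nY: "g y \<noteq> int i" "g y \<noteq> int i + 1" "g y \<noteq> - int i" "g y \<noteq> - int i - 1" if "\<not> Y"
    using that unfolding Y_def g by blast+
  show ?thesis
  proof (cases X)
    case False
    note ox = oth[OF nX[OF False]]
    show ?thesis
    proof (cases Y)
      case False
      note oy = oth[OF nY[OF False]]
      have "cov (cox_gen i \<circ> g) x y \<longleftrightarrow> cov g x y"
        by (rule cov_cox_gen_other) (fact ox oy)+
      moreover have "swp x y \<alpha> = \<alpha>" "swp x y \<alpha>' = \<alpha>'"
        using False \<open>\<not> X\<close> unfolding X_def Y_def swp_def by auto
      ultimately show ?thesis by auto
    next
      case True
      note PQ = P(3,4)[OF nX(1,2)[OF False] ox _ refl] Q(3,4)[OF nX(4,3)[OF False] ox _ refl]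
      consider "y = \<alpha>" | "y = \<alpha>'" | "y = - \<alpha>" | "y = - \<alpha>'" using True unfolding Y_def by blast
      then show ?thesis
      proof cases
        case 1
        have e: "\<alpha> = y" using 1 by simp
        have "swp x y \<alpha> = x" unfolding e by (rule swp_values(2))
        moreover have "swp x y \<alpha>' = \<alpha>'"
          by (rule swp_values(5)) (use False a 1 in \<open>auto simp: X_def\<close>)
        ultimately show ?thesis using PQ(1)[OF 1] by simp
      next
        case 2
        have e: "\<alpha>' = y" using 2 by simp
        have "swp x y \<alpha>' = x" unfolding e by (rule swp_values(2))
        moreover have "swp x y \<alpha> = \<alpha>"
          by (rule swp_values(5)) (use False a 2 in \<open>auto simp: X_def\<close>)
        ultimately show ?thesis using PQ(2)[OF 2] by simp
      next
        case 3
        have e: "\<alpha> = - y" using 3 by simp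
        have "swp x y \<alpha> = - x" unfolding e by (rule swp_values(4)) (use xy in simp_all)
        moreover have "swp x y \<alpha>' = \<alpha>'"
          by (rule swp_values(5)) (use False a 3 in \<open>auto simp: X_def\<close>)
        ultimately show ?thesis using PQ(4)[OF 3] by (smt (verit))
      next
        case 4
        have e: "\<alpha>' = - y" using 4 by simp
        have "swp x y \<alpha>' = - x" unfolding e by (rule swp_values(4)) (use xy in simp_all)
        moreover have "swp x y \<alpha> = \<alpha>"
          by (rule swp_values(5)) (use False a 4 in \<open>auto simp: X_def\<close>)
        ultimately show ?thesis using PQ(3)[OF 4] by (smt (verit))
      qed
    qed
  next
    case True
    show ?thesis
    proof (cases Y)
      case False
      note oy = oth[OF nY[OF False]]
      note PQ = P(1,2)[OF nY(1,2)[OF False] oy _ refl] Q(1,2)[OF nY(4,3)[OF False] oy _ refl]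
      consider "x = \<alpha>" | "x = \<alpha>'" | "x = - \<alpha>" | "x = - \<alpha>'" using True unfolding X_def by blast
      then show ?thesis
      proof cases
        case 1
        have e: "\<alpha> = x" using 1 by simp
        have "swp x y \<alpha> = y" unfolding e by (rule swp_values(1))
        moreover have "swp x y \<alpha>' = \<alpha>'"
          by (rule swp_values(5)) (use False a 1 in \<open>auto simp: Y_def\<close>)
        ultimately show ?thesis using PQ(1)[OF 1] by simp
      next
        case 2
        have e: "\<alpha>' = x" using 2 by simp
        have "swp x y \<alpha>' = y" unfolding e by (rule swp_values(1))
        moreover have "swp x y \<alpha> = \<alpha>"
          by (rule swp_values(5)) (use False a 2 in \<open>auto simp: Y_def\<close>)
        ultimately show ?thesis using PQ(2)[OF 2] by simp
      next
        case 3
        have e: "\<alpha> = - x" using 3 by simp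
        have "swp x y \<alpha> = - y" unfolding e by (rule swp_values(3)) (use xy in simp_all)
        moreover have "swp x y \<alpha>' = \<alpha>'"
          by (rule swp_values(5)) (use False a 3 in \<open>auto simp: Y_def\<close>)
        ultimately show ?thesis using PQ(4)[OF 3] by (smt (verit))
      next
        case 4
        have e: "\<alpha>' = - x" using 4 by simp
        have "swp x y \<alpha>' = - y" unfolding e by (rule swp_values(3)) (use xy in simp_all)
        moreover have "swp x y \<alpha> = \<alpha>"
          by (rule swp_values(5)) (use False a 4 in \<open>auto simp: Y_def\<close>)
        ultimately show ?thesis using PQ(3)[OF 4] by (smt (verit))
      qed
    next
      case Y: True
      \<comment> \<open>Both ends now belong to the exchanged values. What remains are the mixed
        pairs, where the windows at both ends change at once; in the last two the entries decrease,
        so there is no covering at all.\<close>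
      consider (a) "x = - \<alpha>'" "y = \<alpha>" | (b) "x = - \<alpha>" "y = \<alpha>'" | (c) "x = \<alpha>" "y = - \<alpha>'" | (d) "x = \<alpha>'" "y = - \<alpha>"
        using True Y np xy unfolding X_def Y_def by (smt (verit))
      then show ?thesis
      proof cases
        case a
        have al: "\<alpha> = y" "\<alpha>' = - x" using a by auto
        have sw: "swp x y \<alpha>' < swp x y \<alpha> \<longleftrightarrow> - x < y" using al xy by (auto simp: swp_def)
        have gx: "g x = - int i - 1" "g y = int i" using v a by auto
        show ?thesis
        proof (cases "- x < y")
          case True
          show ?thesis
          proof (cases "x < 0")
            case True
            then have xy0: "x < 0" "0 < y" using \<open>- x < y\<close> by auto
            have "(cox_gen i \<circ> g) 0 = 0" using g(5) i by (simp add: cox_gen_eq swp_def lo_def up_def)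
            then have "\<not> cov (cox_gen i \<circ> g) x y"
              by (intro zero_blocks xy0) (use i in \<open>simp_all add: gx f\<close>)
            moreover have "\<not> cov g x y"
              by (intro zero_blocks xy0) (use i g(5) in \<open>simp_all add: gx\<close>)
            ultimately show ?thesis by blast
          next
            case False
            then have "0 < x" using xy by simp
            have e1: "none g x y (- int i - 1) (int i) \<longleftrightarrow> none g x y (- int i) (int i) \<and> \<not> (x < - \<alpha> \<and> - \<alpha> < y)"
              by (rule none_insert[OF _ g(3)]) (use i in auto)
            have e2: "none (cox_gen i \<circ> g) x y (- int i) (int i + 1) \<longleftrightarrow> none g x y (- int i) (int i) \<and> \<not> (x < \<alpha>' \<and> \<alpha>' < y)"
            proof (rule none_comp_insert[OF _ g(2)])
              fix u
              show "- int i < cox_gen i u \<and> cox_gen i u < int i + 1 \<longleftrightarrow> - int i < u \<and> u < int i \<or> u = int i + 1"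
                using f(6)[of u] f(8)[of u] f(9)[of u] i by linarith
            qed
            have gs: "(cox_gen i \<circ> g) x = - int i" "(cox_gen i \<circ> g) y = int i + 1" by (simp_all add: gx f)
            have c1: "cov g x y \<longleftrightarrow> none g x y (- int i) (int i)"
              using xy(1) i al \<open>0 < x\<close> unfolding cov_none gx e1 by auto
            have c2: "cov (cox_gen i \<circ> g) x y \<longleftrightarrow> none g x y (- int i) (int i)"
              using xy(1) i al \<open>0 < x\<close> unfolding cov_none gs e2 by auto
            have "\<alpha>' < \<alpha> \<longleftrightarrow> - x < y" using al by simp
            then show ?thesis unfolding c1 c2 sw by blast
          qed
        qed (use sw al in auto)
      next
        case b
        have al: "\<alpha> = - x" "\<alpha>' = y" using b by auto
        have sw: "swp x y \<alpha>' < swp x y \<alpha> \<longleftrightarrow> y < - x" using al xy by (auto simp: swp_def)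
        have gx: "g x = - int i" "g y = int i + 1" using v b by auto
        show ?thesis
        proof (cases "y < - x")
          case True
          show ?thesis
          proof (cases "0 < y")
            case True
            then have xy0: "x < 0" "0 < y" using \<open>y < - x\<close> by auto
            have "(cox_gen i \<circ> g) 0 = 0" using g(5) i by (simp add: cox_gen_eq swp_def lo_def up_def)
            then have "\<not> cov (cox_gen i \<circ> g) x y"
              by (intro zero_blocks xy0) (use i in \<open>simp_all add: gx f\<close>)
            moreover have "\<not> cov g x y"
              by (intro zero_blocks xy0) (use i g(5) in \<open>simp_all add: gx\<close>)
            ultimately show ?thesis by blast
          next
            case False
            then have "y < 0" using xy by simp
            have e1: "none g x y (- int i) (int i + 1) \<longleftrightarrow> none g x y (- int i) (int i) \<and> \<not> (x < \<alpha> \<and> \<alpha> < y)"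
              by (rule none_insert[OF _ g(1)]) (use i in auto)
            have e2: "none (cox_gen i \<circ> g) x y (- int i - 1) (int i) \<longleftrightarrow> none g x y (- int i) (int i) \<and> \<not> (x < - \<alpha>' \<and> - \<alpha>' < y)"
            proof (rule none_comp_insert[OF _ g(4)])
              fix u
              show "- int i - 1 < cox_gen i u \<and> cox_gen i u < int i \<longleftrightarrow> - int i < u \<and> u < int i \<or> u = - int i - 1"
                using f(6)[of u] f(9)[of u] f(11)[of u] i by linarith
            qed
            have gs: "(cox_gen i \<circ> g) x = - int i - 1" "(cox_gen i \<circ> g) y = int i" by (simp_all add: gx f)
            have c1: "cov g x y \<longleftrightarrow> none g x y (- int i) (int i)"
              using xy(1) i al \<open>y < 0\<close> unfolding cov_none gx e1 by auto
            have c2: "cov (cox_gen i \<circ> g) x y \<longleftrightarrow> none g x y (- int i) (int i)"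
              using xy(1) i al \<open>y < 0\<close> unfolding cov_none gs e2 by auto
            have "\<alpha>' < \<alpha> \<longleftrightarrow> y < - x" using al by simp
            then show ?thesis unfolding c1 c2 sw by blast
          qed
        qed (use sw al in auto)
      next
        case c
        then show ?thesis using i by (auto simp: cov_def v f)
      next
        case d
        then show ?thesis using i by (auto simp: cov_def v f)
      qed
    qed
  qed
qed

text \<open>The exchanged values -1 and 1 are not neighbours among all integers. Passing from one to
  the other changes the value window by 0, which stands at position 0, and by one further value,
  which stands at \<open>\<kappa>\<close> or \<open>- \<kappa>\<close>.\<close>

lemma cov_cox_gen_0:
  fixes \<kappa> x y :: int
  assumes g: "\<And>j. g j = 1 \<longleftrightarrow> j = \<kappa>" "\<And>j. g j = - 1 \<longleftrightarrow> j = - \<kappa>" "\<And>j. g j = 0 \<longleftrightarrow> j = 0"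
    and xy: "x < y" "x \<noteq> - y" "x \<noteq> 0" "y \<noteq> 0"
  shows "cov g x y \<and> swp x y \<kappa> < 0 \<longleftrightarrow> \<kappa> < 0 \<and> cov (cox_gen 0 \<circ> g) x y"
proof -
  note oth = cox_gen_0_other
  have s: "cox_gen 0 1 = - 1" "cox_gen 0 (- 1) = 1" "cox_gen 0 0 = 0"
    by (auto simp: cox_gen_eq swp_def lo_def up_def)
  have v: "g \<kappa> = 1" "g (- \<kappa>) = - 1" "g 0 = 0" using g by blast+
  have k: "\<kappa> \<noteq> 0" using v by (intro notI) simp
  have g0: "g x \<noteq> 0" "g y \<noteq> 0" using g xy by auto
  have hi: "none g x y (- 1) c \<longleftrightarrow> none g x y 1 c \<and> \<not> (x < 0 \<and> 0 < y) \<and> \<not> (x < \<kappa> \<and> \<kappa> < y)" if "1 < c" for c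
  proof -
    have "none g x y (- 1) c \<longleftrightarrow> none g x y 0 c \<and> \<not> (x < 0 \<and> 0 < y)"
      by (rule none_insert[OF _ g(3)]) (use that in auto)
    moreover have "none g x y 0 c \<longleftrightarrow> none g x y 1 c \<and> \<not> (x < \<kappa> \<and> \<kappa> < y)"
      by (rule none_insert[OF _ g(1)]) (use that in auto)
    ultimately show ?thesis by blast
  qed
  have lw: "none g x y c 1 \<longleftrightarrow> none g x y c (- 1) \<and> \<not> (x < 0 \<and> 0 < y) \<and> \<not> (x < - \<kappa> \<and> - \<kappa> < y)" if "c < - 1" for c
  proof -
    have "none g x y c 1 \<longleftrightarrow> none g x y c 0 \<and> \<not> (x < 0 \<and> 0 < y)"
      by (rule none_insert[OF _ g(3)]) (use that in auto)
    moreover have "none g x y c 0 \<longleftrightarrow> none g x y c (- 1) \<and> \<not> (x < - \<kappa> \<and> - \<kappa> < y)"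
      by (rule none_insert[OF _ g(2)]) (use that in auto)
    ultimately show ?thesis by blast
  qed
  have s0: "(cox_gen 0 \<circ> g) j = 0 \<longleftrightarrow> j = 0" for j
  proof -
    have "cox_gen 0 u = 0 \<longleftrightarrow> u = 0" for u by (auto simp: cox_gen_eq swp_def lo_def up_def)
    then show ?thesis using g(3)[of j] by simp
  qed
  have his: "none (cox_gen 0 \<circ> g) x y (- 1) c \<longleftrightarrow> none g x y 1 c \<and> \<not> (x < 0 \<and> 0 < y) \<and> \<not> (x < - \<kappa> \<and> - \<kappa> < y)" if "1 < c" for c
  proof -
    have "none (cox_gen 0 \<circ> g) x y (- 1) c \<longleftrightarrow> none (cox_gen 0 \<circ> g) x y 0 c \<and> \<not> (x < 0 \<and> 0 < y)"
      by (rule none_insert[OF _ s0]) (use that in auto)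
    moreover have "none (cox_gen 0 \<circ> g) x y 0 c \<longleftrightarrow> none g x y 1 c \<and> \<not> (x < - \<kappa> \<and> - \<kappa> < y)"
      by (rule none_comp_insert[OF _ g(2)]) (use that in \<open>auto simp: cox_gen_eq swp_def lo_def up_def\<close>)
    ultimately show ?thesis by blast
  qed
  have lws: "none (cox_gen 0 \<circ> g) x y c 1 \<longleftrightarrow> none g x y c (- 1) \<and> \<not> (x < 0 \<and> 0 < y) \<and> \<not> (x < \<kappa> \<and> \<kappa> < y)" if "c < - 1" for c
  proof -
    have "none (cox_gen 0 \<circ> g) x y c 1 \<longleftrightarrow> none (cox_gen 0 \<circ> g) x y c 0 \<and> \<not> (x < 0 \<and> 0 < y)"
      by (rule none_insert[OF _ s0]) (use that in auto)
    moreover have "none (cox_gen 0 \<circ> g) x y c 0 \<longleftrightarrow> none g x y c (- 1) \<and> \<not> (x < \<kappa> \<and> \<kappa> < y)"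
      by (rule none_comp_insert[OF _ g(1)]) (use that in \<open>auto simp: cox_gen_eq swp_def lo_def up_def\<close>)
    ultimately show ?thesis by blast
  qed
  have ps1: "none (cox_gen 0 \<circ> g) x y 1 c \<longleftrightarrow> none g x y 1 c" for c
    by (rule none_comp) (auto simp: cox_gen_eq swp_def lo_def up_def)
  have ps2: "none (cox_gen 0 \<circ> g) x y c (-1) \<longleftrightarrow> none g x y c (-1)" for c
    by (rule none_comp) (auto simp: cox_gen_eq swp_def lo_def up_def)
  note ps = ps1 ps2
  consider (x1) "x = \<kappa>" | (x2) "x = - \<kappa>" | (y1) "y = \<kappa>" | (y2) "y = - \<kappa>"
    | (o) "x \<noteq> \<kappa>" "x \<noteq> - \<kappa>" "y \<noteq> \<kappa>" "y \<noteq> - \<kappa>" by blast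
  then show ?thesis
  proof cases
    case o
    then have nx: "g x \<noteq> 1" "g x \<noteq> - 1" "g y \<noteq> 1" "g y \<noteq> - 1" using g by auto
    have "cov (cox_gen 0 \<circ> g) x y \<longleftrightarrow> cov g x y"
      by (rule cov_cox_gen_other) (fact oth[OF nx(1,2) g0(1)] oth[OF nx(3,4) g0(2)])+
    moreover have "swp x y \<kappa> = \<kappa>" using o by (auto simp: swp_def)
    ultimately show ?thesis by auto
  next
    case x1
    then have nx: "g y \<noteq> 1" "g y \<noteq> - 1" using g xy by auto
    have sw: "swp x y \<kappa> = y" using x1 xy k by (auto simp: swp_def)
    have gp: "g x = 1" using x1 v by simp
    have gs: "(cox_gen 0 \<circ> g) x = (- 1)" "(cox_gen 0 \<circ> g) y = g y"
      using gp s oth(1)[OF nx g0(2)] by simp_all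
    have c1: "cov g x y \<longleftrightarrow> 1 < g y \<and> none g x y 1 (g y)"
      using xy(1) by (simp only: cov_none gp simp_thms)
    have c2: "cov (cox_gen 0 \<circ> g) x y \<longleftrightarrow> (- 1) < g y \<and> none (cox_gen 0 \<circ> g) x y (- 1) (g y)"
      using xy(1) by (simp only: cov_none gs simp_thms)
    have eq: "(- 1 < g y) = (1 < g y)" using nx g0 by linarith
    show ?thesis
    proof (cases "1 < g y")
      case True
      show ?thesis unfolding c1 c2 sw his[OF True] eq using True x1 xy by auto
    next
      case False
      then show ?thesis unfolding c1 c2 eq by blast
    qed
  next
    case x2
    then have nx: "g y \<noteq> 1" "g y \<noteq> - 1" using g xy by auto
    have sw: "swp x y \<kappa> = - y" using x2 xy k by (auto simp: swp_def)
    have gp: "g x = (- 1)" using x2 v by simp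
    have gs: "(cox_gen 0 \<circ> g) x = 1" "(cox_gen 0 \<circ> g) y = g y"
      using gp s oth(1)[OF nx g0(2)] by simp_all
    have c1: "cov g x y \<longleftrightarrow> (- 1) < g y \<and> none g x y (- 1) (g y)"
      using xy(1) by (simp only: cov_none gp simp_thms)
    have c2: "cov (cox_gen 0 \<circ> g) x y \<longleftrightarrow> 1 < g y \<and> none (cox_gen 0 \<circ> g) x y 1 (g y)"
      using xy(1) by (simp only: cov_none gs simp_thms)
    have eq: "(- 1 < g y) = (1 < g y)" using nx g0 by linarith
    show ?thesis
    proof (cases "1 < g y")
      case True
      show ?thesis unfolding c1 c2 sw hi[OF True] ps eq using True x2 xy by auto
    next
      case False
      then show ?thesis unfolding c1 c2 eq by blast
    qed
  next
    case y1
    then have nx: "g x \<noteq> 1" "g x \<noteq> - 1" using g xy by auto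
    have sw: "swp x y \<kappa> = x" using y1 xy k by (auto simp: swp_def)
    have gp: "g y = 1" using y1 v by simp
    have gs: "(cox_gen 0 \<circ> g) y = (- 1)" "(cox_gen 0 \<circ> g) x = g x"
      using gp s oth(1)[OF nx g0(1)] by simp_all
    have c1: "cov g x y \<longleftrightarrow> g x < 1 \<and> none g x y (g x) 1"
      using xy(1) by (simp only: cov_none gp simp_thms)
    have c2: "cov (cox_gen 0 \<circ> g) x y \<longleftrightarrow> g x < (- 1) \<and> none (cox_gen 0 \<circ> g) x y (g x) (- 1)"
      using xy(1) by (simp only: cov_none gs simp_thms)
    have eq: "(g x < 1) = (g x < - 1)" using nx g0 by linarith
    show ?thesis
    proof (cases "g x < - 1")
      case True
      show ?thesis unfolding c1 c2 sw lw[OF True] ps eq using True y1 xy by auto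
    next
      case False
      then show ?thesis unfolding c1 c2 eq by blast
    qed
  next
    case y2
    then have nx: "g x \<noteq> 1" "g x \<noteq> - 1" using g xy by auto
    have sw: "swp x y \<kappa> = - x" using y2 xy k by (auto simp: swp_def)
    have gp: "g y = (- 1)" using y2 v by simp
    have gs: "(cox_gen 0 \<circ> g) y = 1" "(cox_gen 0 \<circ> g) x = g x"
      using gp s oth(1)[OF nx g0(1)] by simp_all
    have c1: "cov g x y \<longleftrightarrow> g x < (- 1) \<and> none g x y (g x) (- 1)"
      using xy(1) by (simp only: cov_none gp simp_thms)
    have c2: "cov (cox_gen 0 \<circ> g) x y \<longleftrightarrow> g x < 1 \<and> none (cox_gen 0 \<circ> g) x y (g x) 1"
      using xy(1) by (simp only: cov_none gs simp_thms)
    have eq: "(g x < 1) = (g x < - 1)" using nx g0 by linarith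
    show ?thesis
    proof (cases "g x < - 1")
      case True
      show ?thesis unfolding c1 c2 sw lws[OF True] eq using True y2 xy by auto
    next
      case False
      then show ?thesis unfolding c1 c2 eq by blast
    qed
  qed
qed

section \<open>Hops and deformed generators\<close>

text \<open>Upward coverings, phrased through the sequence on all integers. For the sign change the
  position 0 always lies between \<open>- k\<close> and \<open>k\<close> and has to be exempted; for
  the other reflections it must remain an obstacle.\<close>

definition hop :: "int \<Rightarrow> int \<Rightarrow> (int \<Rightarrow> int) \<Rightarrow> bool" where
  "hop k t g \<longleftrightarrow> (if t = - k then 0 < g k \<and> (\<forall>j. - k < j \<and> j < k \<and> j \<noteq> 0 \<longrightarrow> \<not> \<bar>g j\<bar> < g k)
     else cov g (min k t) (max k t))"

text \<open>The generator compares \<open>k\<close>, up to a common sign of both entries, with a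
  member of \<open>J\<close>.\<close>

definition flip :: "int \<Rightarrow> nat \<Rightarrow> int set \<Rightarrow> (int \<Rightarrow> int) \<Rightarrow> bool" where
  "flip k i J w \<longleftrightarrow> k = w (lo i) \<and> w (up i) \<in> J \<or> k = w (up i) \<and> w (lo i) \<in> J
     \<or> k = - w (lo i) \<and> - w (up i) \<in> J \<or> k = - w (up i) \<and> - w (lo i) \<in> J"

definition Rop :: "'a::comm_ring_1 \<Rightarrow> int \<Rightarrow> int \<Rightarrow> ((int \<Rightarrow> int) \<Rightarrow> 'a) \<Rightarrow> (int \<Rightarrow> int) \<Rightarrow> 'a" where
  "Rop \<beta> k t f w = f w + \<beta> * (if hop k t (inv w) then f (swp k t \<circ> w) else 0)"

text \<open>\<open>Sop\<close> with empty \<open>J\<close> is \<open>dd\<close>. Moving \<open>Rop \<beta> k t\<close> past it adds \<open>t\<close> to \<open>J\<close>, the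
  set of positions whose hops have been passed already.\<close>

definition Sop :: "'a::comm_ring_1 \<Rightarrow> int \<Rightarrow> nat \<Rightarrow> int set \<Rightarrow> ((int \<Rightarrow> int) \<Rightarrow> 'a) \<Rightarrow> (int \<Rightarrow> int) \<Rightarrow> 'a" where
  "Sop \<beta> k i J f w = (if desc w i then f (w \<circ> cox_gen i) else 0)
     + \<beta> * (if desc w i \<noteq> flip k i J w then f w else 0)"

lemma inv_comp_cox_gen: "odd_perm w \<Longrightarrow> inv (w \<circ> cox_gen i) = cox_gen i \<circ> inv w"
  by (simp add: odd_perm_inv_comp odd_perm_cox_gen inv_swp[of "lo i" "up i", folded cox_gen_eq])

definition partner :: "int \<Rightarrow> int \<Rightarrow> nat \<Rightarrow> (int \<Rightarrow> int) \<Rightarrow> bool" where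
  "partner k t i w \<longleftrightarrow> k = w (lo i) \<and> t = w (up i) \<or> k = w (up i) \<and> t = w (lo i)
     \<or> k = - w (lo i) \<and> t = - w (up i) \<or> k = - w (up i) \<and> t = - w (lo i)"

lemma flip_insert: "flip k i (insert t J) w \<longleftrightarrow> flip k i J w \<or> partner k t i w"
  unfolding flip_def partner_def insert_iff by blast

text \<open>Both sides involve \<open>f\<close> at \<open>w\<close>, at
  \<open>w \<circ> cox_gen i\<close>, and at these two after the reflection. Assumption 1 matches
  the terms at \<open>w\<close>, assumption 2 those where both moves are made, and assumption 3
  those where only the reflection is made.\<close>

lemma step_generic:
  fixes \<beta> :: "'a::comm_ring_1"
  assumes 1: "flip k i (insert t J) w = flip k i J w"
    and 2: "hop k t (inv w) \<and> desc (swp k t \<circ> w) i \<longleftrightarrow> desc w i \<and> hop k t (inv (w \<circ> cox_gen i))"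
    and 3: "hop k t (inv w) \<Longrightarrow>
      (desc (swp k t \<circ> w) i \<noteq> flip k i J (swp k t \<circ> w)) = (desc w i \<noteq> flip k i J w)"
  shows "Rop \<beta> k t (Sop \<beta> k i J f) w = Sop \<beta> k i (insert t J) (Rop \<beta> k t f) w"
proof -
  have e: "swp k t \<circ> (w \<circ> cox_gen i) = (swp k t \<circ> w) \<circ> cox_gen i" by (simp add: comp_assoc)
  define h hs D D' th th' where d: "h = hop k t (inv w)" "hs = hop k t (inv (w \<circ> cox_gen i))" "D = desc w i"
    "D' = desc (swp k t \<circ> w) i" "th = (desc w i \<noteq> flip k i J w)"
    "th' = (desc (swp k t \<circ> w) i \<noteq> flip k i J (swp k t \<circ> w))"
  have 2: "h \<and> D' \<longleftrightarrow> D \<and> hs" and 3: "h \<Longrightarrow> th' = th" using 2 3 unfolding d by blast+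
  show ?thesis
    unfolding Rop_def Sop_def 1 e unfolding d(5,6)[symmetric] unfolding d(1-4)[symmetric] using 2 3
    by (cases h; cases D; cases D'; cases hs; cases th; cases th') (simp_all add: algebra_simps)
qed

text \<open>Here \<open>swp k t \<circ> w = w \<circ> cox_gen i\<close>, so only two elements are
  involved. The hop is possible iff \<open>i\<close> is no descent, and compensating for it moves
  the \<beta> term from descents to ascents. This case is the source of the deformation.\<close>

lemma step_partner:
  fixes \<beta> :: "'a::comm_ring_1"
  assumes w: "odd_perm w" and t: "t \<notin> J" and p: "partner k t i w" and k: "0 < k"
  shows "Rop \<beta> k t (Sop \<beta> k i J f) w = Sop \<beta> k i (insert t J) (Rop \<beta> k t f) w"
proof -
  let ?s = "w \<circ> cox_gen i"
  have os: "odd_perm ?s" by (simp add: w odd_perm_comp odd_perm_cox_gen)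
  have ps: "partner k t i ?s" using p by (auto simp: partner_def)
  have hop: "hop k t (inv v) \<longleftrightarrow> \<not> desc v i" if v: "odd_perm v" and pv: "partner k t i v" for v
  proof -
    note iv = odd_perm_inv_f[OF v]
    have iv': "inv v (- v x) = - x" for x using iv odd_perm_minus[OF v] by metis
    show ?thesis
    proof (cases "t = - k")
      case True
      have "v (lo i) = - v (up i)" using pv True unfolding partner_def by auto
      then have i: "i = 0" using odd_perm_eq_minus_iff[OF v] by (auto simp: lo_def up_def split: if_splits)
      have n: "v (-1) = - v 1" using odd_perm_minus[OF v] by blast
      have "k = v 1 \<or> k = - v 1" using pv n by (auto simp: partner_def i lo_def up_def)
      then show ?thesis
      proof
        assume kk: "k = v 1"
        then have "inv v k = 1" using iv by simp
        moreover have "inv v j \<noteq> 0" if "j \<noteq> 0" for j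
          using odd_perm_eq_0_iff[OF odd_perm_inv[OF v]] that by simp
        ultimately have "hop k t (inv v)" unfolding hop_def using True by force
        moreover have "\<not> desc v i" using kk k n by (simp add: i lo_def up_def)
        ultimately show ?thesis by simp
      next
        assume kk: "k = - v 1"
        then have "inv v k = - 1" using iv' by simp
        then have "\<not> hop k t (inv v)" unfolding hop_def using True by simp
        moreover have "desc v i" using kk k n by (simp add: i lo_def up_def)
        ultimately show ?thesis by simp
      qed
    next
      case False
      have i: "0 < i"
      proof (rule ccontr)
        assume "\<not> 0 < i"
        then have "i = 0" by simp
        then have "v (lo i) = - v (up i)" using odd_perm_minus[OF v, of 1] by (simp add: lo_def up_def)
        then show False using pv False unfolding partner_def by auto
      qed
      have l: "up i = lo i + 1" using i by (simp add: lo_def up_def)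
      have adj: "cov g x y \<longleftrightarrow> x < y \<and> g x < g y" if "g x = g y - 1 \<or> g x = g y + 1" for g x y
        using that by (auto simp: cov_def)
      have ne: "v (lo i) \<noteq> v (up i)" using odd_perm_eq_iff[OF v] lo_less_up[of i] by simp
      have gk: "inv v (min k t) = inv v (max k t) - 1 \<or> inv v (min k t) = inv v (max k t) + 1"
        using pv iv iv' l ne by (cases "k < t") (auto simp: partner_def min_def max_def)
      show ?thesis
        unfolding hop_def using False adj[of "inv v" "min k t" "max k t", OF gk] pv iv iv' l ne
        by (cases "k < t") (auto simp: partner_def min_def max_def)
    qed
  qed
  have w': "swp k t \<circ> w = ?s"
  proof -
    have "swp k t = swp (w (lo i)) (w (up i))"
      using p odd_perm_eq_0_iff[OF w] unfolding partner_def
      by (auto simp: swp_commute[of "w (up i)"] swp_uminus swp_commute[of "- w (up i)"])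
    then show ?thesis by (simp add: comp_cox_gen_eq[OF w])
  qed
  have fl: "\<not> flip k i J v" "flip k i (insert t J) v" if v: "odd_perm v" and pv: "partner k t i v" for v
  proof -
    have ne: "v (lo i) \<noteq> v (up i)" "v (lo i) \<noteq> 0" "v (up i) \<noteq> 0"
      using odd_perm_eq_iff[OF v, of "lo i" "up i"] lo_less_up[of i] odd_perm_eq_0_iff[OF v] by auto
    have aux: "\<not> (k = a \<and> b \<in> J \<or> k = b \<and> a \<in> J \<or> k = - a \<and> - b \<in> J \<or> k = - b \<and> - a \<in> J)"
      if "k = a \<and> t = b \<or> k = b \<and> t = a \<or> k = - a \<and> t = - b \<or> k = - b \<and> t = - a"
        "a \<noteq> b" "a \<noteq> 0" "b \<noteq> 0" for a b
      using that(1)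
    proof (elim disjE conjE)
      assume "k = a" "t = b" then show ?thesis using that(2-) t by (cases "a = - b") auto
    next
      assume "k = b" "t = a" then show ?thesis using that(2-) t by (cases "a = - b") auto
    next
      assume "k = - a" "t = - b" then show ?thesis using that(2-) t by (cases "a = - b") auto
    next
      assume "k = - b" "t = - a" then show ?thesis using that(2-) t by (cases "a = - b") auto
    qed
    show "\<not> flip k i J v" using aux[OF pv[unfolded partner_def] ne] unfolding flip_def .
    show "flip k i (insert t J) v" using pv unfolding flip_def partner_def by auto
  qed
  have ss: "swp k t \<circ> ?s = w" and ws: "?s \<circ> cox_gen i = w"
    using w' comp_cox_gen_cox_gen[of w i] by (simp_all add: comp_assoc[symmetric])
  note fl = fl[OF w p] fl[OF os ps]
  note hop = hop[OF w p] hop[OF os ps]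
  note de = desc_comp_cox_gen[OF w, of i]
  show ?thesis
    unfolding Rop_def Sop_def w' ss ws using fl hop de
    by (cases "desc w i") (simp_all add: algebra_simps ws del: o_apply)
qed


section \<open>Passing one hop\<close>

text \<open>Inverting the comparisons of \<open>k\<close> with everything strictly between
  \<open>k\<close> and \<open>t\<close> amounts to placing \<open>k\<close> next to
  \<open>t\<close>. Exchanging two neighbours affects no comparison except their own, which
  \<open>np\<close> excludes.\<close>

lemma theta_exchange:
  fixes k t \<alpha> \<alpha>' :: int
  assumes J: "\<And>q. q \<noteq> 0 \<Longrightarrow> q \<noteq> k \<Longrightarrow> q \<noteq> - k \<Longrightarrow> q \<in> J \<longleftrightarrow> min k t < q \<and> q < max k t"
    and k: "0 < k" "t \<noteq> 0" "t \<noteq> k" "t \<noteq> - k"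
    and a: "\<alpha> \<noteq> \<alpha>'" "\<alpha> \<noteq> - \<alpha>'" "\<alpha> \<noteq> 0" "\<alpha>' \<noteq> 0"
    and np: "\<not> (k = \<alpha> \<and> t = \<alpha>')" "\<not> (k = \<alpha>' \<and> t = \<alpha>)" "\<not> (k = - \<alpha> \<and> t = - \<alpha>')" "\<not> (k = - \<alpha>' \<and> t = - \<alpha>)"
    and th: "\<And>u v. th u v \<longleftrightarrow> (v < u) \<noteq> (k = u \<and> v \<in> J \<or> k = v \<and> u \<in> J \<or> k = - u \<and> - v \<in> J \<or> k = - v \<and> - u \<in> J)"
  shows "th (swp k t \<alpha>) (swp k t \<alpha>') = th \<alpha> \<alpha>'"
proof -
  note sv = swp_values[where p = k and q = t]
  have k0: "k \<noteq> 0" "- k \<noteq> k" "- k \<noteq> t" "- t \<noteq> k" "t \<noteq> - t" "k \<noteq> - t" using k by auto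
  have sk: "swp k t k = t" "swp k t t = k" "swp k t (- k) = - t" "swp k t (- t) = - k"
    using sv(1,2) sv(3)[OF k0(1) k(4)] sv(4)[OF k(2) k0(6)] by simp_all
  have Ja: "\<alpha> \<noteq> k \<Longrightarrow> \<alpha> \<noteq> - k \<Longrightarrow> \<alpha> \<in> J \<longleftrightarrow> min k t < \<alpha> \<and> \<alpha> < max k t"
    "\<alpha>' \<noteq> k \<Longrightarrow> \<alpha>' \<noteq> - k \<Longrightarrow> \<alpha>' \<in> J \<longleftrightarrow> min k t < \<alpha>' \<and> \<alpha>' < max k t"
    "\<alpha> \<noteq> k \<Longrightarrow> \<alpha> \<noteq> - k \<Longrightarrow> - \<alpha> \<in> J \<longleftrightarrow> min k t < - \<alpha> \<and> - \<alpha> < max k t"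
    "\<alpha>' \<noteq> k \<Longrightarrow> \<alpha>' \<noteq> - k \<Longrightarrow> - \<alpha>' \<in> J \<longleftrightarrow> min k t < - \<alpha>' \<and> - \<alpha>' < max k t"
    using J[of \<alpha>] J[of \<alpha>'] J[of "- \<alpha>"] J[of "- \<alpha>'"] a by auto
  have Jt: "- t \<in> J \<longleftrightarrow> min k t < - t \<and> - t < max k t"
    using J[of "- t"] k k0 by auto
  have fixv: "swp k t v = v" if "v \<noteq> k" "v \<noteq> t" "v \<noteq> - k" "v \<noteq> - t" for v using sv(5) that by blast
  have th0: "th u v \<longleftrightarrow> v < u" if "u \<noteq> k" "u \<noteq> - k" "v \<noteq> k" "v \<noteq> - k" for u v
    using that unfolding th by auto
  have th1: "th k v \<longleftrightarrow> (v < k) \<noteq> (v \<in> J)" "th v k \<longleftrightarrow> (k < v) \<noteq> (v \<in> J)"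
    "th (- k) v \<longleftrightarrow> (v < - k) \<noteq> (- v \<in> J)" "th v (- k) \<longleftrightarrow> (- k < v) \<noteq> (- v \<in> J)" if "v \<noteq> k" "v \<noteq> - k" for v
    using that k unfolding th by auto
  \<comment> \<open>The inverted comparison with \<open>k\<close> is the plain comparison with
    \<open>t\<close>.\<close>
  have cmp: "(q < k) \<noteq> (min k t < q \<and> q < max k t) \<longleftrightarrow> q < t" "(k < q) \<noteq> (min k t < q \<and> q < max k t) \<longleftrightarrow> t < q"
    if "q \<noteq> k" "q \<noteq> t" for q
    using that by (cases "k < t"; simp add: min_def max_def; linarith)+
  have cmp': "(q < - k) \<noteq> (min k t < - q \<and> - q < max k t) \<longleftrightarrow> q < - t"
    "(- k < q) \<noteq> (min k t < - q \<and> - q < max k t) \<longleftrightarrow> - t < q"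
    if "q \<noteq> - k" "q \<noteq> - t" for q
  proof -
    have "- q \<noteq> k" "- q \<noteq> t" using that by auto
    from cmp[OF this] show "(q < - k) \<noteq> (min k t < - q \<and> - q < max k t) \<longleftrightarrow> q < - t"
      "(- k < q) \<noteq> (min k t < - q \<and> - q < max k t) \<longleftrightarrow> - t < q" by auto
  qed
  have tk: "t \<noteq> k" "t \<noteq> - k" "- t \<noteq> k" "- t \<noteq> - k" using k k0 by auto
  show ?thesis
  proof (cases "k = \<alpha> \<or> k = \<alpha>' \<or> k = - \<alpha> \<or> k = - \<alpha>'")
    case True
    then consider "\<alpha> = k" | "\<alpha>' = k" | "\<alpha> = - k" | "\<alpha>' = - k" by force
    then show ?thesis
    proof cases
      case 1
      have na: "\<alpha>' \<noteq> k" "\<alpha>' \<noteq> - k" "\<alpha>' \<noteq> t" using 1 a np by auto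
      show ?thesis
      proof (cases "\<alpha>' = - t")
        case True
        show ?thesis unfolding 1 True sk th1(1)[OF tk(3,4)] th1(4)[OF tk(1,2)] by auto
      next
        case False
        show ?thesis
          unfolding 1 sk fixv[OF na(1,3,2) False] th1(1)[OF na(1,2)] th0[OF tk(1,2) na(1,2)]
            Ja(2)[OF na(1,2)] cmp(1)[OF na(1,3)] ..
      qed
    next
      case 2
      have na: "\<alpha> \<noteq> k" "\<alpha> \<noteq> - k" "\<alpha> \<noteq> t" using 2 a np by auto
      show ?thesis
      proof (cases "\<alpha> = - t")
        case True
        show ?thesis unfolding 2 True sk th1(2)[OF tk(3,4)] th1(3)[OF tk(1,2)] by auto
      next
        case False
        show ?thesis
          unfolding 2 sk fixv[OF na(1,3,2) False] th1(2)[OF na(1,2)] th0[OF na(1,2) tk(1,2)]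
            Ja(1)[OF na(1,2)] cmp(2)[OF na(1,3)] ..
      qed
    next
      case 3
      have na: "\<alpha>' \<noteq> k" "\<alpha>' \<noteq> - k" "\<alpha>' \<noteq> - t" using 3 a np by auto
      show ?thesis
      proof (cases "\<alpha>' = t")
        case True
        show ?thesis unfolding 3 True sk th1(3)[OF tk(1,2)] th1(2)[OF tk(3,4)] by auto
      next
        case False
        show ?thesis
          unfolding 3 sk fixv[OF na(1) False na(2,3)] th1(3)[OF na(1,2)] th0[OF tk(3,4) na(1,2)]
            Ja(4)[OF na(1,2)] cmp'(1)[OF na(2,3)] ..
      qed
    next
      case 4
      have na: "\<alpha> \<noteq> k" "\<alpha> \<noteq> - k" "\<alpha> \<noteq> - t" using 4 a np by auto
      show ?thesis
      proof (cases "\<alpha> = t")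
        case True
        show ?thesis unfolding 4 True sk th1(4)[OF tk(1,2)] th1(1)[OF tk(3,4)] by auto
      next
        case False
        show ?thesis
          unfolding 4 sk fixv[OF na(1) False na(2,3)] th1(4)[OF na(1,2)] th0[OF na(1,2) tk(3,4)]
            Ja(3)[OF na(1,2)] cmp'(2)[OF na(2,3)] ..
      qed
    qed
  next
    case False
    then have nk: "\<alpha> \<noteq> k" "\<alpha>' \<noteq> k" "\<alpha> \<noteq> - k" "\<alpha>' \<noteq> - k" by auto
    note t0 = th0[OF nk(1,3,2,4)]
    show ?thesis
    proof (cases "\<alpha> = t \<or> \<alpha>' = t \<or> \<alpha> = - t \<or> \<alpha>' = - t")
      case True
      then consider "\<alpha> = t" | "\<alpha>' = t" | "\<alpha> = - t" | "\<alpha>' = - t" by blast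
      then show ?thesis
      proof cases
        case 1
        have na: "\<alpha>' \<noteq> t" "\<alpha>' \<noteq> - t" using 1 a by auto
        show ?thesis unfolding t0 unfolding 1 sk fixv[OF nk(2) na(1) nk(4) na(2)] th1(1)[OF nk(2,4)]
          Ja(2)[OF nk(2,4)] cmp(1)[OF nk(2) na(1)] ..
      next
        case 2
        have na: "\<alpha> \<noteq> t" "\<alpha> \<noteq> - t" using 2 a by auto
        show ?thesis unfolding t0 unfolding 2 sk fixv[OF nk(1) na(1) nk(3) na(2)] th1(2)[OF nk(1,3)]
          Ja(1)[OF nk(1,3)] cmp(2)[OF nk(1) na(1)] ..
      next
        case 3
        have na: "\<alpha>' \<noteq> t" "\<alpha>' \<noteq> - t" using 3 a by auto
        show ?thesis unfolding t0 unfolding 3 sk fixv[OF nk(2) na(1) nk(4) na(2)] th1(3)[OF nk(2,4)]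
          Ja(4)[OF nk(2,4)] cmp'(1)[OF nk(4) na(2)] ..
      next
        case 4
        have na: "\<alpha> \<noteq> t" "\<alpha> \<noteq> - t" using 4 a by auto
        show ?thesis unfolding t0 unfolding 4 sk fixv[OF nk(1) na(1) nk(3) na(2)] th1(4)[OF nk(1,3)]
          Ja(3)[OF nk(1,3)] cmp'(2)[OF nk(3) na(2)] ..
      qed
    next
      case False
      then show ?thesis using fixv nk by simp
    qed
  qed
qed

lemma step_far:
  fixes \<beta> :: "'a::comm_ring_1"
  assumes w: "odd_perm w" and p: "\<not> partner k t i w" and i: "0 < i"
    and k: "0 < k" "t \<noteq> 0" "t \<noteq> k" "t \<noteq> - k"
    and J: "\<And>q. q \<noteq> 0 \<Longrightarrow> q \<noteq> k \<Longrightarrow> q \<noteq> - k \<Longrightarrow> q \<in> J \<longleftrightarrow> min k t < q \<and> q < max k t"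
  shows "Rop \<beta> k t (Sop \<beta> k i J f) w = Sop \<beta> k i (insert t J) (Rop \<beta> k t f) w"
proof (rule step_generic)
  let ?a = "w (lo i)" and ?b = "w (up i)"
  have l: "lo i = int i" "up i = int i + 1" using i by (auto simp: lo_def up_def)
  have a: "?a \<noteq> ?b" "?a \<noteq> - ?b" "?a \<noteq> 0" "?b \<noteq> 0"
    using odd_perm_eq_iff[OF w] odd_perm_eq_minus_iff[OF w] odd_perm_eq_0_iff[OF w] i
    by (auto simp: l)
  show "flip k i (insert t J) w = flip k i J w"
    using p flip_insert by blast
  have g: "inv w j = int i \<longleftrightarrow> j = ?a" "inv w j = int i + 1 \<longleftrightarrow> j = ?b"
    "inv w j = - int i \<longleftrightarrow> j = - ?a" "inv w j = - int i - 1 \<longleftrightarrow> j = - ?b" "inv w 0 = 0" for j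
    using odd_perm_inv_eq_iff[OF w] odd_perm_minus[OF w, of "int i"] odd_perm_minus[OF w, of "int i + 1"]
      odd_perm_0[OF odd_perm_inv[OF w]] by (auto simp: l)
  have mm: "min k t < max k t" "min k t \<noteq> - max k t" "min k t \<noteq> 0" "max k t \<noteq> 0"
    using k by (auto simp: min_def max_def)
  have np: "\<not> (min k t = ?a \<and> max k t = ?b)" "\<not> (min k t = ?b \<and> max k t = ?a)"
    "\<not> (min k t = - ?a \<and> max k t = - ?b)" "\<not> (min k t = - ?b \<and> max k t = - ?a)"
    using p unfolding partner_def by (auto simp: min_def max_def split: if_splits)
  have sw: "swp (min k t) (max k t) = swp k t"
    by (auto simp: min_def max_def swp_commute)
  show "hop k t (inv w) \<and> desc (swp k t \<circ> w) i \<longleftrightarrow> desc w i \<and> hop k t (inv (w \<circ> cox_gen i))"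
    using cov_cox_gen[OF i g mm np] k(4) unfolding inv_comp_cox_gen[OF w] hop_def sw by simp
  define th where "th u v \<longleftrightarrow> (v < u) \<noteq> (k = u \<and> v \<in> J \<or> k = v \<and> u \<in> J \<or> k = - u \<and> - v \<in> J \<or> k = - v \<and> - u \<in> J)"
    for u v :: int
  have np': "\<not> (k = ?a \<and> t = ?b)" "\<not> (k = ?b \<and> t = ?a)" "\<not> (k = - ?a \<and> t = - ?b)" "\<not> (k = - ?b \<and> t = - ?a)"
    using p unfolding partner_def by blast+
  have "th (swp k t ?a) (swp k t ?b) = th ?a ?b"
    by (rule theta_exchange[OF J k a np' th_def])
  then show "(desc (swp k t \<circ> w) i \<noteq> flip k i J (swp k t \<circ> w)) = (desc w i \<noteq> flip k i J w)"
    unfolding th_def flip_def by simp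
qed

text \<open>The generator \<open>cox_gen 0\<close> compares a value with its negative, so only the
  membership of \<open>- k\<close> in \<open>J\<close> matters.\<close>

lemma step_far_0:
  fixes \<beta> :: "'a::comm_ring_1"
  assumes w: "odd_perm w"
    and k: "0 < k" "t \<noteq> 0" "t \<noteq> k" "t \<noteq> - k"
    and J: "- k \<in> J \<longleftrightarrow> t < 0"
  shows "Rop \<beta> k t (Sop \<beta> k 0 J f) w = Sop \<beta> k 0 (insert t J) (Rop \<beta> k t f) w"
proof (rule step_generic)
  let ?c = "w 1"
  have l: "lo 0 = - 1" "up 0 = 1" by (auto simp: lo_def up_def)
  have n: "w (- 1) = - w 1" using odd_perm_minus[OF w] by blast
  have c0: "?c \<noteq> 0" using odd_perm_eq_0_iff[OF w] by simp
  have mm: "min k t < max k t" "min k t \<noteq> - max k t" "min k t \<noteq> 0" "max k t \<noteq> 0"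
    using k by (auto simp: min_def max_def)
  have sw: "swp (min k t) (max k t) = swp k t"
    by (auto simp: min_def max_def swp_commute)
  have so: "swp k t (- v) = - swp k t v" for v
    using odd_perm_minus[OF odd_perm_swp[of k t]] k by simp
  show "flip k 0 (insert t J) w = flip k 0 J w"
    using k unfolding flip_def l n by auto
  have g: "inv w j = 1 \<longleftrightarrow> j = ?c" "inv w j = - 1 \<longleftrightarrow> j = - ?c" "inv w j = 0 \<longleftrightarrow> j = 0" for j
    using odd_perm_inv_eq_iff[OF w] n odd_perm_0[OF w] by auto
  have d: "desc w 0 \<longleftrightarrow> ?c < 0" "desc (swp k t \<circ> w) 0 \<longleftrightarrow> swp k t ?c < 0"
    by (auto simp: l n so)
  show "hop k t (inv w) \<and> desc (swp k t \<circ> w) 0 \<longleftrightarrow> desc w 0 \<and> hop k t (inv (w \<circ> cox_gen 0))"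
    using cov_cox_gen_0[OF g mm] k(4) unfolding inv_comp_cox_gen[OF w] hop_def sw d by simp
  have fl: "flip k 0 J v \<longleftrightarrow> (k = v 1 \<or> k = - v 1) \<and> t < 0" if "v (- 1) = - v 1" for v
    unfolding flip_def l that using J by auto
  have fl': "flip k 0 J (swp k t \<circ> w) \<longleftrightarrow> (k = swp k t ?c \<or> k = - swp k t ?c) \<and> t < 0"
    using fl[of "swp k t \<circ> w"] n so by simp
  have sv: "swp k t k = t" "swp k t t = k" "swp k t (- k) = - t" "swp k t (- t) = - k"
    using k by (auto simp: swp_def)
  consider "?c = k" | "?c = - k" | "?c = t" | "?c = - t" | "?c \<noteq> k" "?c \<noteq> - k" "?c \<noteq> t" "?c \<noteq> - t" by blast
  then show "(desc (swp k t \<circ> w) 0 \<noteq> flip k 0 J (swp k t \<circ> w)) = (desc w 0 \<noteq> flip k 0 J w)"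
  proof cases
    case 5
    then have "swp k t ?c = ?c" by (intro swp_values(5))
    then show ?thesis unfolding d fl[OF n] fl' by simp
  next
    case 1
    show ?thesis unfolding d fl[OF n] fl' unfolding 1 sv using k by auto
  next
    case 2
    show ?thesis unfolding d fl[OF n] fl' unfolding 2 sv using k by auto
  next
    case 3
    show ?thesis unfolding d fl[OF n] fl' unfolding 3 sv using k by auto
  next
    case 4
    show ?thesis unfolding d fl[OF n] fl' unfolding 4 sv using k by auto
  qed
qed

text \<open>Having crossed the positive values below it, \<open>k\<close> is next to 0, and by
  symmetry so is \<open>- k\<close>. The two are then neighbours and may change places.\<close>

lemma step_sign:
  fixes \<beta> :: "'a::comm_ring_1"
  assumes w: "odd_perm w" and p: "\<not> partner k (- k) i w" and k: "0 < k"
    and J: "\<And>q. q \<noteq> 0 \<Longrightarrow> q \<noteq> k \<Longrightarrow> q \<noteq> - k \<Longrightarrow> q \<in> J \<longleftrightarrow> 0 < q \<and> q < k"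
  shows "Rop \<beta> k (- k) (Sop \<beta> k i J f) w = Sop \<beta> k i (insert (- k) J) (Rop \<beta> k (- k) f) w"
proof (rule step_generic)
  let ?g = "inv w"
  note wi = odd_perm_inv[OF w]
  define nn where "nn g c \<longleftrightarrow> (\<forall>j. - k < j \<and> j < k \<and> j \<noteq> 0 \<longrightarrow> \<not> \<bar>g j\<bar> < c)" for g :: "int \<Rightarrow> int" and c
  have hop: "hop k (- k) g \<longleftrightarrow> 0 < g k \<and> nn g (g k)" for g by (simp add: hop_def nn_def)
  have sk: "swp k (- k) k = - k" "swp k (- k) (- k) = k" "v \<noteq> k \<Longrightarrow> v \<noteq> - k \<Longrightarrow> swp k (- k) v = v" for v
    by (auto simp: swp_def)
  show "flip k i (insert (- k) J) w = flip k i J w"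
    using p flip_insert by blast
  show "hop k (- k) ?g \<and> desc (swp k (- k) \<circ> w) i \<longleftrightarrow> desc w i \<and> hop k (- k) (inv (w \<circ> cox_gen i))" (is ?A)
    and "(desc (swp k (- k) \<circ> w) i \<noteq> flip k i J (swp k (- k) \<circ> w)) = (desc w i \<noteq> flip k i J w)" (is ?B)
  proof -
    have "?A \<and> ?B"
    proof (cases "i = 0")
      case True
      have l: "lo i = - 1" "up i = 1" using True by (auto simp: lo_def up_def)
      have n: "w (- 1) = - w 1" using odd_perm_minus[OF w] by blast
      have nk: "w 1 \<noteq> k" "w 1 \<noteq> - k" using p unfolding partner_def l n by auto
      have gk: "?g k \<noteq> 1" "?g k \<noteq> - 1" using odd_perm_inv_eq_iff[OF w] n nk by auto
      have "cox_gen i (?g k) = ?g k" "\<bar>cox_gen i v\<bar> = \<bar>v\<bar>" for v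
        using gk by (auto simp: cox_gen_eq swp_def l)
      then have "hop k (- k) (inv (w \<circ> cox_gen i)) = hop k (- k) ?g"
        unfolding inv_comp_cox_gen[OF w] hop nn_def by simp
      moreover have "swp k (- k) (w 1) = w 1" "swp k (- k) (- w 1) = - w 1"
        using sk(3) nk by (auto simp: minus_equation_iff)
      ultimately show ?thesis by (auto simp: flip_def l n)
    next
      case False
      then have i: "0 < i" by simp
      have l: "lo i = int i" "up i = int i + 1" using i by (auto simp: lo_def up_def)
      define a b where ab: "a = w (lo i)" "b = w (up i)"
      have ne: "a \<noteq> b" "a \<noteq> - b" "a \<noteq> 0" "b \<noteq> 0"
        using odd_perm_eq_iff[OF w] odd_perm_eq_minus_iff[OF w] odd_perm_eq_0_iff[OF w] i
        by (auto simp: l ab)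
      have g: "?g j = int i \<longleftrightarrow> j = a" "?g j = int i + 1 \<longleftrightarrow> j = b"
        "?g j = - int i \<longleftrightarrow> j = - a" "?g j = - int i - 1 \<longleftrightarrow> j = - b" for j
        using odd_perm_inv_eq_iff[OF w] odd_perm_minus[OF w, of "int i"] odd_perm_minus[OF w, of "int i + 1"]
        by (auto simp: l ab)
      have gab: "?g a = int i" "?g b = int i + 1" "?g (- a) = - int i" "?g (- b) = - int i - 1" using g by blast+
      note f = cox_gen_pos_facts[OF i]
      have range_insert: "(\<forall>j. - k < j \<and> j < k \<and> j \<noteq> 0 \<longrightarrow> \<not> (A j \<or> j = c \<or> j = - c))
          \<longleftrightarrow> (\<forall>j. - k < j \<and> j < k \<and> j \<noteq> 0 \<longrightarrow> \<not> A j) \<and> \<not> (- k < c \<and> c < k)"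
        if "c \<noteq> 0" for c and A :: "int \<Rightarrow> bool"
      proof (intro iffI conjI)
        assume *: "\<forall>j. - k < j \<and> j < k \<and> j \<noteq> 0 \<longrightarrow> \<not> (A j \<or> j = c \<or> j = - c)"
        show "\<forall>j. - k < j \<and> j < k \<and> j \<noteq> 0 \<longrightarrow> \<not> A j" using * by blast
        show "\<not> (- k < c \<and> c < k)" using *[rule_format, of c] that by blast
      next
        assume "(\<forall>j. - k < j \<and> j < k \<and> j \<noteq> 0 \<longrightarrow> \<not> A j) \<and> \<not> (- k < c \<and> c < k)"
        then show "\<forall>j. - k < j \<and> j < k \<and> j \<noteq> 0 \<longrightarrow> \<not> (A j \<or> j = c \<or> j = - c)" by auto
      qed
      have nn1: "nn (cox_gen i \<circ> ?g) (int i) \<longleftrightarrow> nn ?g (int i)"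
      proof -
        have "\<bar>cox_gen i v\<bar> < int i \<longleftrightarrow> \<bar>v\<bar> < int i" for v
          using f(6,9)[of v] by (auto simp: abs_less_iff)
        then show ?thesis by (simp add: nn_def)
      qed
      have nn2: "nn (cox_gen i \<circ> ?g) (int i + 1) \<longleftrightarrow> nn ?g (int i) \<and> \<not> (- k < b \<and> b < k)"
      proof -
        have "\<bar>cox_gen i v\<bar> < int i + 1 \<longleftrightarrow> \<bar>v\<bar> < int i \<or> v = int i + 1 \<or> v = - int i - 1" for v
          using i unfolding cox_gen_eq swp_def lo_def up_def by auto
        then have e: "\<bar>cox_gen i (?g j)\<bar> < int i + 1 \<longleftrightarrow> \<bar>?g j\<bar> < int i \<or> j = b \<or> j = - b" for j
          using g(2,4)[of j] by simp
        show ?thesis unfolding nn_def comp_apply e by (rule range_insert[OF ne(4)])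
      qed
      have nn3: "nn ?g (int i + 1) \<longleftrightarrow> nn ?g (int i) \<and> \<not> (- k < a \<and> a < k)"
      proof -
        have "\<bar>v\<bar> < int i + 1 \<longleftrightarrow> \<bar>v\<bar> < int i \<or> v = int i \<or> v = - int i" for v by auto
        then have e: "\<bar>?g j\<bar> < int i + 1 \<longleftrightarrow> \<bar>?g j\<bar> < int i \<or> j = a \<or> j = - a" for j
          using g(1,3)[of j] by simp
        show ?thesis unfolding nn_def e by (rule range_insert[OF ne(3)])
      qed
      have Jq: "a \<noteq> k \<Longrightarrow> a \<noteq> - k \<Longrightarrow> (a \<in> J \<longleftrightarrow> 0 < a \<and> a < k) \<and> (- a \<in> J \<longleftrightarrow> a < 0 \<and> - k < a)"
        "b \<noteq> k \<Longrightarrow> b \<noteq> - k \<Longrightarrow> (b \<in> J \<longleftrightarrow> 0 < b \<and> b < k) \<and> (- b \<in> J \<longleftrightarrow> b < 0 \<and> - k < b)"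
        using J[of a] J[of "- a"] J[of b] J[of "- b"] ne by auto
      have D: "desc w i \<longleftrightarrow> b < a" "desc (swp k (- k) \<circ> w) i \<longleftrightarrow> swp k (- k) b < swp k (- k) a" by (simp_all add: ab)
      have F: "flip k i J w \<longleftrightarrow> k = a \<and> b \<in> J \<or> k = b \<and> a \<in> J \<or> k = - a \<and> - b \<in> J \<or> k = - b \<and> - a \<in> J"
        by (simp add: flip_def ab)
      have F': "flip k i J (swp k (- k) \<circ> w) \<longleftrightarrow> k = swp k (- k) a \<and> swp k (- k) b \<in> J
          \<or> k = swp k (- k) b \<and> swp k (- k) a \<in> J \<or> k = - swp k (- k) a \<and> - swp k (- k) b \<in> J
          \<or> k = - swp k (- k) b \<and> - swp k (- k) a \<in> J"
        by (simp add: flip_def ab)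
      note H = hop inv_comp_cox_gen[OF w] comp_apply[of "cox_gen i" ?g k]
      consider "a = k" | "b = k" | "a = - k" | "b = - k" | "a \<noteq> k" "b \<noteq> k" "a \<noteq> - k" "b \<noteq> - k" by blast
      then show ?thesis
      proof cases
        case 1
        have nb: "b \<noteq> k" "b \<noteq> - k" "k \<noteq> b" "k \<noteq> - b" "- k \<noteq> k" "k \<noteq> - k" using 1 ne k by auto
        have gk: "?g k = int i" using gab 1 by simp
        have F1: "flip k i J w \<longleftrightarrow> 0 < b \<and> b < k"
          unfolding F 1 using nb Jq(2)[OF nb(1,2)] by simp
        have F2: "flip k i J (swp k (- k) \<circ> w) \<longleftrightarrow> b < 0 \<and> - k < b"
          unfolding F' 1 sk(1) sk(3)[OF nb(1,2)] using nb Jq(2)[OF nb(1,2)] by simp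
        have D1: "desc w i \<longleftrightarrow> b < k"
          "desc (swp k (- k) \<circ> w) i \<longleftrightarrow> b < - k"
          unfolding D 1 sk(1) sk(3)[OF nb(1,2)] by simp_all
        show ?thesis unfolding D1 F1 F2 H gk f nn2 using nb ne k i by auto
      next
        case 2
        have nb: "a \<noteq> k" "a \<noteq> - k" "k \<noteq> a" "k \<noteq> - a" "- k \<noteq> k" "k \<noteq> - k" using 2 ne k by auto
        have gk: "?g k = int i + 1" using gab 2 by simp
        have F1: "flip k i J w \<longleftrightarrow> 0 < a \<and> a < k"
          unfolding F 2 using nb Jq(1)[OF nb(1,2)] by simp
        have F2: "flip k i J (swp k (- k) \<circ> w) \<longleftrightarrow> a < 0 \<and> - k < a"
          unfolding F' 2 sk(1) sk(3)[OF nb(1,2)] using nb Jq(1)[OF nb(1,2)] by simp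
        have D1: "desc w i \<longleftrightarrow> k < a"
          "desc (swp k (- k) \<circ> w) i \<longleftrightarrow> - k < a"
          unfolding D 2 sk(1) sk(3)[OF nb(1,2)] by simp_all
        show ?thesis unfolding D1 F1 F2 H gk f nn3 nn1 using nb ne k i by auto
      next
        case 3
        have nb: "b \<noteq> k" "b \<noteq> - k" "k \<noteq> b" "k \<noteq> - b" "- k \<noteq> k" "k \<noteq> - k" using 3 ne k by auto
        have gk: "?g k = - int i" using gab 3 by simp
        have F1: "flip k i J w \<longleftrightarrow> b < 0 \<and> - k < b"
          unfolding F 3 using nb Jq(2)[OF nb(1,2)] by simp
        have F2: "flip k i J (swp k (- k) \<circ> w) \<longleftrightarrow> 0 < b \<and> b < k"
          unfolding F' 3 sk(2) sk(3)[OF nb(1,2)] using nb Jq(2)[OF nb(1,2)] by simp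
        have D1: "desc w i \<longleftrightarrow> b < - k"
          "desc (swp k (- k) \<circ> w) i \<longleftrightarrow> b < k"
          unfolding D 3 sk(2) sk(3)[OF nb(1,2)] by simp_all
        show ?thesis unfolding D1 F1 F2 H gk f  using nb ne k i by auto
      next
        case 4
        have nb: "a \<noteq> k" "a \<noteq> - k" "k \<noteq> a" "k \<noteq> - a" "- k \<noteq> k" "k \<noteq> - k" using 4 ne k by auto
        have gk: "?g k = - int i - 1" using gab 4 by simp
        have F1: "flip k i J w \<longleftrightarrow> a < 0 \<and> - k < a"
          unfolding F 4 using nb Jq(1)[OF nb(1,2)] by simp
        have F2: "flip k i J (swp k (- k) \<circ> w) \<longleftrightarrow> 0 < a \<and> a < k"
          unfolding F' 4 sk(2) sk(3)[OF nb(1,2)] using nb Jq(1)[OF nb(1,2)] by simp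
        have D1: "desc w i \<longleftrightarrow> - k < a"
          "desc (swp k (- k) \<circ> w) i \<longleftrightarrow> k < a"
          unfolding D 4 sk(2) sk(3)[OF nb(1,2)] by simp_all
        show ?thesis unfolding D1 F1 F2 H gk f  using nb ne k i by auto
      next
        case 5
        define c where "c = ?g k"
        have gk: "c \<noteq> int i" "c \<noteq> int i + 1" "c \<noteq> - int i" "c \<noteq> - int i - 1"
          using 5 g[of k] unfolding c_def by auto
        note o = cox_gen_pos_other[OF i gk]
        have gk': "- c \<noteq> int i" "- c \<noteq> int i + 1" "- c \<noteq> - int i" "- c \<noteq> - int i - 1" using gk by auto
        note o' = cox_gen_pos_other[OF i gk']
        have "\<bar>cox_gen i v\<bar> < c \<longleftrightarrow> \<bar>v\<bar> < c" for v
          using o(2)[of v] o'(3)[of v] by (auto simp: abs_less_iff)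
        then have "nn (cox_gen i \<circ> ?g) c \<longleftrightarrow> nn ?g c" by (simp add: nn_def)
        moreover have "k \<noteq> - a" "k \<noteq> - b" using 5 by auto
        ultimately show ?thesis unfolding D F F' H c_def[symmetric] o(1) sk(3)[OF 5(1,3)] sk(3)[OF 5(2,4)] by auto
      qed
    qed
    then show ?A ?B by blast+
  qed
qed

text \<open>The requirements of the preceding commutation lemmas on the hops already passed; they
  dictate the order of the hops in the two lists below.\<close>

definition ok :: "int \<Rightarrow> int \<Rightarrow> int set \<Rightarrow> bool" where
  "ok k t J \<longleftrightarrow> t \<noteq> 0 \<and> t \<noteq> k \<and> t \<notin> J \<and>
     (t \<noteq> - k \<longrightarrow> (- k \<in> J \<longleftrightarrow> t < 0) \<and>
        (\<forall>q. q \<noteq> 0 \<and> q \<noteq> k \<and> q \<noteq> - k \<longrightarrow> (q \<in> J \<longleftrightarrow> min k t < q \<and> q < max k t))) \<and>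
     (t = - k \<longrightarrow> (\<forall>q. q \<noteq> 0 \<and> q \<noteq> k \<and> q \<noteq> - k \<longrightarrow> (q \<in> J \<longleftrightarrow> 0 < q \<and> q < k)))"

lemma step:
  assumes w: "odd_perm w" and k: "0 < k" and ok: "ok k t J"
  shows "Rop \<beta> k t (Sop \<beta> k i J f) w = Sop \<beta> k i (insert t J) (Rop \<beta> k t f) w"
proof -
  have t: "t \<noteq> 0" "t \<noteq> k" "t \<notin> J" using ok by (auto simp: ok_def)
  show ?thesis
  proof (cases "partner k t i w")
    case True
    then show ?thesis by (rule step_partner[OF w t(3) _ k])
  next
    case False
    show ?thesis
    proof (cases "t = - k")
      case True
      have J: "q \<in> J \<longleftrightarrow> 0 < q \<and> q < k" if "q \<noteq> 0" "q \<noteq> k" "q \<noteq> - k" for q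
        using ok True that unfolding ok_def by blast
      show ?thesis unfolding True by (rule step_sign[OF w False[unfolded True] k J])
    next
      case tk: False
      have J: "q \<in> J \<longleftrightarrow> min k t < q \<and> q < max k t" if "q \<noteq> 0" "q \<noteq> k" "q \<noteq> - k" for q
        using ok tk that unfolding ok_def by blast
      have J0: "- k \<in> J \<longleftrightarrow> t < 0" using ok tk unfolding ok_def by blast
      show ?thesis
      proof (cases "i = 0")
        case True
        then show ?thesis using step_far_0[OF w k t(1,2) tk J0] by blast
      next
        case i: False
        then have "0 < i" by simp
        then show ?thesis by (rule step_far[OF w False _ k t(1,2) tk J])
      qed
    qed
  qed
qed

section \<open>Passing all hops on one side\<close>

definition Rs :: "'a::comm_ring_1 \<Rightarrow> int \<Rightarrow> int list \<Rightarrow> ((int \<Rightarrow> int) \<Rightarrow> 'a) \<Rightarrow> (int \<Rightarrow> int) \<Rightarrow> 'a" where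
  "Rs \<beta> k ts f = foldr (Rop \<beta> k) ts f"

lemma Rs_simps: "Rs \<beta> k [] f = f" "Rs \<beta> k (t # ts) f = Rop \<beta> k t (Rs \<beta> k ts f)"
  by (simp_all add: Rs_def)

fun chain_ok :: "int \<Rightarrow> int list \<Rightarrow> bool" where
  "chain_ok k [] = True"
| "chain_ok k (t # ts) = (ok k t (set ts) \<and> chain_ok k ts)"

lemma Rop_cong:
  assumes "\<And>v. odd_perm v \<Longrightarrow> f v = g v" "odd_perm w" "k \<noteq> 0" "t \<noteq> 0"
  shows "Rop \<beta> k t f w = Rop \<beta> k t g w"
  using assms odd_perm_comp[OF odd_perm_swp[OF assms(3,4)] assms(2)] by (simp add: Rop_def)

lemma Rs_Sop:
  "chain_ok k ts \<Longrightarrow> 0 < k \<Longrightarrow> odd_perm w \<Longrightarrow>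
     Rs \<beta> k ts (Sop \<beta> k i {} f) w = Sop \<beta> k i (set ts) (Rs \<beta> k ts f) w"
proof (induction ts arbitrary: w)
  case (Cons t ts)
  have t: "t \<noteq> 0" using Cons.prems(1) by (simp add: ok_def)
  have "Rs \<beta> k (t # ts) (Sop \<beta> k i {} f) w = Rop \<beta> k t (Sop \<beta> k i (set ts) (Rs \<beta> k ts f)) w"
    unfolding Rs_simps by (rule Rop_cong) (use Cons t in auto)
  also have "\<dots> = Sop \<beta> k i (set (t # ts)) (Rs \<beta> k (t # ts) f) w"
    unfolding Rs_simps list.set by (rule step) (use Cons.prems in auto)
  finally show ?case .
qed (simp add: Rs_simps)

lemma Sop_empty: "odd_perm w \<Longrightarrow> Sop \<beta> k i {} f w = dd \<beta> i f w"
  by (simp add: Sop_def flip_def dd_def)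

definition opS :: "'a::comm_ring_1 \<Rightarrow> 'a \<Rightarrow> int \<Rightarrow> int set \<Rightarrow> nat \<Rightarrow> ((int \<Rightarrow> int) \<Rightarrow> 'a) \<Rightarrow> (int \<Rightarrow> int) \<Rightarrow> 'a" where
  "opS \<beta> x k J i f w = f w + x * Sop \<beta> k i J f w"

lemma Rop_linear: "Rop \<beta> k t (\<lambda>w. f w + x * g w) w = Rop \<beta> k t f w + x * Rop \<beta> k t g w"
  by (simp add: Rop_def algebra_simps)

lemma Rs_linear: "Rs \<beta> k ts (\<lambda>w. f w + x * g w) = (\<lambda>w. Rs \<beta> k ts f w + x * Rs \<beta> k ts g w)"
  by (induction ts) (auto simp: Rs_simps Rop_linear)

lemma Rs_cong:
  assumes "\<And>v. odd_perm v \<Longrightarrow> f v = g v" "k \<noteq> 0" "0 \<notin> set ts"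
  shows "odd_perm w \<Longrightarrow> Rs \<beta> k ts f w = Rs \<beta> k ts g w"
  using assms(3)
proof (induction ts arbitrary: w)
  case (Cons t ts)
  show ?case unfolding Rs_simps by (rule Rop_cong) (use Cons assms(2) in auto)
qed (simp add: Rs_simps assms)

lemma chain_ok_nz: "chain_ok k ts \<Longrightarrow> 0 \<notin> set ts"
  by (induction ts) (auto simp: ok_def)

lemma Rs_opx:
  assumes "chain_ok k ts" "0 < k" "odd_perm w"
  shows "Rs \<beta> k ts (opx \<beta> x i f) w = opS \<beta> x k (set ts) i (Rs \<beta> k ts f) w"
proof -
  have "Rs \<beta> k ts (opx \<beta> x i f) w = Rs \<beta> k ts (\<lambda>w. f w + x * Sop \<beta> k i {} f w) w"
    by (rule Rs_cong) (use assms chain_ok_nz in \<open>auto simp: opx_def Sop_empty\<close>)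
  then show ?thesis using Rs_Sop[OF assms, of \<beta> i f] by (simp add: Rs_linear opS_def)
qed

lemma opS_cong_odd:
  "(\<And>v. odd_perm v \<Longrightarrow> f v = g v) \<Longrightarrow> odd_perm w \<Longrightarrow> opS \<beta> x k J i f w = opS \<beta> x k J i g w"
  by (simp add: opS_def Sop_def odd_perm_comp odd_perm_cox_gen)

lemma fold_opS_cong_odd:
  assumes "\<And>v. odd_perm v \<Longrightarrow> f v = g v"
  shows "odd_perm w \<Longrightarrow> fold (opS \<beta> x k J) L f w = fold (opS \<beta> x k J) L g w"
  using assms
proof (induction L arbitrary: f g)
  case (Cons i L)
  show ?case unfolding fold_simps
  proof (rule Cons.IH[OF Cons.prems(1)])
    fix v
    assume "odd_perm v"
    then show "opS \<beta> x k J i f v = opS \<beta> x k J i g v"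
      using opS_cong_odd[of f g v \<beta> x k J i] Cons.prems(2) by blast
  qed
qed simp

lemma Rs_fold_opx:
  assumes "chain_ok k ts" "0 < k"
  shows "odd_perm w \<Longrightarrow> Rs \<beta> k ts (fold (opx \<beta> x) L f) w = fold (opS \<beta> x k (set ts)) L (Rs \<beta> k ts f) w"
proof (induction L arbitrary: f)
  case (Cons i L)
  have "fold (opS \<beta> x k (set ts)) L (Rs \<beta> k ts (opx \<beta> x i f)) w
      = fold (opS \<beta> x k (set ts)) L (opS \<beta> x k (set ts) i (Rs \<beta> k ts f)) w"
    by (rule fold_opS_cong_odd) (use Rs_opx[OF assms] Cons.prems in auto)
  then show ?case using Cons by simp
qed simp

definition right_hops :: "int \<Rightarrow> nat \<Rightarrow> int list" where
  "right_hops k m = rev [k + 1..int m]"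

text \<open>A list is passed from its end: first \<open>k - 1\<close> down to 1, then
  \<open>- k\<close>, then -1 down to \<open>- k + 1\<close>, finally the places beyond
  \<open>- k\<close>. The sign change comes out of its numerical order because \<open>k\<close> and
  \<open>- k\<close> are neighbours exactly when 0 is reached.\<close>

definition left_hops :: "int \<Rightarrow> nat \<Rightarrow> int list" where
  "left_hops k m = [- int m..- k - 1] @ [- k + 1..- 1] @ [- k] @ [1..k - 1]"

lemma set_right_hops: "set (right_hops k m) = {k + 1..int m}"
  by (simp add: right_hops_def)

lemma set_left_hops: "0 < k \<Longrightarrow> k \<le> int m \<Longrightarrow> set (left_hops k m) = {- int m..k - 1} - {0}"
  by (auto simp: left_hops_def)

lemma chain_ok_upto:
  assumes "\<And>t. a \<le> t \<Longrightarrow> t \<le> b \<Longrightarrow> ok k t ({t + 1..b} \<union> set zs)" "chain_ok k zs"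
  shows "chain_ok k ([a..b] @ zs)"
  using assms(1)
proof (induction "nat (b - a + 1)" arbitrary: a)
  case 0
  then show ?case using assms(2) by simp
next
  case (Suc n)
  then have "a \<le> b" by simp
  moreover have "chain_ok k ([a + 1..b] @ zs)" using Suc by (intro Suc.hyps(1)) auto
  ultimately show ?case using Suc.prems[of a] by (simp add: upto_rec1[of a b] Un_commute)
qed

lemma chain_ok_left: assumes "0 < k" "k \<le> int m" shows "chain_ok k (left_hops k m)"
proof -
  have "chain_ok k ([1..k - 1] @ [])"
    by (rule chain_ok_upto) (use assms in \<open>auto simp: ok_def\<close>)
  then have 4: "chain_ok k [1..k - 1]" by simp
  then have 3: "chain_ok k (- k # [1..k - 1])" using assms by (auto simp: ok_def)
  have 2: "chain_ok k ([- k + 1..- 1] @ (- k # [1..k - 1]))"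
    by (rule chain_ok_upto[OF _ 3]) (use assms in \<open>auto simp: ok_def\<close>)
  have "chain_ok k ([- int m..- k - 1] @ ([- k + 1..- 1] @ (- k # [1..k - 1])))"
    by (rule chain_ok_upto[OF _ 2]) (use assms in \<open>auto simp: ok_def\<close>)
  then show ?thesis by (simp add: left_hops_def)
qed

lemma chain_ok_right: assumes "0 < k" "k \<le> int m" shows "chain_ok k (right_hops k m)"
proof -
  have "chain_ok k (rev [k + 1..k + int n])" for n
  proof (induction n)
    case (Suc n)
    have "[k + 1..k + int (Suc n)] = [k + 1..k + int n] @ [k + int (Suc n)]"
      using upto_rec2[of "k + 1" "k + int (Suc n)"] by simp
    then show ?case using Suc assms by (auto simp: ok_def)
  qed simp
  from this[of "nat (int m - k)"] show ?thesis using assms by (simp add: right_hops_def)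
qed


section \<open>Comparison of the two families of hops\<close>

text \<open>With all larger values in the set, \<open>k\<close> compares as if it were above
  everything; with all smaller ones, as if it were below. So when \<open>k\<close> or
  \<open>- k\<close> takes part, the \<beta> term depends only on which of the two places it
  occupies.\<close>

lemma Sop_values:
  assumes w: "w \<in> signed_perms m" and i: "i < m" and k: "0 < k" "k \<le> int m"
    and J: "J = {k + 1..int m}" and J': "J' = {- int m..k - 1} - {0}"
  shows "inv w k = lo i \<or> inv w k = - up i \<Longrightarrow>
      Sop \<beta> k i J f w = (if desc w i then f (w \<circ> cox_gen i) else 0) + \<beta> * f w
      \<and> Sop \<beta> k i J' f w = (if desc w i then f (w \<circ> cox_gen i) else 0)"
    and "inv w k = up i \<or> inv w k = - lo i \<Longrightarrow>
      Sop \<beta> k i J f w = (if desc w i then f (w \<circ> cox_gen i) else 0)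
      \<and> Sop \<beta> k i J' f w = (if desc w i then f (w \<circ> cox_gen i) else 0) + \<beta> * f w"
    and "inv w k \<notin> {lo i, up i, - lo i, - up i} \<Longrightarrow> Sop \<beta> k i J f w = Sop \<beta> k i J' f w"
proof -
  note o = signed_perms_odd[OF w]
  define a b where ab: "a = w (lo i)" "b = w (up i)"
  have ne: "a \<noteq> b" "a \<noteq> 0" "b \<noteq> 0"
    using odd_perm_eq_iff[OF o, of "lo i" "up i"] odd_perm_eq_0_iff[OF o] lo_less_up[of i] by (auto simp: ab)
  have le: "\<bar>a\<bar> \<le> int m" "\<bar>b\<bar> \<le> int m"
    unfolding ab by (rule signed_perms_abs_le[OF w], use i in \<open>simp add: lo_def up_def\<close>)+
  have inv: "inv w k = lo i \<longleftrightarrow> a = k" "inv w k = up i \<longleftrightarrow> b = k" "inv w k = - lo i \<longleftrightarrow> a = - k" "inv w k = - up i \<longleftrightarrow> b = - k"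
    using odd_perm_inv_eq_iff[OF o] odd_perm_minus[OF o] by (auto simp: ab)
  have F: "flip k i K w \<longleftrightarrow> k = a \<and> b \<in> K \<or> k = b \<and> a \<in> K \<or> k = - a \<and> - b \<in> K \<or> k = - b \<and> - a \<in> K" for K
    by (simp add: flip_def ab)
  have D: "desc w i \<longleftrightarrow> b < a" by (simp add: ab)
  have fk: "a = k \<Longrightarrow> flip k i K w \<longleftrightarrow> b \<in> K" "b = k \<Longrightarrow> flip k i K w \<longleftrightarrow> a \<in> K"
    "a = - k \<Longrightarrow> flip k i K w \<longleftrightarrow> - b \<in> K" "b = - k \<Longrightarrow> flip k i K w \<longleftrightarrow> - a \<in> K" for K
    unfolding F using ne k by (cases "b = - a"; auto)+
  have mem: "q \<in> J \<longleftrightarrow> k < q" "q \<in> J' \<longleftrightarrow> q < k" if "\<bar>q\<bar> \<le> int m" "q \<noteq> 0" for q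
    using that unfolding J J' by auto
  have mems: "b \<in> J \<longleftrightarrow> k < b" "b \<in> J' \<longleftrightarrow> b < k" "a \<in> J \<longleftrightarrow> k < a" "a \<in> J' \<longleftrightarrow> a < k"
    "- b \<in> J \<longleftrightarrow> k < - b" "- b \<in> J' \<longleftrightarrow> - b < k" "- a \<in> J \<longleftrightarrow> k < - a" "- a \<in> J' \<longleftrightarrow> - a < k"
    using mem[of a] mem[of b] mem[of "- a"] mem[of "- b"] le ne by auto
  {
    assume "inv w k = lo i \<or> inv w k = - up i"
    then have "a = k \<or> b = - k" unfolding inv by blast
    then have "(flip k i J w \<longleftrightarrow> \<not> b < a) \<and> (flip k i J' w \<longleftrightarrow> b < a)"
    proof
      assume e: "a = k"
      show ?thesis unfolding fk(1)[OF e] mems using e ne by auto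
    next
      assume e: "b = - k"
      show ?thesis unfolding fk(4)[OF e] mems using e ne by auto
    qed
    then show "Sop \<beta> k i J f w = (if desc w i then f (w \<circ> cox_gen i) else 0) + \<beta> * f w
      \<and> Sop \<beta> k i J' f w = (if desc w i then f (w \<circ> cox_gen i) else 0)"
      unfolding Sop_def D by simp
  next
    assume "inv w k = up i \<or> inv w k = - lo i"
    then have "b = k \<or> a = - k" unfolding inv by blast
    then have "(flip k i J w \<longleftrightarrow> b < a) \<and> (flip k i J' w \<longleftrightarrow> \<not> b < a)"
    proof
      assume e: "b = k"
      show ?thesis unfolding fk(2)[OF e] mems using e ne by auto
    next
      assume e: "a = - k"
      show ?thesis unfolding fk(3)[OF e] mems using e ne by auto
    qed
    then show "Sop \<beta> k i J f w = (if desc w i then f (w \<circ> cox_gen i) else 0)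
      \<and> Sop \<beta> k i J' f w = (if desc w i then f (w \<circ> cox_gen i) else 0) + \<beta> * f w"
      unfolding Sop_def D by simp
  next
    assume "inv w k \<notin> {lo i, up i, - lo i, - up i}"
    then have "a \<noteq> k" "b \<noteq> k" "a \<noteq> - k" "b \<noteq> - k" using inv by auto
    then have "\<not> flip k i K w" for K unfolding F by auto
    then show "Sop \<beta> k i J f w = Sop \<beta> k i J' f w" unfolding Sop_def by simp
  }
qed

text \<open>The two deformations disagree only if \<open>k\<close> stands at one of the four places
  moved by the generator, and then by a summand \<beta> X in the coefficient of \<open>f w\<close>.
  A weight with ratio \<open>1 + \<beta> * X\<close> absorbs it, at the price of being transported
  by \<open>cox_gen i\<close>.\<close>

lemma weight_step:
  fixes y :: "int \<Rightarrow> 'a::comm_ring_1"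
  assumes w: "w \<in> signed_perms m" and i: "i < m" and k: "0 < k" "k \<le> int m"
    and J: "J = {k + 1..int m}" and J': "J' = {- int m..k - 1} - {0}"
    and y: "y (up i) = (1 + \<beta> * X) * y (lo i)" "y (- lo i) = (1 + \<beta> * X) * y (- up i)"
  shows "y (inv w k) * opS \<beta> X k J i f w = opS \<beta> X k J' i (\<lambda>v. y (cox_gen i (inv v k)) * f v) w"
proof -
  note o = signed_perms_odd[OF w]
  have ws: "inv (w \<circ> cox_gen i) k = cox_gen i (inv w k)" by (simp add: inv_comp_cox_gen[OF o])
  have ss: "cox_gen i (cox_gen i v) = v" for v using fun_cong[OF cox_gen_cox_gen[of i], of v] by simp
  have neg: "cox_gen i (- v) = - cox_gen i v" for v by (rule odd_perm_minus[OF odd_perm_cox_gen])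
  note S = Sop_values[OF w i k J J', of \<beta>]
  consider "inv w k = lo i" | "inv w k = - up i" | "inv w k = up i" | "inv w k = - lo i"
    | "inv w k \<notin> {lo i, up i, - lo i, - up i}" by blast
  then show ?thesis
  proof cases
    case 1
    show ?thesis unfolding opS_def using S(1)[OF disjI1[OF 1]] y
      by (simp add: ws ss algebra_simps 1)
  next
    case 2
    show ?thesis unfolding opS_def using S(1)[OF disjI2[OF 2]] y
      by (simp add: ws ss algebra_simps 2 neg)
  next
    case 3
    show ?thesis unfolding opS_def using S(2)[OF disjI1[OF 3]] y
      by (simp add: ws ss algebra_simps 3)
  next
    case 4
    show ?thesis unfolding opS_def using S(2)[OF disjI2[OF 4]] y
      by (simp add: ws ss algebra_simps 4 neg)
  next
    case 5
    have fx: "cox_gen i (inv w k) = inv w k"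
      using 5 by (auto simp: cox_gen_eq swp_def)
    show ?thesis unfolding opS_def S(3)[OF 5] unfolding Sop_def using fx
      by (simp add: ws ss algebra_simps)
  qed
qed

text \<open>The two middle factors merge into one with parameter X = 2x + \<beta> x^2, for which 1 +
  \<beta> X is the square of 1 + \<beta> x. This is why the weight below has the extreme values 1
  and (1 + \<beta> x)^2.\<close>

lemma opS_0_twice:
  fixes \<beta> :: "'a::comm_ring_1"
  assumes w: "w \<in> signed_perms m" and m: "0 < m" and k: "0 < k" "k \<le> int m"
    and K: "K = {k + 1..int m} \<or> K = {- int m..k - 1} - {0}"
  shows "opS \<beta> x k K 0 (opS \<beta> x k K 0 f) w = opS \<beta> (x + x + \<beta> * x * x) k K 0 f w"
proof -
  note o = signed_perms_odd[OF w]
  let ?s = "w \<circ> cox_gen 0"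
  have s: "?s \<in> signed_perms m" by (rule signed_perms_comp[OF w signed_perms_cox_gen[OF m]])
  have l: "lo 0 = - 1" "up 0 = 1" by (auto simp: lo_def up_def)
  have n: "w (- 1) = - w 1" using odd_perm_minus[OF o] by blast
  have n': "?s 1 = - w 1" "?s (- 1) = w 1" using n by (simp_all add: cox_gen_eq swp_def l)
  have c0: "w 1 \<noteq> 0" using odd_perm_eq_0_iff[OF o] by simp
  have ss: "?s \<circ> cox_gen 0 = w" by (rule comp_cox_gen_cox_gen)
  have fl: "flip k 0 K v \<longleftrightarrow> (k = v 1 \<or> k = - v 1) \<and> - k \<in> K" if "v (- 1) = - v 1" for v
    unfolding flip_def l that by auto
  have fw: "flip k 0 K w \<longleftrightarrow> (k = w 1 \<or> k = - w 1) \<and> - k \<in> K" by (rule fl[OF n])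
  have fs: "flip k 0 K ?s \<longleftrightarrow> (k = w 1 \<or> k = - w 1) \<and> - k \<in> K" using fl[of ?s] n' by auto
  have d: "desc w 0 \<longleftrightarrow> w 1 < 0" "desc ?s 0 \<longleftrightarrow> 0 < w 1" using n n' by (auto simp: l)
  define P where "P \<longleftrightarrow> (k = w 1 \<or> k = - w 1) \<and> - k \<in> K"
  have d2: "0 < w 1 \<longleftrightarrow> \<not> w 1 < 0" using c0 by auto
  show ?thesis
    unfolding opS_def Sop_def ss fw fs d unfolding P_def[symmetric] d2
    by (cases "w 1 < 0"; cases P) (simp_all add: algebra_simps)
qed


section \<open>Restriction to smaller groups\<close>

text \<open>Generators beyond the rank find no descent, hence functions need only be compared on
  \<open>signed_perms q\<close>, even under operators with larger indices.\<close>

lemma desc_less: assumes "w \<in> signed_perms q" "desc w i" shows "i < q"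
proof (rule ccontr)
  assume "\<not> i < q"
  then have q: "q \<le> i" by simp
  have u: "w (up i) = up i" using assms(1) q by (auto simp: signed_perms_iff up_def)
  have "w (lo i) \<le> \<bar>lo i\<bar>"
    using signed_perms_abs_le[OF signed_perms_mono[of q "nat \<bar>lo i\<bar>" w], of "lo i"] assms(1) q
    by (auto simp: lo_def split: if_splits)
  then show False using assms(2) u q assms(1)
    by (cases "i = 0") (auto simp: lo_def up_def signed_perms_iff)
qed

lemma opS_cong_SP:
  assumes "\<And>v. v \<in> signed_perms q \<Longrightarrow> f v = g v" "w \<in> signed_perms q"
  shows "opS \<beta> x k J i f w = opS \<beta> x k J i g w"
  using assms desc_less[OF assms(2), of i] signed_perms_comp[OF assms(2) signed_perms_cox_gen[of i q]]
  by (auto simp: opS_def Sop_def)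

lemma fold_opS_cong_SP:
  assumes "\<And>v. v \<in> signed_perms q \<Longrightarrow> f v = g v" "w \<in> signed_perms q"
  shows "fold (opS \<beta> x k J) L f w = fold (opS \<beta> x k J) L g w"
  using assms(1)
proof (induction L arbitrary: f g)
  case (Cons i L)
  show ?case unfolding fold_simps
  proof (rule Cons.IH)
    fix v
    assume "v \<in> signed_perms q"
    then show "opS \<beta> x k J i f v = opS \<beta> x k J i g v"
      using opS_cong_SP[of q f g v \<beta> x k J i] Cons.prems by blast
  qed
qed (simp add: assms)

definition factorS :: "'a::comm_ring_1 \<Rightarrow> 'a \<Rightarrow> int \<Rightarrow> int set \<Rightarrow> nat \<Rightarrow> ((int \<Rightarrow> int) \<Rightarrow> 'a) \<Rightarrow> (int \<Rightarrow> int) \<Rightarrow> 'a" where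
  "factorS \<beta> x k J n = fold (opS \<beta> x k J) (rev [0..<n] @ [0..<n])"

lemma factorS_1: "factorS \<beta> x k J 1 h = opS \<beta> x k J 0 (opS \<beta> x k J 0 h)"
  by (simp add: factorS_def)

lemma factorS_Suc: "factorS \<beta> x k J (Suc n) h = opS \<beta> x k J n (factorS \<beta> x k J n (opS \<beta> x k J n h))"
  by (simp add: factorS_def)

lemma factorS_cong_SP:
  assumes "\<And>v. v \<in> signed_perms q \<Longrightarrow> f v = g v" "w \<in> signed_perms q"
  shows "factorS \<beta> x k J n f w = factorS \<beta> x k J n g w"
  unfolding factorS_def by (rule fold_opS_cong_SP[OF assms])

text \<open>The weight records the equivariant parameter of the value at position \<open>k\<close>. All parameters
  are \<open>0\<close> except one, which the factors of the generating function move from \<open>n\<close> to \<open>- n\<close>.\<close>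

definition wt :: "'a::comm_ring_1 \<Rightarrow> 'a \<Rightarrow> int \<Rightarrow> int \<Rightarrow> 'a" where
  "wt \<beta> x p v = (if v = p then (1 + \<beta> * x) * (1 + \<beta> * x) else if v = - p then 1 else 1 + \<beta> * x)"

lemma wt_cox_gen: "wt \<beta> x p (cox_gen i v) = wt \<beta> x (cox_gen i p) v"
proof -
  have ss: "cox_gen i (cox_gen i u) = u" for u using fun_cong[OF cox_gen_cox_gen[of i], of u] by simp
  have "cox_gen i v = u \<longleftrightarrow> v = cox_gen i u" for u using ss by metis
  then show ?thesis by (simp add: wt_def odd_perm_minus[OF odd_perm_cox_gen])
qed

text \<open>Along the factors with indices n-1, ..., 0, 0, ..., n-1 the special place of the weight
  runs through n, ..., 1, -1, ..., -n.\<close>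

lemma weight_factorS:
  fixes \<beta> :: "'a::comm_ring_1"
  assumes k: "0 < k" "k \<le> int m"
    and J: "J = {k + 1..int m}" and J': "J' = {- int m..k - 1} - {0}"
  shows "1 \<le> n \<Longrightarrow> n \<le> m \<Longrightarrow> w \<in> signed_perms m \<Longrightarrow>
    wt \<beta> x (int n) (inv w k) * factorS \<beta> x k J n h w
      = factorS \<beta> x k J' n (\<lambda>v. wt \<beta> x (- int n) (inv v k) * h v) w"
proof (induction n arbitrary: h w rule: nat_induct_at_least)
  case base
  let ?X = "x + x + \<beta> * x * x"
  have m: "0 < m" using base.prems by simp
  have l: "lo 0 = - 1" "up 0 = 1" by (auto simp: lo_def up_def)
  have s: "cox_gen 0 1 = - 1" by (simp add: cox_gen_eq swp_def l)
  have "wt \<beta> x 1 (inv w k) * opS \<beta> ?X k J 0 h w = opS \<beta> ?X k J' 0 (\<lambda>v. wt \<beta> x 1 (cox_gen 0 (inv v k)) * h v) w"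
    by (rule weight_step[OF base.prems(2) m k J J']) (simp_all add: l wt_def algebra_simps)
  then show ?case
    unfolding factorS_1 opS_0_twice[OF base.prems(2) m k disjI1[OF J]] opS_0_twice[OF base.prems(2) m k disjI2[OF J']]
    by (simp add: wt_cox_gen s)
next
  case (Suc n)
  have n: "n < m" "0 < n" using Suc by auto
  have l: "lo n = int n" "up n = int (Suc n)" using n by (auto simp: lo_def up_def)
  have s: "cox_gen n (int (Suc n)) = int n" "cox_gen n (- int n) = - int (Suc n)"
    using n by (auto simp: cox_gen_eq swp_def lo_def up_def)
  let ?A = "\<lambda>v. factorS \<beta> x k J n (opS \<beta> x k J n h) v"
  have "wt \<beta> x (int (Suc n)) (inv w k) * opS \<beta> x k J n ?A w
      = opS \<beta> x k J' n (\<lambda>v. wt \<beta> x (int (Suc n)) (cox_gen n (inv v k)) * ?A v) w"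
    by (rule weight_step[OF Suc.prems(2) n(1) k J J']) (use n in \<open>simp_all add: l wt_def\<close>)
  also have "\<dots> = opS \<beta> x k J' n (\<lambda>v. wt \<beta> x (int n) (inv v k) * ?A v) w"
    by (simp only: wt_cox_gen s)
  also have "\<dots> = opS \<beta> x k J' n (factorS \<beta> x k J' n (\<lambda>v. wt \<beta> x (- int n) (inv v k) * opS \<beta> x k J n h v)) w"
    by (rule opS_cong_SP[OF _ Suc.prems(2)]) (use Suc.IH n in simp)
  also have "\<dots> = opS \<beta> x k J' n (factorS \<beta> x k J' n (opS \<beta> x k J' n (\<lambda>v. wt \<beta> x (- int (Suc n)) (inv v k) * h v))) w"
  proof (rule opS_cong_SP[OF _ Suc.prems(2)], rule factorS_cong_SP)
    fix v
    assume v: "v \<in> signed_perms m"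
    have "wt \<beta> x (- int n) (inv v k) * opS \<beta> x k J n h v
        = opS \<beta> x k J' n (\<lambda>v. wt \<beta> x (- int n) (cox_gen n (inv v k)) * h v) v"
      by (rule weight_step[OF v n(1) k J J']) (use n in \<open>simp_all add: l wt_def\<close>)
    then show "wt \<beta> x (- int n) (inv v k) * opS \<beta> x k J n h v
        = opS \<beta> x k J' n (\<lambda>v. wt \<beta> x (- int (Suc n)) (inv v k) * h v) v"
      by (simp only: wt_cox_gen s)
  qed
  finally show ?case by (simp only: factorS_Suc)
qed

lemma factorS_mult:
  "factorS \<beta> x k J n (\<lambda>v. c * h v) = (\<lambda>w. c * factorS \<beta> x k J n h w)"
proof -
  have "opS \<beta> x k J i (\<lambda>v. c * h v) = (\<lambda>w. c * opS \<beta> x k J i h w)" for h i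
    by (rule ext) (simp add: opS_def Sop_def algebra_simps)
  then have "fold (opS \<beta> x k J) L (\<lambda>v. c * h v) = (\<lambda>w. c * fold (opS \<beta> x k J) L h w)" for L h
    by (induction L arbitrary: h) simp_all
  then show ?thesis unfolding factorS_def .
qed

section \<open>The transition equation\<close>

definition transition :: "'a::comm_ring_1 \<Rightarrow> int \<Rightarrow> nat \<Rightarrow> ((int \<Rightarrow> int) \<Rightarrow> 'a) \<Rightarrow> bool" where
  "transition \<beta> k q f \<longleftrightarrow>
     (\<forall>w\<in>signed_perms q. Rs \<beta> k (right_hops k (Suc q)) f w = Rs \<beta> k (left_hops k (Suc q)) f w)"

text \<open>A hop ending at the identity would start at the reflection \<open>swp k t\<close>
  itself, from which exchanging \<open>k\<close> and \<open>t\<close> leads down and not up.\<close>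

lemma transition_dlt: assumes "0 < k" "k \<le> int q" shows "transition \<beta> k q (dlt id)"
proof -
  have "Rs \<beta> k ts (dlt id) w = dlt id w" if "odd_perm w" "0 \<notin> set ts" "k \<notin> set ts" for ts w
    using that
  proof (induction ts arbitrary: w)
    case (Cons t ts)
    have t: "t \<noteq> 0" "t \<noteq> k" "k \<noteq> 0" using Cons.prems assms by auto
    have "\<not> hop k t (inv w)" if "swp k t \<circ> w = id"
    proof -
      have "w = swp k t \<circ> (swp k t \<circ> w)" by (simp add: comp_assoc[symmetric] swp_comp_swp t)
      then have "w = swp k t" using that by simp
      then have "inv w = swp k t" using inv_swp t by simp
      then show ?thesis using t assms(1) by (auto simp: hop_def cov_def swp_def min_def max_def)
    qed
    moreover have "Rs \<beta> k ts (dlt id) (swp k t \<circ> w) = dlt id (swp k t \<circ> w)"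
      by (rule Cons.IH[OF odd_perm_comp[OF odd_perm_swp[OF t(3,1)] Cons.prems(1)]]) (use Cons.prems in auto)
    moreover have "Rs \<beta> k ts (dlt id) w = dlt id w" by (rule Cons.IH) (use Cons.prems in auto)
    ultimately show ?case unfolding Rs_simps Rop_def dlt_def by auto
  qed (simp add: Rs_simps)
  then show ?thesis
    using assms by (auto simp: transition_def signed_perms_odd set_right_hops set_left_hops)
qed

lemma transition_factor:
  fixes \<beta> :: "'a::idom"
  assumes k: "0 < k" "k \<le> int q" and x: "1 + \<beta> * x \<noteq> 0" and f: "transition \<beta> k q f"
  shows "transition \<beta> k q (factor \<beta> x (Suc q) f)"
  unfolding transition_def
proof
  fix w
  assume w: "w \<in> signed_perms q"
  let ?m = "Suc q" and ?R = "right_hops k (Suc q)" and ?L = "left_hops k (Suc q)"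
  have km: "k \<le> int ?m" using k by simp
  note o = signed_perms_odd[OF w] and wm = signed_perms_mono[OF _ w, of ?m]
  have J: "set ?R = {k + 1..int ?m}" and J': "set ?L = {- int ?m..k - 1} - {0}"
    using set_right_hops set_left_hops[OF k(1) km] by auto
  \<comment> \<open>The factors have one generator more than the group: the special places are
    \<open>Suc q\<close> and its negative, while \<open>inv v k\<close> is bounded by
    \<open>q\<close>. So both weights reduce to the same constant, which cancels in an integral
    domain.\<close>
  have wt: "wt \<beta> x p (inv v k) = 1 + \<beta> * x" if "v \<in> signed_perms q" "p = int ?m \<or> p = - int ?m" for v p
    using signed_perms_abs_le[OF signed_perms_inv[OF that(1)], of k] k that(2) by (auto simp: wt_def)
  have comp: "factorS \<beta> x k (set ?R) ?m h w = factorS \<beta> x k (set ?L) ?m h w" for h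
  proof -
    have "(1 + \<beta> * x) * factorS \<beta> x k (set ?R) ?m h w = wt \<beta> x (int ?m) (inv w k) * factorS \<beta> x k (set ?R) ?m h w"
      using wt[OF w, of "int ?m"] by simp
    also have "\<dots> = factorS \<beta> x k (set ?L) ?m (\<lambda>v. wt \<beta> x (- int ?m) (inv v k) * h v) w"
      by (rule weight_factorS[OF k(1) km J J']) (use wm in auto)
    also have "\<dots> = factorS \<beta> x k (set ?L) ?m (\<lambda>v. (1 + \<beta> * x) * h v) w"
      by (rule factorS_cong_SP[OF _ w]) (use wt in simp)
    also have "\<dots> = (1 + \<beta> * x) * factorS \<beta> x k (set ?L) ?m h w" by (simp add: factorS_mult)
    finally show ?thesis using x by simp
  qed
  have "Rs \<beta> k ?R (factor \<beta> x ?m f) w = factorS \<beta> x k (set ?R) ?m (Rs \<beta> k ?R f) w"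
    unfolding factor_def factorS_def by (rule Rs_fold_opx[OF chain_ok_right[OF k(1) km] k(1) o])
  also have "\<dots> = factorS \<beta> x k (set ?L) ?m (Rs \<beta> k ?R f) w" by (rule comp)
  also have "\<dots> = factorS \<beta> x k (set ?L) ?m (Rs \<beta> k ?L f) w"
    by (rule factorS_cong_SP[OF _ w]) (use f in \<open>simp add: transition_def\<close>)
  also have "\<dots> = Rs \<beta> k ?L (factor \<beta> x ?m f) w"
    unfolding factor_def factorS_def by (rule Rs_fold_opx[OF chain_ok_left[OF k(1) km] k(1) o, symmetric])
  finally show "Rs \<beta> k ?R (factor \<beta> x ?m f) w = Rs \<beta> k ?L (factor \<beta> x ?m f) w" .
qed

lemma transition_FF:
  assumes "0 < k" "k \<le> int q" shows "transition bR k q (FF (Suc q) N)"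
proof (induction N)
  case 0
  then show ?case using transition_dlt[OF assms] by (simp add: FF_0)
next
  case (Suc N)
  have "Poly_Mapping.lookup (1 + bR * xv (Suc N)) 0 \<noteq> 0"
    by (simp add: lookup_add lookup_bR_times xv_def lookup_single when_def single_zero)
       (metis One_nat_def lookup_single_eq lookup_zero zero_neq_one)
  then have "1 + bR * xv (Suc N) \<noteq> 0" by (metis lookup_zero)
  then show ?case unfolding FF_Suc by (rule transition_factor[OF assms _ Suc])
qed

section \<open>Independence of the rank\<close>

lemma factor_Suc: "factor \<beta> x (Suc m) f = opx \<beta> x m (factor \<beta> x m (opx \<beta> x m f))"
  by (simp add: factor_def)

lemma opx_cong_SP:
  assumes "\<And>v. v \<in> signed_perms q \<Longrightarrow> f v = g v" "w \<in> signed_perms q"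
  shows "opx \<beta> x i f w = opx \<beta> x i g w"
  using assms desc_less[OF assms(2), of i] signed_perms_comp[OF assms(2) signed_perms_cox_gen[of i q]]
  by (auto simp: opx_def dd_def)

lemma factor_cong_SP:
  assumes "\<And>v. v \<in> signed_perms q \<Longrightarrow> f v = g v" "w \<in> signed_perms q"
  shows "factor \<beta> x n f w = factor \<beta> x n g w"
proof -
  have "fold (opx \<beta> x) L f w = fold (opx \<beta> x) L g w" if "\<And>v. v \<in> signed_perms q \<Longrightarrow> f v = g v" for L f g
    using that
  proof (induction L arbitrary: f g)
    case (Cons i L)
    show ?case unfolding fold_simps
    proof (rule Cons.IH)
      fix v
      assume "v \<in> signed_perms q"
      then show "opx \<beta> x i f v = opx \<beta> x i g v"
        using opx_cong_SP[of q f g v \<beta> x i] Cons.prems by blast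
    qed
  qed (simp add: assms)
  then show ?thesis using assms(1) unfolding factor_def by blast
qed

text \<open>The two outermost generators added by each increase of the rank act trivially on the
  smaller group.\<close>

lemma factor_stable:
  assumes "n \<le> m" "w \<in> signed_perms n"
  shows "factor \<beta> x m f w = factor \<beta> x n f w"
  using assms(1)
proof (induction m arbitrary: f rule: dec_induct)
  case (step m)
  have o: "opx \<beta> x m h v = h v" if "v \<in> signed_perms n" for h v
    using desc_less[OF that, of m] step.hyps by (auto simp: opx_def dd_def)
  show ?case
    unfolding factor_Suc o[OF assms(2)] step.IH
    by (rule factor_cong_SP[OF _ assms(2)]) (rule o)
qed simp

lemma FF_stable:
  assumes "n \<le> m" shows "w \<in> signed_perms n \<Longrightarrow> FF m N w = FF n N w"
proof (induction N arbitrary: w)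
  case (Suc N)
  have "FF m (Suc N) w = factor bR (xv (Suc N)) n (FF m N) w"
    unfolding FF_Suc by (rule factor_stable[OF assms Suc.prems])
  also have "\<dots> = FF n (Suc N) w"
    unfolding FF_Suc by (rule factor_cong_SP[OF _ Suc.prems]) (rule Suc.IH)
  finally show ?case .
qed (simp add: FF_0)

section \<open>Vexillary signed permutations\<close>

text \<open>Apart from a complete bipartite set of inversions between positive entries, the bi-infinite
  sequence \<open>\<dots> g(-1) g(0) g(1) \<dots>\<close> avoids the pattern 2143: the inversions \<open>(p, q)\<close> and
  \<open>(- q', - p')\<close> form this pattern iff \<open>0 < p + p'\<close> and \<open>0 < g q + g q'\<close>.\<close>

definition vex :: "(int \<Rightarrow> int) \<Rightarrow> bool" where
  "vex g \<longleftrightarrow> (\<forall>p q p' q'. p < q \<and> g q < g p \<and> p' < q' \<and> g q' < g p' \<and> 0 < p + p' \<and> 0 < g q + g q' \<longrightarrow>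
     0 < p \<and> 0 < g q \<and> p < q' \<and> g q' < g p)"

lemma vexD:
  assumes "vex g" "p < q" "g q < g p" "p' < q'" "g q' < g p'" "0 < p + p'" "0 < g q + g q'"
  shows "0 < p" "0 < g q" "p < q'" "g q' < g p"
  using assms unfolding vex_def by blast+

text \<open>Inverting exchanges positions with values. The two sum conditions change places, and so
  do the two halves of the conclusion. This is needed because the patterns concern \<open>w\<close>,
  but the hops concern \<open>inv w\<close>.\<close>

lemma vex_inv: assumes "odd_perm g" "vex g" shows "vex (inv g)"
  unfolding vex_def
proof (intro allI impI, elim conjE)
  fix p q p' q'
  assume h: "p < q" "inv g q < inv g p" "p' < q'" "inv g q' < inv g p'" "0 < p + p'" "0 < inv g q + inv g q'"
  note f = odd_perm_f_inv[OF assms(1)]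
  have "0 < inv g q \<and> 0 < g (inv g p) \<and> inv g q < inv g p' \<and> g (inv g p') < g (inv g q)"
    using vexD[OF assms(2), of "inv g q" "inv g p" "inv g q'" "inv g p'"] h by (simp add: f)
  moreover have "inv g q' < inv g p" "g (inv g p) < g (inv g q')"
    using vexD(3,4)[OF assms(2), of "inv g q'" "inv g p'" "inv g q" "inv g p"] h by (simp_all add: f add.commute)
  ultimately show "0 < p \<and> 0 < inv g q \<and> p < q' \<and> inv g q' < inv g p"
    by (simp add: f)
qed

text \<open>A negative entry at \<open>l\<close> makes \<open>(- l, l)\<close> an inversion, and
  \<open>(- l, q)\<close> too if \<open>g q\<close> lies below \<open>g (- l)\<close>. One of these
  two violates \<open>vex\<close> together with \<open>(p, q)\<close>, as its left end is
  negative.\<close>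

lemma vex_no_neg_before:
  assumes "odd_perm g" "vex g" "0 < l" "g l < 0" "l < p" "p < q" "g q < g p" "0 < g q"
  shows False
proof (cases "0 < g q + g l")
  case True
  then show ?thesis
    using vexD(1)[OF assms(2), of "- l" l p q] assms odd_perm_minus[OF assms(1)] by simp
next
  case False
  have "g l \<noteq> - g q" using odd_perm_eq_minus_iff[OF assms(1)] assms by auto
  then have "g q < g (- l)" using False odd_perm_minus[OF assms(1)] by simp
  then show ?thesis
    using vexD(1)[OF assms(2), of "- l" q p q] assms by simp
qed

section \<open>Products with a single effective hop\<close>

lemma Rs_no_hop:
  "\<forall>t\<in>set ts. \<not> hop k t (inv w) \<Longrightarrow> Rs \<beta> k ts f w = f w"
  by (induction ts) (auto simp: Rs_simps Rop_def)

text \<open>Evaluation branches along the list from left to right; once the hop \<open>t\<close> has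
  been taken, only the entries of \<open>ys\<close> can follow.\<close>

lemma Rs_one_hop:
  assumes "\<forall>t\<in>set xs. \<not> hop k t (inv w)" "hop k t (inv w)" "\<forall>t\<in>set ys. \<not> hop k t (inv w)"
    "\<forall>t'\<in>set ys. \<not> hop k t' (inv (swp k t \<circ> w))"
  shows "Rs \<beta> k (xs @ t # ys) f w = f w + \<beta> * f (swp k t \<circ> w)"
  using assms(1)
proof (induction xs)
  case Nil
  have "Rs \<beta> k ys f w = f w" "Rs \<beta> k ys f (swp k t \<circ> w) = f (swp k t \<circ> w)"
    using Rs_no_hop assms(3,4) by blast+
  then show ?case unfolding append_Nil Rs_simps Rop_def using assms(2) by (simp only: if_True)
qed (auto simp: Rs_simps Rop_def)

lemma chain_ok_append: "chain_ok k (xs @ ys) \<Longrightarrow> chain_ok k ys"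
  by (induction xs) auto

lemma chain_ok_distinct: "chain_ok k ts \<Longrightarrow> distinct ts"
  by (induction ts) (auto simp: ok_def)

lemma bR_nonzero: "bR \<noteq> 0"
proof
  assume "bR = 0"
  then have "Poly_Mapping.lookup bR 0 = 0" by simp
  then show False by (simp add: bR_def)
qed

section \<open>The step at the last descent\<close>

definition lower_after :: "int \<Rightarrow> (int \<Rightarrow> int) \<Rightarrow> int set" where
  "lower_after r h = {j. r < j \<and> h j < h r}"

text \<open>The choice of the classical transition formula: \<open>r\<close> is the last descent and
  \<open>s\<close> the last place behind it with a smaller entry. Undoing this inversion gives the
  element \<open>u\<close>, at which the transition equation is evaluated.\<close>

locale vex_desc =
  fixes g :: "int \<Rightarrow> int" and n :: nat and r s :: int
  assumes gS: "g \<in> signed_perms n" and vex: "vex g" and r: "0 < r"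
    and tail: "\<And>x y. r < x \<Longrightarrow> x < y \<Longrightarrow> g x < g y"
    and s: "r < s" "g s < g r" "\<And>j. s < j \<Longrightarrow> g r < g j"
begin

lemma odd: "odd_perm g" by (rule signed_perms_odd[OF gS])

abbreviation c where "c \<equiv> g r"
abbreviation a where "a \<equiv> g s"

definition u where "u = g \<circ> swp r s"

lemma s_le: "s \<le> int n" "r \<le> int n"
proof -
  show "s \<le> int n"
  proof (rule ccontr)
    assume "\<not> s \<le> int n"
    then have "g s = s" using gS r s(1) by (auto simp: signed_perms_iff)
    moreover have "g r < s"
      using signed_perms_abs_le[OF gS, of r] gS r s(1) \<open>\<not> s \<le> int n\<close>
      by (cases "r \<le> int n") (auto simp: signed_perms_iff)
    ultimately show False using s(2) by simp
  qed
  then show "r \<le> int n" using s(1) by simp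
qed

lemma uS: "u \<in> signed_perms n"
  unfolding u_def by (rule signed_perms_comp[OF gS signed_perms_swp]) (use r s(1) s_le in auto)

lemma uodd: "odd_perm u" by (rule signed_perms_odd[OF uS])

lemma u_minus: "u (- x) = - u x" by (rule odd_perm_minus[OF uodd])
lemma g_minus: "g (- x) = - g x" by (rule odd_perm_minus[OF odd])
lemma u_inj: "u x = u y \<longleftrightarrow> x = y" by (rule odd_perm_eq_iff[OF uodd])
lemma g_inj: "g x = g y \<longleftrightarrow> x = y" by (rule odd_perm_eq_iff[OF odd])
lemma u0: "u 0 = 0" by (rule odd_perm_0[OF uodd])

lemma u_r: "u r = a" and u_s: "u s = c" and u_mr: "u (- r) = - a" and u_ms: "u (- s) = - c"
  and u_other: "x \<noteq> r \<Longrightarrow> x \<noteq> s \<Longrightarrow> x \<noteq> - r \<Longrightarrow> x \<noteq> - s \<Longrightarrow> u x = g x"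
  unfolding u_minus using r s(1) by (auto simp: u_def swp_def)

lemma a_nz: "a \<noteq> 0" using odd_perm_eq_0_iff[OF odd, of s] r s(1) by simp

lemma tail_lower: "r < x \<Longrightarrow> g x < c \<Longrightarrow> g x \<le> a"
  using s(3)[of x] tail[of x s] by (cases "x < s"; cases "x = s") auto

lemma u_tail: assumes "r < x" "x < y" shows "u x < u y"
proof -
  consider "x = s" | "y = s" | "x \<noteq> s" "y \<noteq> s" by blast
  then show ?thesis
  proof cases
    case 1
    then have "u y = g y" using u_other[of y] assms r s(1) by auto
    then show ?thesis using 1 u_s s(3)[of y] assms by simp
  next
    case 2
    then have "u x = g x" using u_other[of x] assms r s(1) by auto
    then show ?thesis using 2 u_s tail[of x s] assms s(2) by simp
  next
    case 3
    then show ?thesis using u_other[of x] u_other[of y] assms r s(1) tail by auto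
  qed
qed

text \<open>Pulls inversions back to \<open>g\<close> without changing the start or the lower entry,
  the data that enter the two sum conditions of \<open>vex\<close>.\<close>

lemma inversion_u:
  assumes "- r < p" "p < q" "u q < u p"
  shows "\<exists>Q. p < Q \<and> g Q < g p \<and> g Q = u q \<and> (Q = q \<or> q = s \<and> Q = r \<or> q = r \<and> Q = s)"
proof -
  have np: "p \<noteq> - r" "p \<noteq> - s" "q \<noteq> - r" "q \<noteq> - s" using assms r s(1) by auto
  consider (qr) "q = r" | (qs) "q = s" | (pr) "p = r" "q \<noteq> s" | (ps) "p = s" | (oth) "q \<noteq> r" "q \<noteq> s" "p \<noteq> r" "p \<noteq> s" by blast
  then show ?thesis
  proof cases
    case qr
    then have "u p = g p" using u_other[of p] np assms s(1) by auto
    then show ?thesis using qr assms u_r s(1) by (intro exI[of _ s]) auto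
  next
    case qs
    have "p < r" using u_tail[of p q] assms qs u_r u_s s(2) by (cases "p < r"; cases "p = r") auto
    then have "u p = g p" using u_other[of p] np s(1) by auto
    then show ?thesis using qs assms u_s \<open>p < r\<close> by (intro exI[of _ r]) auto
  next
    case pr
    then have "u q = g q" using u_other[of q] np assms by auto
    then show ?thesis using pr assms u_r s(2) by (intro exI[of _ q]) auto
  next
    case ps
    then show ?thesis using u_tail[of p q] assms s(1) by auto
  next
    case oth
    then show ?thesis using u_other[of p] u_other[of q] np assms by (intro exI[of _ q]) auto
  qed
qed

text \<open>Entries below \<open>a\<close> that decrease from \<open>j1\<close> to \<open>j2\<close>
  form an inversion whose mirror image violates \<open>vex\<close> together with
  \<open>(r, s)\<close>. The exception for positive entries leaves only a case across 0, excluded by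
  \<open>sg\<close>. At \<open>- s\<close>, where \<open>u\<close> differs from \<open>g\<close>, a
  separate argument is needed.\<close>

lemma two_hops:
  assumes j: "j1 < j2" "j2 < r" "j1 \<noteq> - r" "j2 \<noteq> - r" and b: "u j2 < u j1" "u j1 < a"
    and sg: "j1 < 0 \<Longrightarrow> \<not> (u j1 < 0 \<and> 0 < a)" and ns: "j1 = - s \<Longrightarrow> a < 0"
  shows False
proof -
  consider (one) "j1 = - s" | (two) "j2 = - s" | (oth) "j1 \<noteq> - s" "j2 \<noteq> - s" by blast
  then show ?thesis
  proof cases
    case oth
    then have e: "u j1 = g j1" "u j2 = g j2" using u_other j s(1) by auto
    have "0 < - j2 \<and> 0 < g (- j1)" "0 < g s"
      using vexD(1,2)[OF vex, of "- j2" "- j1" r s] vexD(2)[OF vex, of r s "- j2" "- j1"] j b e s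
      by (auto simp: g_minus)
    then show False using sg j e by (auto simp: g_minus)
  next
    case one
    then have c: "0 < c" "- c < a" using ns b u_ms by auto
    have b2: "u j2 < - c" using one b u_ms by simp
    have j2: "u j2 = g j2" using u_other[of j2] j one s(1) by auto
    show False
    proof (cases "- r < j2")
      case True
      have "0 < a"
        using vexD(2)[OF vex, of r s "- j2" r] True j s b2 j2 c by (auto simp: g_minus)
      then show False using ns one by simp
    next
      case False
      then have "g (- j2) < g s" using tail[of "- j2" s] j one by auto
      then show False using b2 j2 c ns one by (simp add: g_minus)
    qed
  next
    case two
    then have "c < g (- j1)" using s(3)[of "- j1"] j by simp
    moreover have "u j1 = g j1" using u_other[of j1] two j s(1) r by auto
    ultimately show False using b two u_ms by (simp add: g_minus)
  qed
qed

lemma no_neg: "0 < l \<Longrightarrow> l < r \<Longrightarrow> 0 < a \<Longrightarrow> 0 < g l"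
  using vex_no_neg_before[OF odd vex, of l r s] s odd_perm_eq_0_iff[OF odd, of l]
  by (metis less_irrefl linorder_neqE)

abbreviation "lower \<equiv> lower_after r"
lemmas lower_def = lower_after_def

lemma finite_lower: assumes "h \<in> signed_perms m" shows "finite (lower h)"
proof -
  have "lower h \<subseteq> {r<..max (int m) (h r)}"
  proof
    fix j
    assume "j \<in> lower h"
    then have j: "r < j" "h j < h r" by (auto simp: lower_def)
    show "j \<in> {r<..max (int m) (h r)}"
    proof (cases "j \<le> int m")
      case False
      then have "h j = j" using assms r j by (simp add: signed_perms_iff)
      then show ?thesis using j by simp
    qed (use j in simp)
  qed
  then show ?thesis by (rule finite_subset) simp
qed

lemma lower_less:
  assumes "h \<in> signed_perms m" "\<And>j. r < j \<Longrightarrow> h j < h r \<Longrightarrow> g j < c \<and> j \<noteq> s"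
  shows "card (lower h) < card (lower g)"
proof (rule psubset_card_mono[OF finite_lower[OF gS]])
  show "lower h \<subset> lower g" using assms s(1,2) by (auto simp: lower_def)
qed

text \<open>Between \<open>r\<close> and \<open>s\<close> the entries of \<open>u\<close> are below
  \<open>a\<close>, and behind \<open>s\<close> they are shielded by \<open>c\<close>. So
  \<open>s\<close> is the only hop; it restores \<open>g\<close>, from which no hop to a place
  before \<open>s\<close> remains.\<close>

lemma right_eval: "Rs \<beta> r (right_hops r (Suc n)) f (inv u) = f (inv u) + \<beta> * f (inv g)"
proof -
  have iu: "inv (inv u) = u" by (rule odd_perm_inv_inv[OF uodd])
  have "u \<circ> swp r s = g"
    unfolding u_def using swp_comp_swp[of r s] r s(1) by (simp add: comp_assoc)
  then have sw: "swp r s \<circ> inv u = inv g"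
    using odd_perm_inv_comp[OF uodd odd_perm_swp[of r s]] inv_swp[of r s] r s(1) by simp
  have "[r + 1..int (Suc n)] = [r + 1..s - 1] @ s # [s + 1..int (Suc n)]"
    using upto_split3[of "r + 1" s "int (Suc n)"] s(1) s_le by simp
  then have e: "right_hops r (Suc n) = rev [s + 1..int (Suc n)] @ s # rev [r + 1..s - 1]"
    by (simp add: right_hops_def)
  have "\<not> hop r t u" if "s < t" for t
    using that s u_r u_s u_tail[of s t] r by (auto simp: hop_def cov_def min_def max_def intro!: exI[of _ s])
  moreover have "\<not> hop r t u" if "r < t" "t < s" for t
    using that s u_r tail[of t s] u_other[of t] r by (auto simp: hop_def cov_def min_def max_def)
  moreover have "hop r s u"
    using s u_r u_s r tail u_other by (auto simp: hop_def cov_def min_def max_def) (smt (verit))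
  moreover have "\<not> hop r t g" if "r < t" "t < s" for t
    using that s tail[of t s] r by (auto simp: hop_def cov_def min_def max_def)
  moreover have "inv (inv g) = g" by (rule odd_perm_inv_inv[OF odd])
  ultimately show ?thesis
    unfolding e sw[symmetric]
    by (intro Rs_one_hop) (auto simp: iu sw)
qed

text \<open>Both sides of the transition equation contain the value at \<open>inv u\<close>. It
  cancels, and then so does \<open>bR\<close>. The conditions on \<open>t\<close> in assumption 2
  are what \<open>ok\<close> reveals about the entries following \<open>i\<close> in the
  list.\<close>

lemma step_FF:
  assumes i: "i \<in> set (left_hops r (Suc n))"
    and 1: "\<And>t. t \<in> set (left_hops r (Suc n)) \<Longrightarrow> hop r t u \<longleftrightarrow> t = i"
    and 2: "\<And>t. t < r \<Longrightarrow> t \<noteq> 0 \<Longrightarrow> t \<noteq> i \<Longrightarrow> (t \<noteq> - r \<Longrightarrow> i \<noteq> - r \<Longrightarrow> i < t) \<Longrightarrow> (t = - r \<Longrightarrow> i < 0) \<Longrightarrow>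
       (i = - r \<Longrightarrow> 0 < t) \<Longrightarrow> \<not> hop r t (u \<circ> swp r i)"
  shows "FF (Suc n) N (inv g) = FF (Suc n) N (inv (u \<circ> swp r i))"
proof -
  let ?L = "left_hops r (Suc n)"
  have rn: "r \<le> int (Suc n)" using s_le by simp
  obtain xs ys where L: "?L = xs @ i # ys" using split_list[OF i] by blast
  have ck: "chain_ok r (xs @ i # ys)" using chain_ok_left[OF r rn] L by simp
  then have ok: "ok r i (set ys)" using chain_ok_append by fastforce
  have dist: "i \<notin> set xs" "i \<notin> set ys" using chain_ok_distinct[OF ck] by auto
  have iu: "inv (inv u) = u" by (rule odd_perm_inv_inv[OF uodd])
  have inz: "i \<noteq> 0" using ok by (simp add: ok_def)
  have og: "odd_perm (u \<circ> swp r i)" by (intro odd_perm_comp uodd odd_perm_swp) (use r inz in auto)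
  have sw: "swp r i \<circ> inv u = inv (u \<circ> swp r i)"
    using odd_perm_inv_comp[OF uodd odd_perm_swp[of r i]] inv_swp[of r i] r inz by simp
  have ys: "\<not> hop r t (u \<circ> swp r i)" if t: "t \<in> set ys" for t
  proof -
    have tL: "t \<in> set ?L" using t L by simp
    then have tr: "t < r" "t \<noteq> 0" using set_left_hops[OF r rn] by auto
    show ?thesis
    proof (rule 2[OF tr])
      show "t \<noteq> i" using t dist by auto
      show "i < t" if "t \<noteq> - r" "i \<noteq> - r"
        using ok that t tr unfolding ok_def by (auto simp: min_def max_def split: if_splits)
      show "i < 0" if "t = - r" using ok that t r unfolding ok_def by auto
      show "0 < t" if "i = - r" using ok that t tr r unfolding ok_def by (metis less_irrefl)
    qed
  qed
  have "Rs bR r ?L (FF (Suc n) N) (inv u) = FF (Suc n) N (inv u) + bR * FF (Suc n) N (swp r i \<circ> inv u)"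
    unfolding L
  proof (rule Rs_one_hop)
    show "\<forall>t\<in>set xs. \<not> hop r t (inv (inv u))" "\<forall>t\<in>set ys. \<not> hop r t (inv (inv u))" "hop r i (inv (inv u))"
      using 1 L dist unfolding iu by (auto; metis)+
    show "\<forall>t\<in>set ys. \<not> hop r t (inv (swp r i \<circ> inv u))"
      using ys unfolding sw odd_perm_inv_inv[OF og] by blast
  qed
  moreover have "Rs bR r (right_hops r (Suc n)) (FF (Suc n) N) (inv u) = Rs bR r ?L (FF (Suc n) N) (inv u)"
    using transition_FF[OF r s_le(2), of N] signed_perms_inv[OF uS] unfolding transition_def by blast
  ultimately have "bR * FF (Suc n) N (inv g) = bR * FF (Suc n) N (inv (u \<circ> swp r i))"
    unfolding right_eval sw by simp
  then show ?thesis using bR_nonzero by simp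
qed

end

definition (in vex_desc) good_step :: "(int \<Rightarrow> int) \<Rightarrow> bool" where
  "good_step h \<longleftrightarrow> h \<in> signed_perms (Suc n) \<and> vex h \<and> (\<forall>x y. r < x \<longrightarrow> x < y \<longrightarrow> h x < h y) \<and>
     card (lower_after r h) < card (lower_after r g) \<and> (\<forall>N. FF (Suc n) N (inv g) = FF (Suc n) N (inv h))"

section \<open>The hop to a place on the left\<close>

text \<open>By \<open>K\<close>, the place \<open>i\<close> holds the largest entry below
  \<open>a\<close> to the left of \<open>r\<close>; this entry is required to have the sign of
  \<open>a\<close>.\<close>

locale vex_swap = vex_desc +
  fixes i :: int
  assumes i: "i < r" "i \<noteq> - r" "i \<noteq> 0" "- int (Suc n) \<le> i"
    and ba: "u i < a" and sgn: "0 < u i \<longleftrightarrow> 0 < a"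
    and K: "\<And>j. j < r \<Longrightarrow> \<not> (u i < u j \<and> u j < a)"
begin

abbreviation b where "b \<equiv> u i"
definition h where "h = u \<circ> swp r i"

lemma b_nz: "b \<noteq> 0" using odd_perm_eq_0_iff[OF uodd] i by simp

lemma sgn_neg: "b < 0 \<longleftrightarrow> a < 0" using sgn b_nz a_nz by auto

lemma hS: "h \<in> signed_perms (Suc n)"
  unfolding h_def
  by (rule signed_perms_comp[OF signed_perms_mono[OF _ uS] signed_perms_swp]) (use i r s_le in auto)

lemma h_minus: "h (- x) = - h x" by (rule odd_perm_minus[OF signed_perms_odd[OF hS]])

lemma h_r: "h r = b" and h_i: "h i = a" and h_mr: "h (- r) = - b" and h_mi: "h (- i) = - a"
  and h_other: "x \<noteq> r \<Longrightarrow> x \<noteq> i \<Longrightarrow> x \<noteq> - r \<Longrightarrow> x \<noteq> - i \<Longrightarrow> h x = u x"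
  unfolding h_minus using r i u_r by (auto simp: h_def swp_def)

lemma K_up: "j < r \<Longrightarrow> b < u j \<Longrightarrow> a < u j"
  using K[of j] u_inj[of j r] u_r by (metis linorder_neqE order_less_irrefl)

lemma K_down: "j < r \<Longrightarrow> u j < a \<Longrightarrow> j \<noteq> i \<Longrightarrow> u j < b"
  using K[of j] u_inj[of j i] by (metis linorder_neqE)

text \<open>Mirror image of \<open>K\<close>: to the right of \<open>- r\<close> no entry lies
  strictly between \<open>- a\<close> and \<open>- b\<close>.\<close>

lemma K'_up: "- r < j \<Longrightarrow> - a < u j \<Longrightarrow> j \<noteq> - i \<Longrightarrow> - b < u j"
  using K_down[of "- j"] by (auto simp: u_minus)

lemma K'_down: "- r < j \<Longrightarrow> u j < - b \<Longrightarrow> u j < - a"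
  using K_up[of "- j"] by (auto simp: u_minus)

text \<open>Otherwise the place \<open>- i\<close> is positive and carries a negative entry. Before
  \<open>r\<close> this is excluded by \<open>no_neg\<close>, behind \<open>r\<close> by
  \<open>vex\<close> applied to the inversions \<open>(r, - i)\<close> and
  \<open>(r, s)\<close>.\<close>

lemma i_pos: assumes "0 < b" shows "0 < i"
proof (rule ccontr)
  assume "\<not> 0 < i"
  then have i0: "i < 0" using i by simp
  have a: "0 < a" using sgn assms by simp
  have "i \<noteq> - s" using assms u_ms a s(2) by auto
  then have gi: "g i = b" using u_other[of i] i s(1) i0 r by auto
  show False
  proof (cases "- r < i")
    case True
    then have "0 < g (- i)" using no_neg[of "- i"] i0 a by simp
    then show False using gi assms by (simp add: g_minus)
  next
    case False
    then have "r < - i" using i by simp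
    then have "0 < g (- i)"
      using vexD(2)[OF vex, of r "- i" r s] s r gi ba assms a by (auto simp: g_minus)
    then show False using gi assms by (simp add: g_minus)
  qed
qed

lemma hop_i: "hop r i u"
  using i ba K u_r by (auto simp: hop_def cov_def min_def max_def)

lemma hop_left: "t < r \<Longrightarrow> t \<noteq> - r \<Longrightarrow> hop r t v \<longleftrightarrow> cov v t r"
  by (simp add: hop_def min_def max_def)

lemma cov_ms: assumes "cov u (- s) r" shows "a < 0"
proof -
  have "\<not> (u (- s) < u (- r) \<and> u (- r) < u r)" using assms r s(1) unfolding cov_def by auto
  then show ?thesis using u_r u_mr u_ms s(2) a_nz by auto
qed

lemma cov_zero: assumes "cov u t r" "t < 0" shows "\<not> (u t < 0 \<and> 0 < a)"
  using assms r u0 u_r unfolding cov_def by force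

text \<open>Of two hops to the left, the nearer place must have the smaller entry, since otherwise
  it would block the other; this contradicts \<open>two_hops\<close>. The sign change is blocked by
  \<open>i\<close> itself.\<close>

lemma hop_unique: assumes t: "t < r" "t \<noteq> 0" "hop r t u" shows "t = i"
proof (rule ccontr)
  assume ti: "t \<noteq> i"
  have ci: "cov u i r" using hop_i hop_left i by simp
  show False
  proof (cases "t = - r")
    case True
    then have h: "0 < a" "\<And>j. - r < j \<Longrightarrow> j < r \<Longrightarrow> j \<noteq> 0 \<Longrightarrow> \<not> \<bar>u j\<bar> < a"
      using t(3) u_r by (auto simp: hop_def)
    then have "0 < b" using sgn by simp
    then have "0 < i" by (rule i_pos)
    then show False using h(2)[of i] i ba \<open>0 < b\<close> by auto
  next
    case False
    then have ct: "cov u t r" using t hop_left by simp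
    have "\<exists>j1 j2. j1 < j2 \<and> j2 < r \<and> cov u j1 r \<and> cov u j2 r \<and> j1 \<noteq> - r \<and> j2 \<noteq> - r"
      using ci ct ti i False t by (metis linorder_neqE)
    then obtain j1 j2 where j: "j1 < j2" "j2 < r" "cov u j1 r" "cov u j2 r" "j1 \<noteq> - r" "j2 \<noteq> - r" by blast
    have "u j1 < a" "u j2 < a" "\<not> (u j1 < u j2 \<and> u j2 < a)" using j u_r by (auto simp: cov_def)
    moreover have "u j1 \<noteq> u j2" using u_inj j(1) by simp
    ultimately have "u j2 < u j1" by linarith
    then show False
      using two_hops[OF j(1,2,5,6)] \<open>u j1 < a\<close> cov_zero[OF j(3)] cov_ms j(3) by blast
  qed
qed

text \<open>After the hop, a later place \<open>t\<close> would need an entry below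
  \<open>b\<close>; then \<open>i\<close> and \<open>t\<close> are again in the situation of
  \<open>two_hops\<close>.\<close>

lemma no_second_hop:
  assumes t: "t < r" "t \<noteq> 0" "t \<noteq> i" "t \<noteq> - r \<Longrightarrow> i < t" "t = - r \<Longrightarrow> i < 0"
  shows "\<not> hop r t h"
proof
  assume hop: "hop r t h"
  show False
  proof (cases "t = - r")
    case True
    then have "0 < b" using hop h_r by (simp add: hop_def)
    then show False using i_pos t(5)[OF True] by simp
  next
    case False
    then have "h t < b" using hop hop_left t(1) h_r by (simp add: cov_def)
    have it: "i < t" using t(4) False by blast
    show False
    proof (cases "t = - i")
      case True
      then have "i < 0" using it by simp
      then have "\<not> 0 < b" using i_pos by auto
      then show False using \<open>h t < b\<close> h_mi True sgn_neg b_nz by auto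
    next
      case ti: False
      then have "u t < b" using \<open>h t < b\<close> h_other[of t] t False by simp
      moreover have "\<not> (b < 0 \<and> 0 < a)" using sgn_neg by auto
      moreover have "a < 0" if "i = - s" using that u_ms sgn s(2) a_nz by auto
      ultimately show False using two_hops[of i t] it t(1) i(2) False ba by blast
    qed
  qed
qed

lemma h_FF: "FF (Suc n) N (inv g) = FF (Suc n) N (inv h)"
proof -
  have rn: "r \<le> int (Suc n)" using s_le by simp
  have L: "t \<in> set (left_hops r (Suc n)) \<longleftrightarrow> - int (Suc n) \<le> t \<and> t < r \<and> t \<noteq> 0" for t
    unfolding set_left_hops[OF r rn] by auto
  show ?thesis unfolding h_def
  proof (rule step_FF)
    show "i \<in> set (left_hops r (Suc n))" using i L by simp
    show "hop r t u \<longleftrightarrow> t = i" if "t \<in> set (left_hops r (Suc n))" for t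
      using that hop_unique hop_i L by blast
    show "\<not> hop r t (u \<circ> swp r i)" if "t < r" "t \<noteq> 0" "t \<noteq> i" "t \<noteq> - r \<Longrightarrow> i \<noteq> - r \<Longrightarrow> i < t" "t = - r \<Longrightarrow> i < 0" for t
      using no_second_hop[of t] that i(2) unfolding h_def by blast
  qed
qed

lemma h_tail: assumes "r < x" "x < y" shows "h x < h y"
proof -
  have o: "h z = u z" if "r < z" "z \<noteq> - i" for z using h_other[of z] that i r by auto
  consider "x = - i" | "y = - i" | "x \<noteq> - i" "y \<noteq> - i" by blast
  then show ?thesis
  proof cases
    case 1
    then have "- b < u y" using u_tail[OF assms] by (simp add: u_minus)
    then show ?thesis using 1 h_mi o[of y] assms ba by simp
  next
    case 2
    then have "u x < - b" using u_tail[OF assms] by (simp add: u_minus)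
    then show ?thesis using 2 h_mi o[of x] assms K'_down[of x] r by simp
  next
    case 3
    then show ?thesis using o assms u_tail by simp
  qed
qed

lemma h_lower: "card (lower_after r h) < card (lower_after r g)"
proof (rule lower_less[OF hS])
  fix j
  assume j: "r < j" "h j < h r"
  show "g j < c \<and> j \<noteq> s"
  proof (cases "j = - i")
    case True
    then have ab: "- a < b" using j h_mi h_r by simp
    then have pos: "0 < a" "0 < b" using sgn sgn_neg a_nz b_nz by auto
    then show ?thesis using i_pos True j r by simp
  next
    case False
    then have e: "h j = u j" using h_other[of j] j i r by auto
    then have "j \<noteq> s" using j h_r u_s ba s(2) by auto
    then show ?thesis using e u_other[of j] j r h_r ba s by auto
  qed
qed

text \<open>Tailored to \<open>vex\<close>: an inversion of \<open>h\<close> is pulled back to one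
  of \<open>g\<close> that starts no earlier and whose lower entry is no smaller, so positive sums
  stay positive. The implication about signs allows the conclusion to be carried back.\<close>

lemma inversion_h:
  assumes p: "- r < p" "p < q" "h q < h p"
  shows "\<exists>P Q. P < Q \<and> g Q < g P \<and> h q \<le> g Q \<and> (0 < g Q \<longrightarrow> 0 < h q) \<and> (P = p \<or> p = i \<and> P = r)"
proof -
  have via_u: ?thesis if "- r < P" "P < q0" "u q0 < u P" "h q \<le> u q0" "0 < u q0 \<longrightarrow> 0 < h q" "P = p \<or> p = i \<and> P = r" for P q0
    using inversion_u[OF that(1-3)] that(4-6) by metis
  have q: "q \<noteq> - r" "p \<noteq> - r" using p by auto
  consider (qmi) "q = - i" | (pmi) "p = - i" "q \<noteq> - i" | (qr) "q = r" "p \<noteq> - i" | (pr) "p = r" "q \<noteq> - i"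
    | (pi) "p = i" "q \<noteq> r" "q \<noteq> - i" | (qi) "q = i" "p \<noteq> - i"
    | (oth) "q \<noteq> - i" "p \<noteq> - i" "q \<noteq> r" "p \<noteq> r" "p \<noteq> i" "q \<noteq> i" by blast
  then show ?thesis
  proof cases
    case qmi
    then have hp: "- a < h p" "p \<noteq> - i" using p h_mi by auto
    have "- b < u p"
    proof -
      consider "p = r" | "p = i" | "p \<noteq> r" "p \<noteq> i" by blast
      then show ?thesis
      proof cases
        case 1
        then show ?thesis using hp h_r u_r sgn sgn_neg a_nz b_nz by auto
      next
        case 2
        then show ?thesis using hp h_i sgn b_nz by auto
      next
        case 3
        then have "h p = u p" using h_other[of p] q hp by auto
        then show ?thesis using hp K'_up[of p] p by simp
      qed
    qed
    then show ?thesis using via_u[of p q] qmi p h_mi ba sgn_neg a_nz b_nz by (auto simp: u_minus)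
  next
    case pmi
    then have hq: "h q < - a" using p h_mi by auto
    consider "q = r" | "q = i" | "q \<noteq> r" "q \<noteq> i" by blast
    then show ?thesis
    proof cases
      case 1
      then have "b < - a" using hq h_r by simp
      then have "a < 0" "b < 0" using sgn_neg sgn a_nz b_nz by auto
      then show ?thesis using via_u[of p q] pmi p 1 h_r u_r ba by (auto simp: u_minus)
    next
      case 2
      then have "a < 0" using hq h_i by simp
      then show ?thesis using via_u[of p r] pmi p 2 h_i u_r i(1) sgn_neg by (auto simp: u_minus)
    next
      case 3
      then have "h q = u q" using h_other[of q] q pmi by auto
      then show ?thesis using via_u[of p q] pmi p hq ba by (auto simp: u_minus)
    qed
  next
    case qr
    show ?thesis
    proof (cases "p = i")
      case True
      then show ?thesis using qr h_r s ba sgn by (intro exI[of _ r] exI[of _ s]) auto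
    next
      case False
      then have "h p = u p" using h_other[of p] q qr p by auto
      then have "a < u p" using K_up[of p] p qr h_r by simp
      then show ?thesis using via_u[of p r] qr p h_r u_r ba sgn by auto
    qed
  next
    case pr
    then have "h q = u q" using h_other[of q] q p i by auto
    then show ?thesis using via_u[of r q] pr p h_r u_r ba r by auto
  next
    case pi
    then have e: "h q = u q" using h_other[of q] q p by auto
    then have "u q < a" using pi p h_i by simp
    show ?thesis
    proof (cases "q < r")
      case True
      then have "u q < b" using K_down[of q] \<open>u q < a\<close> p pi by simp
      then show ?thesis using via_u[of i q] pi p e by auto
    next
      case False
      then show ?thesis using via_u[of r q] pi p e \<open>u q < a\<close> u_r r by auto
    qed
  next
    case qi
    then have "h p = u p" using h_other[of p] q p i by auto
    then show ?thesis using via_u[of p r] qi p h_i u_r i by auto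
  next
    case oth
    then show ?thesis using via_u[of p q] h_other[of p] h_other[of q] q p by auto
  qed
qed

lemma inversion_le: assumes "p < q" "h q < h p" shows "p \<le> r"
  using h_tail[of p q] assms by force

text \<open>For \<open>0 < a\<close> the inversion \<open>(r, s)\<close> is positive, so every other
  positive inversion must satisfy the exception of \<open>vex\<close> with it.\<close>

lemma pos_inversion_g:
  assumes "0 < a" "0 < p" "p < q" "g q < g p" "0 < g q"
  shows "r < q" "g q < c" "a < g p"
  using vexD(3,4)[OF vex, of r s p q] vexD(3,4)[OF vex, of p q r s] assms r s by auto

text \<open>The positive inversions of \<open>h\<close> all straddle the place \<open>r\<close> and
  the value \<open>a\<close>; hence any two of them satisfy the exception in
  \<open>vex\<close>.\<close>

lemma pos_inversion_h:
  assumes a: "0 < a" and p: "0 < p" "p < q" "h q < h p" "0 < h q"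
  shows "p < r \<and> r \<le> q \<and> a \<le> h p \<and> h q < a"
proof -
  have b: "0 < b" using sgn a by simp
  then have ip: "0 < i" by (rule i_pos)
  have gi: "g i = b" using u_other[of i] i ip r s(1) by auto
  have hg: "h x = g x" if "0 < x" "x \<noteq> r" "x \<noteq> i" "x \<noteq> s" for x
    using h_other[of x] u_other[of x] that r s(1) ip by auto
  have hs: "h s = c" using h_other[of s] u_s s(1) i r ip by auto
  note pg = pos_inversion_g[OF a]
  have pr: "p \<le> r" using inversion_le p by blast
  have 1: "p < r"
  proof (rule ccontr)
    assume "\<not> p < r"
    then have e: "p = r" using pr by simp
    then have "h q < b" using p h_r by simp
    moreover have "q \<noteq> s" using calculation hs ba s(2) by auto
    moreover have "h q = g q" using hg[of q] calculation p e r i by auto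
    ultimately have "a < g i" using pg(3)[of i q] ip p e i gi by auto
    then show False using gi ba by simp
  qed
  have 2: "r \<le> q"
  proof (rule ccontr)
    assume "\<not> r \<le> q"
    then have q: "q < r" by simp
    consider "p = i" | "q = i" | "p \<noteq> i" "q \<noteq> i" by blast
    then show False
    proof cases
      case 1
      have "h q = g q" "u q = g q" using hg[of q] u_other[of q] p q 1 s(1) r by auto
      moreover have "u q < b" using K_down[of q] q p 1 h_i calculation by auto
      ultimately show False using pg(1)[of i q] p 1 gi q by auto
    next
      case 2
      have "h p = g p" using hg[of p] p q 2 s(1) by auto
      then show False using pg(1)[of p i] p 2 gi h_i ba b q by auto
    next
      case 3
      then show False using hg[of p] hg[of q] p q s(1) pg(1)[of p q] by auto
    qed
  qed
  have ps: "p \<noteq> s" "q \<noteq> i" using 1 2 s(1) i by auto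
  have 3: "a \<le> h p"
  proof (rule ccontr)
    assume n: "\<not> a \<le> h p"
    then have pi: "p \<noteq> i" using h_i by auto
    have hp: "h p = g p" "u p = g p" using hg[of p] u_other[of p] p 1 pi ps r s(1) by auto
    then have "g p < b" using K_down[of p] 1 n pi by simp
    then have "q \<noteq> r" "q \<noteq> s" using p h_r hs hp ba s(2) by auto
    then show False using pg(3)[of p q] hg[of q] hp p ps n by auto
  qed
  have 4: "h q < a"
  proof (cases "q = r")
    case True
    then show ?thesis using h_r ba by simp
  next
    case False
    show ?thesis
    proof (cases "q = s")
      case True
      then have "c < h p" using p hs by simp
      then have "p \<noteq> i" using h_i s(2) by auto
      then have "g p = h p" using hg[of p] p 1 ps by auto
      then show ?thesis using pg(1)[of p r] \<open>c < h p\<close> p 1 a s(2) by auto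
    next
      case qs: False
      then have hq: "h q = g q" using hg[of q] p False ps by auto
      show ?thesis
      proof (cases "p = i")
        case True
        then show ?thesis using p h_i by simp
      next
        case pi: False
        then have "h p = g p" using hg[of p] p 1 ps by auto
        then have "g q < c" using pg(2)[of p q] p hq by auto
        then have "g q \<le> a" using tail_lower[of q] 2 False by auto
        then show ?thesis using hq qs g_inj[of q s] by auto
      qed
    qed
  qed
  show ?thesis using 1 2 3 4 by blast
qed

lemma h_vex: "vex h"
  unfolding vex_def
proof (intro allI impI, elim conjE)
  fix p q p' q'
  assume A: "p < q" "h q < h p" "p' < q'" "h q' < h p'" "0 < p + p'" "0 < h q + h q'"
  have le: "p \<le> r" "p' \<le> r" using inversion_le A by blast+
  then have gt: "- r < p" "- r < p'" using A(5) by auto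
  obtain P Q where PQ: "P < Q" "g Q < g P" "h q \<le> g Q" "0 < g Q \<longrightarrow> 0 < h q" "P = p \<or> p = i \<and> P = r"
    using inversion_h[OF gt(1) A(1,2)] by blast
  obtain P' Q' where PQ': "P' < Q'" "g Q' < g P'" "h q' \<le> g Q'" "0 < g Q' \<longrightarrow> 0 < h q'" "P' = p' \<or> p' = i \<and> P' = r"
    using inversion_h[OF gt(2) A(3,4)] by blast
  have ge: "p \<le> P" "p' \<le> P'" using PQ(5) PQ'(5) i by auto
  \<comment> \<open>The sums stay positive in \<open>g\<close>, so \<open>vex\<close> makes both
    left ends and both lower entries positive there.\<close>
  have pos: "0 < P" "0 < g Q" "0 < P'" "0 < g Q'"
    using vexD(1,2)[OF vex PQ(1,2) PQ'(1,2)] vexD(1,2)[OF vex PQ'(1,2) PQ(1,2)] A(5,6) ge PQ(3) PQ'(3) by auto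
  have posP: "0 < p0" if "P0 = p0 \<or> p0 = i \<and> P0 = r" "0 < P0" "0 < h q0" "h q0 < h p0" for p0 P0 q0
    using that i_pos sgn h_i by auto
  have p0: "0 < p" "0 < h q" "0 < p'" "0 < h q'"
    using posP[OF PQ(5) pos(1)] posP[OF PQ'(5) pos(3)] PQ(4) PQ'(4) pos A(2,4) by auto
  have "p < q' \<and> h q' < h p"
  proof (cases "0 < a")
    case True
    show ?thesis using pos_inversion_h[OF True p0(1) A(1,2) p0(2)] pos_inversion_h[OF True p0(3) A(3,4) p0(4)] by auto
  next
    case False
    \<comment> \<open>Here \<open>h\<close> is negative at \<open>r\<close> and \<open>i\<close>, so
      positive inversions avoid both places. They are inversions of \<open>u\<close> already and
      transfer to \<open>g\<close>.\<close>
    then have neg: "a < 0" "b < 0" using sgn_neg a_nz by auto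
    have nsp: "x \<noteq> r" "x \<noteq> i" if "0 < h x" for x using that h_r h_i neg by auto
    have hpos: "0 < h p" "0 < h p'" using A p0 by auto
    have sp: "p \<noteq> r" "p \<noteq> i" "q \<noteq> r" "q \<noteq> i" "p' \<noteq> r" "p' \<noteq> i" "q' \<noteq> r" "q' \<noteq> i"
      using nsp p0 hpos by auto
    have hu: "h x = u x" if "0 < x" "x \<noteq> r" "x \<noteq> i" "x \<noteq> - i" for x
      using h_other[of x] that r by auto
    have to_u: "u y < u x" if "0 < x" "x < y" "h y < h x" "x \<noteq> r" "x \<noteq> i" "y \<noteq> r" "y \<noteq> i" for x y
    proof -
      consider "x = - i" | "y = - i" | "x \<noteq> - i" "y \<noteq> - i" by blast
      then show ?thesis
      proof cases
        case 1
        then show ?thesis using hu[of y] that h_mi ba by (auto simp: u_minus)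
      next
        case 2
        then show ?thesis using hu[of x] that h_mi K'_up[of x] r by (auto simp: u_minus)
      next
        case 3
        then show ?thesis using hu[of x] hu[of y] that by auto
      qed
    qed
    note up = to_u[OF p0(1) A(1,2) sp(1-4)] and up' = to_u[OF p0(3) A(3,4) sp(5-8)]
    obtain R where R: "p < R" "g R < g p" "g R = u q"
      using inversion_u[OF gt(1) A(1) up] by blast
    obtain R' where R': "p' < R'" "g R' < g p'" "g R' = u q'" "R' = q' \<or> q' = s \<and> R' = r"
      using inversion_u[OF gt(2) A(3) up'] sp by blast
    have uq: "0 < u x" if "0 < x" "0 < h x" for x
    proof (cases "x = - i")
      case True
      then show ?thesis using neg by (simp add: u_minus)
    next
      case False
      then show ?thesis using hu[of x] nsp[OF that(2)] that by simp
    qed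
    have "0 < g R + g R'" using uq[of q] uq[of q'] p0 A R(3) R'(3) by auto
    then have V: "p < R'" "u q' < g p"
      using vexD(3,4)[OF vex R(1,2) R'(1,2)] A(5) R'(3) by auto
    have ps: "p \<noteq> s" using u_tail[of p q] A up s(1) by auto
    have "g p = u p" using u_other[of p] sp(1) ps p0(1) r s(1) by auto
    then have uu: "u q' < u p" using V by simp
    have "h q' < h p"
    proof -
      consider "p = - i" "q' \<noteq> - i" | "q' = - i" "p \<noteq> - i" | "p \<noteq> - i" "q' \<noteq> - i" using uu by blast
      then show ?thesis
      proof cases
        case 1
        then show ?thesis using hu[of q'] uu K'_down[of q'] h_mi p0 A(3) sp r by (auto simp: u_minus)
      next
        case 2
        then show ?thesis using hu[of p] uu h_mi p0 sp ba by (auto simp: u_minus)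
      next
        case 3
        then show ?thesis using hu[of p] hu[of q'] uu p0 A(3) sp by auto
      qed
    qed
    then show ?thesis using V(1) R'(4) s(1) by auto
  qed
  then show "0 < p \<and> 0 < h q \<and> p < q' \<and> h q' < h p" using p0 by blast
qed

lemma good: "good_step h"
  unfolding good_step_def using hS h_vex h_tail h_lower h_FF by blast

end

section \<open>The sign change\<close>

text \<open>Without an entry between 0 and \<open>a\<close> to the left of \<open>r\<close>, no
  ordinary hop is possible: a negative entry is shielded by position 0 or by an obstacle that
  \<open>vex\<close> excludes. The sign change at \<open>r\<close> takes its place.\<close>

lemma (in vex_desc) sign_step:
  assumes a: "0 < a" and K: "\<And>j. j < r \<Longrightarrow> \<not> (0 < u j \<and> u j < a)"
  shows "\<exists>h. good_step h"
proof -
  define h where "h = u \<circ> swp r (- r)"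
  have hS: "h \<in> signed_perms (Suc n)"
    unfolding h_def
    by (rule signed_perms_comp[OF signed_perms_mono[OF _ uS] signed_perms_swp]) (use r s_le in auto)
  have h_r: "h r = - a" and h_other: "\<And>x. x \<noteq> r \<Longrightarrow> x \<noteq> - r \<Longrightarrow> h x = u x"
    using u_mr by (auto simp: h_def swp_def)
  have mid: "u l = g l \<and> a < u l" if "0 < l" "l < r" for l
  proof -
    have "u l = g l" using u_other[of l] that s(1) by auto
    moreover have "u l \<noteq> a" using u_inj[of l r] u_r that by auto
    ultimately show ?thesis using no_neg[OF that a] K[of l] that by auto
  qed
  have hop1: "hop r t u \<longleftrightarrow> t = - r" if t: "t < r" "t \<noteq> 0" for t
  proof
    assume h: "hop r t u"
    show "t = - r"
    proof (rule ccontr)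
      assume "t \<noteq> - r"
      then have c: "cov u t r" using h t by (simp add: hop_def min_def max_def)
      then have ut: "u t < a" using u_r by (simp add: cov_def)
      show False
      proof (cases "0 < t")
        case True
        then show False using mid[of t] t ut by simp
      next
        case False
        then have "t < 0" using t by simp
        then have "\<not> u t < 0" using c r u0 u_r a unfolding cov_def by force
        moreover have "u t \<noteq> 0" using u_inj[of t 0] u0 t by simp
        ultimately show False using K[of t] t ut by simp
      qed
    qed
  next
    assume "t = - r"
    moreover have "\<not> \<bar>u j\<bar> < a" if j: "- r < j" "j < r" "j \<noteq> 0" for j
      using mid[of j] mid[of "- j"] j a by (cases "0 < j") (auto simp: u_minus)
    ultimately show "hop r t u" using a u_r by (simp add: hop_def)
  qed
  have FF: "FF (Suc n) N (inv g) = FF (Suc n) N (inv h)" for N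
    unfolding h_def
  proof (rule step_FF)
    have rn: "r \<le> int (Suc n)" using s_le by simp
    have L: "t \<in> set (left_hops r (Suc n)) \<longleftrightarrow> - int (Suc n) \<le> t \<and> t < r \<and> t \<noteq> 0" for t
      unfolding set_left_hops[OF r rn] by auto
    show "- r \<in> set (left_hops r (Suc n))" using L rn r by simp
    show "hop r t u \<longleftrightarrow> t = - r" if "t \<in> set (left_hops r (Suc n))" for t using that hop1 L by blast
    show "\<not> hop r t (u \<circ> swp r (- r))" if t: "t < r" "t \<noteq> 0" "- r = - r \<Longrightarrow> 0 < t" for t
    proof -
      have "0 < t" using t(3) by simp
      then have "h r < h t" using h_r h_other[of t] mid[of t] t a by simp
      then show ?thesis using t \<open>0 < t\<close> unfolding h_def by (auto simp: hop_def cov_def min_def max_def)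
    qed
  qed
  have tail': "h x < h y" if "r < x" "x < y" for x y
    using h_other[of x] h_other[of y] that r u_tail by auto
  have low: "card (lower_after r h) < card (lower_after r g)"
  proof (rule lower_less[OF hS])
    fix j
    assume j: "r < j" "h j < h r"
    then have e: "h j = u j" "u j < - a" using h_other[of j] h_r r by auto
    then have "j \<noteq> s" using u_s a s(2) by auto
    then show "g j < c \<and> j \<noteq> s" using e u_other[of j] j r s a by auto
  qed
  have map: "\<exists>Q. p < Q \<and> g Q < g p \<and> g Q = h q \<and> (Q = q \<or> q = s \<and> Q = r)"
    if "- r < p" "p < q" "h q < h p" "q \<noteq> r" for p q
  proof -
    have "h q = u q" using h_other[of q] that by auto
    moreover have "u q < u p" using calculation that h_r u_r a h_other[of p] by (cases "p = r") auto
    ultimately show ?thesis using inversion_u[of p q] that by metis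
  qed
  have vex_h: "vex h"
    unfolding vex_def
  proof (intro allI impI, elim conjE)
    fix p q p' q'
    assume A: "p < q" "h q < h p" "p' < q'" "h q' < h p'" "0 < p + p'" "0 < h q + h q'"
    have le: "p \<le> r" "p' \<le> r" using tail'[of p q] tail'[of p' q'] A by force+
    \<comment> \<open>Inversions ending at \<open>r\<close> are the ones that \<open>map\<close>
      does not pull back to \<open>g\<close>; none of them can occur in a pair satisfying the two
      sum conditions.\<close>
    have exc: False if B: "x < r" "- r < x" "h r < h x" "- r < y" "y < z" "h z < h y" "0 < x + y" "0 < h r + h z" for x y z
    proof -
      have z: "z \<noteq> r" using B h_r a by auto
      obtain Q where Q: "y < Q" "g Q < g y" "g Q = h z" using map[OF B(4-6) z] by blast
      have gQ: "a < g Q" using Q B h_r by simp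
      show False
      proof (cases "0 < y")
        case True
        have "r < Q \<and> g Q < c"
          using vexD(3,4)[OF vex, of r s y Q] Q gQ s r a True by auto
        then show False using tail_lower[of Q] gQ by auto
      next
        case False
        then have "0 < x" using B by simp
        then have "a < g x" using mid[of x] B by simp
        then show False using vexD(1)[OF vex Q(1,2), of x s] gQ B s a False by auto
      qed
    qed
    have q: "q \<noteq> r" using exc[of p p' q'] A le by auto
    have q': "q' \<noteq> r" using exc[of p' p q] A le by (auto simp: add.commute)
    obtain Q where Q: "p < Q" "g Q < g p" "g Q = h q" using map[of p q] A le q by auto
    obtain Q' where Q': "p' < Q'" "g Q' < g p'" "g Q' = h q'" "Q' = q' \<or> q' = s \<and> Q' = r"
      using map[of p' q'] A le q' by auto
    have V: "0 < p" "0 < h q" "p < Q'" "h q' < g p"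
      using vexD[OF vex Q(1,2) Q'(1,2)] A Q(3) Q'(3) by auto
    have "p \<noteq> r" using A(2) V h_r a by auto
    moreover have "p \<noteq> s" using le s(1) by auto
    ultimately have "h p = g p" using h_other[of p] u_other[of p] V r s(1) by auto
    then show "0 < p \<and> 0 < h q \<and> p < q' \<and> h q' < h p" using V Q'(4) s(1) by auto
  qed
  show ?thesis unfolding good_step_def using hS vex_h tail' low FF by blast
qed

lemma (in vex_desc) exists_good_step: "\<exists>h. good_step h"
proof -
  \<comment> \<open>Candidates for \<open>i\<close>. The extra place \<open>- int (Suc n)\<close> is
    fixed by \<open>u\<close> and has an entry below \<open>a\<close>, so for negative
    \<open>a\<close> there is always a candidate. This is why the rank grows by one.\<close>
  define X where "X = {t. - int (Suc n) \<le> t \<and> t < r \<and> u t < a \<and> (a < 0 \<or> 0 < u t)}"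
  have finX: "finite X" by (rule finite_subset[of _ "{- int (Suc n)..<r}"]) (auto simp: X_def)
  have out: "u j = j" if "j < - int n" for j using uS that by (auto simp: signed_perms_iff)
  have al: "- int n \<le> a" using signed_perms_abs_le[OF gS, of s] s_le r s(1) by simp
  show ?thesis
  proof (cases "X = {}")
    case True
    have "- int (Suc n) \<in> X" if "a < 0" using that out[of "- int (Suc n)"] al r by (simp add: X_def)
    then have a: "0 < a" using True a_nz by (metis empty_iff linorder_neqE)
    have "\<not> (0 < u j \<and> u j < a)" if "j < r" for j
    proof (cases "- int (Suc n) \<le> j")
      case c: True
      then show ?thesis using True that unfolding X_def by blast
    next
      case False
      then show ?thesis using out[of j] by simp
    qed
    then show ?thesis by (rule sign_step[OF a])
  next
    case False
    have "Max (u ` X) \<in> u ` X" by (rule Max_in) (use finX False in auto)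
    then obtain i where iX: "i \<in> X" "u i = Max (u ` X)" by auto
    then have i: "i \<in> X" "\<And>t. t \<in> X \<Longrightarrow> u t \<le> u i" using finX by simp_all
    have i': "- int (Suc n) \<le> i" "i < r" "u i < a" "a < 0 \<or> 0 < u i" using i(1) by (auto simp: X_def)
    have "vex_swap g n r s i"
    proof unfold_locales
      show "i < r" "- int (Suc n) \<le> i" "u i < a" by fact+
      show "i \<noteq> - r" using i' u_mr by auto
      show "i \<noteq> 0" using i' u0 by auto
      show "0 < u i \<longleftrightarrow> 0 < a" using i' by auto
      show "\<not> (u i < u j \<and> u j < a)" if "j < r" for j
      proof
        assume h: "u i < u j \<and> u j < a"
        show False
        proof (cases "- int (Suc n) \<le> j")
          case True
          then have "j \<in> X" using h i' that by (auto simp: X_def)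
          then show False using i(2)[of j] h by simp
        next
          case False
          then have uj: "u j = j" using out[of j] by simp
          show False
          proof (cases "a < 0")
            case True
            then have "- int (Suc n) \<in> X" using out[of "- int (Suc n)"] al r by (simp add: X_def)
            then have "- int (Suc n) \<le> u i" using i(2) out[of "- int (Suc n)"] by force
            then show False using h uj False by simp
          next
            case c: False
            then show False using i' h uj False by simp
          qed
        qed
      qed
    qed
    then interpret vex_swap g n r s i .
    show ?thesis using good by blast
  qed
qed

section \<open>Iteration of the step\<close>

lemma vex_step:
  assumes "g \<in> signed_perms n" "vex g" "0 < r" "\<And>x y. r < x \<Longrightarrow> x < y \<Longrightarrow> g x < g y" "lower_after r g \<noteq> {}"
  shows "\<exists>h. h \<in> signed_perms (Suc n) \<and> vex h \<and> (\<forall>x y. r < x \<longrightarrow> x < y \<longrightarrow> h x < h y) \<and>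
    card (lower_after r h) < card (lower_after r g) \<and> (\<forall>N. FF (Suc n) N (inv g) = FF (Suc n) N (inv h))"
proof -
  have "lower_after r g \<subseteq> {r<..max (int n) (g r)}"
  proof
    fix j
    assume "j \<in> lower_after r g"
    then have j: "r < j" "g j < g r" by (auto simp: lower_after_def)
    show "j \<in> {r<..max (int n) (g r)}"
    proof (cases "j \<le> int n")
      case False
      then have "g j = j" using assms(1,3) j by (simp add: signed_perms_iff)
      then show ?thesis using j by simp
    qed (use j in simp)
  qed
  then have fin: "finite (lower_after r g)" by (rule finite_subset) simp
  define s where "s = Max (lower_after r g)"
  have s: "s \<in> lower_after r g" unfolding s_def by (rule Max_in[OF fin assms(5)])
  have "g r < g j" if "s < j" for j
  proof -
    have "j \<notin> lower_after r g" using that fin unfolding s_def by (metis Max_ge not_le)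
    moreover have "r < j" using that s by (simp add: lower_after_def)
    moreover have "g j \<noteq> g r" using odd_perm_eq_iff[OF signed_perms_odd[OF assms(1)]] calculation by simp
    ultimately show ?thesis by (auto simp: lower_after_def)
  qed
  then interpret vex_desc g n r s
    by unfold_locales (use assms s in \<open>auto simp: lower_after_def\<close>)
  show ?thesis using exists_good_step unfolding good_step_def by blast
qed

text \<open>Outer induction on the bound \<open>r\<close> for the last descent, inner induction on
  the number of smaller entries behind it. The equations obtained at different ranks are brought to
  the last rank by \<open>FF_stable\<close>.\<close>

lemma vex_reduce:
  "g \<in> signed_perms n \<Longrightarrow> vex g \<Longrightarrow> (\<And>x y. int r < x \<Longrightarrow> x < y \<Longrightarrow> g x < g y) \<Longrightarrow>
    \<exists>m h. n \<le> m \<and> h \<in> signed_perms m \<and> (\<forall>x y. 0 < x \<longrightarrow> x < y \<longrightarrow> h x < h y) \<and>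
      (\<forall>N. FF m N (inv g) = FF m N (inv h))"
proof (induction r arbitrary: g n)
  case 0
  then show ?case by (intro exI[of _ n] exI[of _ g]) auto
next
  case (Suc r)
  note outer = Suc.IH
  show ?case using Suc.prems
  proof (induction "card (lower_after (int (Suc r)) g)" arbitrary: g n rule: less_induct)
    case less
    let ?r = "int (Suc r)"
    note o = signed_perms_odd[OF less.prems(1)]
    show ?case
    proof (cases "lower_after ?r g = {}")
      case True
      have "g x < g y" if xy: "int r < x" "x < y" for x y
      proof (cases "x = ?r")
        case e: True
        then have "\<not> g y < g x" using True xy by (auto simp: lower_after_def)
        moreover have "g y \<noteq> g x" using odd_perm_eq_iff[OF o] xy by simp
        ultimately show ?thesis by simp
      next
        case False
        then show ?thesis using less.prems(3)[of x y] xy by simp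
      qed
      then show ?thesis by (rule outer[OF less.prems(1,2)])
    next
      case False
      obtain h where h: "h \<in> signed_perms (Suc n)" "vex h" "\<forall>x y. ?r < x \<longrightarrow> x < y \<longrightarrow> h x < h y"
        "card (lower_after ?r h) < card (lower_after ?r g)" "\<And>N. FF (Suc n) N (inv g) = FF (Suc n) N (inv h)"
        using vex_step[OF less.prems(1,2) _ less.prems(3) False] by auto
      obtain m h' where m: "Suc n \<le> m" "h' \<in> signed_perms m" "\<forall>x y. 0 < x \<longrightarrow> x < y \<longrightarrow> h' x < h' y"
        "\<And>N. FF m N (inv h) = FF m N (inv h')"
        using less.hyps[OF h(4,1,2)] h(3) by blast
      have "inv g \<in> signed_perms (Suc n)" "inv h \<in> signed_perms (Suc n)"
        using signed_perms_inv signed_perms_mono[of n "Suc n"] less.prems(1) h(1) by auto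
      then have "FF m N (inv g) = FF m N (inv h')" for N
        using FF_stable[OF m(1)] h(5)[of N] m(4)[of N] by simp
      then show ?thesis using m by (intro exI[of _ m] exI[of _ h']) auto
    qed
  qed
qed

section \<open>The patterns\<close>

lemma subseq_one_line:
  assumes "sorted_wrt (<) ps" "\<forall>p\<in>set ps. 0 < p \<and> p \<le> int n"
  shows "subseq (map w ps) (one_line n w)"
proof -
  let ?I = "map int [1..<Suc n]"
  have "filter (\<lambda>x. x \<in> set ps) ?I = ps"
  proof (rule sorted_distinct_set_unique)
    show "sorted (filter (\<lambda>x. x \<in> set ps) ?I)"
      by (rule sorted_wrt_filter) (simp add: sorted_map del: upt_Suc)
    show "sorted ps" "distinct ps" using assms(1) strict_sorted_iff by blast+
    show "set (filter (\<lambda>x. x \<in> set ps) ?I) = set ps"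
    proof -
      have "x \<in> int ` {1..<Suc n}" if "x \<in> set ps" for x
        using that assms(2) by (intro image_eqI[of _ _ "nat x"]) auto
      then show ?thesis by (auto simp del: upt_Suc)
    qed
  qed (auto simp: distinct_map del: upt_Suc)
  then have "subseq ps ?I" by (metis subseq_filter_left)
  then have "subseq (map w ps) (map w ?I)" by (rule subseq_map)
  then show ?thesis by (simp add: one_line_def comp_def del: upt_Suc)
qed

lemma no_pattern3:
  assumes "vexillary n w" "[v1, v2, v3] \<in> vexillary_patterns" "0 < p" "p < q" "q < t" "t \<le> int n"
    "sgn (w p) = sgn v1" "sgn (w q) = sgn v2" "sgn (w t) = sgn v3"
    "\<bar>w p\<bar> < \<bar>w q\<bar> \<longleftrightarrow> \<bar>v1\<bar> < \<bar>v2\<bar>" "\<bar>w q\<bar> < \<bar>w p\<bar> \<longleftrightarrow> \<bar>v2\<bar> < \<bar>v1\<bar>"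
    "\<bar>w p\<bar> < \<bar>w t\<bar> \<longleftrightarrow> \<bar>v1\<bar> < \<bar>v3\<bar>" "\<bar>w t\<bar> < \<bar>w p\<bar> \<longleftrightarrow> \<bar>v3\<bar> < \<bar>v1\<bar>"
    "\<bar>w q\<bar> < \<bar>w t\<bar> \<longleftrightarrow> \<bar>v2\<bar> < \<bar>v3\<bar>" "\<bar>w t\<bar> < \<bar>w q\<bar> \<longleftrightarrow> \<bar>v3\<bar> < \<bar>v2\<bar>"
  shows False
proof -
  have "subseq (map w [p, q, t]) (one_line n w)"
    by (rule subseq_one_line) (use assms in auto)
  then have "contains_pattern (one_line n w) [v1, v2, v3]"
    unfolding contains_pattern_def using assms(7-)
    by (intro exI[of _ "map w [p, q, t]"]) (auto simp: less_Suc_eq)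
  then show False using assms(1,2) unfolding vexillary_def by blast
qed

lemma no_pattern4:
  assumes "vexillary n w" "[v1, v2, v3, v4] \<in> vexillary_patterns" "0 < p" "p < q" "q < t" "t < l" "l \<le> int n"
    "sgn (w p) = sgn v1" "sgn (w q) = sgn v2" "sgn (w t) = sgn v3" "sgn (w l) = sgn v4"
    "\<bar>w p\<bar> < \<bar>w q\<bar> \<longleftrightarrow> \<bar>v1\<bar> < \<bar>v2\<bar>" "\<bar>w q\<bar> < \<bar>w p\<bar> \<longleftrightarrow> \<bar>v2\<bar> < \<bar>v1\<bar>"
    "\<bar>w p\<bar> < \<bar>w t\<bar> \<longleftrightarrow> \<bar>v1\<bar> < \<bar>v3\<bar>" "\<bar>w t\<bar> < \<bar>w p\<bar> \<longleftrightarrow> \<bar>v3\<bar> < \<bar>v1\<bar>"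
    "\<bar>w q\<bar> < \<bar>w t\<bar> \<longleftrightarrow> \<bar>v2\<bar> < \<bar>v3\<bar>" "\<bar>w t\<bar> < \<bar>w q\<bar> \<longleftrightarrow> \<bar>v3\<bar> < \<bar>v2\<bar>"
    "\<bar>w p\<bar> < \<bar>w l\<bar> \<longleftrightarrow> \<bar>v1\<bar> < \<bar>v4\<bar>" "\<bar>w l\<bar> < \<bar>w p\<bar> \<longleftrightarrow> \<bar>v4\<bar> < \<bar>v1\<bar>"
    "\<bar>w q\<bar> < \<bar>w l\<bar> \<longleftrightarrow> \<bar>v2\<bar> < \<bar>v4\<bar>" "\<bar>w l\<bar> < \<bar>w q\<bar> \<longleftrightarrow> \<bar>v4\<bar> < \<bar>v2\<bar>"
    "\<bar>w t\<bar> < \<bar>w l\<bar> \<longleftrightarrow> \<bar>v3\<bar> < \<bar>v4\<bar>" "\<bar>w l\<bar> < \<bar>w t\<bar> \<longleftrightarrow> \<bar>v4\<bar> < \<bar>v3\<bar>"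
  shows False
proof -
  have "subseq (map w [p, q, t, l]) (one_line n w)"
    by (rule subseq_one_line) (use assms in auto)
  then have "contains_pattern (one_line n w) [v1, v2, v3, v4]"
    unfolding contains_pattern_def using assms(8-)
    by (intro exI[of _ "map w [p, q, t, l]"]) (auto simp: less_Suc_eq)
  then show False using assms(1,2) unfolding vexillary_def by blast
qed


text \<open>Two inversions violating \<open>vex\<close> are folded onto the positive places by
  oddness; three or four of these places then carry one of the patterns.\<close>

lemma vexillary_imp_vex:
  assumes wS: "w \<in> signed_perms n" and v: "vexillary n w"
  shows "vex w"
proof -
  note o = signed_perms_odd[OF wS]
  note P3 = no_pattern3[OF v] and P4 = no_pattern4[OF v]
  note pats = vexillary_patterns_def
  have ne: "w x \<noteq> w y" "w x \<noteq> - w y" if "0 < x" "x < y" for x y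
    using odd_perm_eq_iff[OF o, of x y] odd_perm_eq_minus_iff[OF o, of x y] that by auto
  have nz: "w x \<noteq> 0" if "x \<noteq> 0" for x using odd_perm_eq_0_iff[OF o] that by simp
  have wm: "w (- x) = - w x" for x by (rule odd_perm_minus[OF o])
  have bound: "- int n \<le> p \<and> q \<le> int n" if "p < q" "w q < w p" for p q
  proof -
    have up: "w x \<le> max (int n) x" for x
    proof (cases "\<bar>x\<bar> \<le> int n")
      case True
      then show ?thesis using signed_perms_abs_le[OF wS True] by simp
    next
      case False
      then show ?thesis using wS by (simp add: signed_perms_iff)
    qed
    have big: "w x = x" if "int n < \<bar>x\<bar>" for x using wS that by (simp add: signed_perms_iff)
    have "q \<le> int n"
    proof (rule ccontr)
      assume "\<not> q \<le> int n"
      then show False using big[of q] up[of p] that by auto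
    qed
    moreover have "- int n \<le> p"
    proof (rule ccontr)
      assume "\<not> - int n \<le> p"
      then show False using big[of p] up[of "- q"] that wm[of q] by auto
    qed
    ultimately show ?thesis by blast
  qed
  \<comment> \<open>The facts \<open>N1\<close> to \<open>N5\<close> bundle the patterns of length
    three according to the places of their negative entries.\<close>
  have N1: False if "0 < x" "x < y" "y < z" "z \<le> int n" "w x < 0" "w z < w y" "0 < w z" for x y z
  proof -
    have "w x \<noteq> - w y" "w x \<noteq> - w z" using ne(2)[of x y] ne(2)[of x z] that by auto
    then consider "- w x < w z" | "w z < - w x" "- w x < w y" | "w y < - w x" by linarith
    then show False
    proof cases
      case 1
      then show False using P3[of "-1" 3 2 x y z] that by (auto simp: pats)
    next
      case 2
      then show False using P3[of "-2" 3 1 x y z] that by (auto simp: pats)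
    next
      case 3
      then show False using P3[of "-3" 2 1 x y z] that by (auto simp: pats)
    qed
  qed
  have N2: False if "0 < x" "x < y" "y < z" "z \<le> int n" "w y < 0" "w z < w x" "- w y < w z" for x y z
    using P3[of 3 "-1" 2 x y z] that by (auto simp: pats)
  have N3: False if "0 < x" "x < y" "y < z" "z \<le> int n" "w z < 0" "w y < w x" "- w z < w y" for x y z
    using P3[of 3 2 "-1" x y z] that by (auto simp: pats)
  have N4: False if "0 < x" "x < y" "y < z" "z \<le> int n" "w z < 0" "- w z < w y" "w x < - w y" for x y z
    using P3[of "-3" 2 "-1" x y z] that by (auto simp: pats)
  have N5: False if "0 < x" "x < y" "y < z" "z \<le> int n" "0 < w z" "w z < w y" "w y < w x" for x y z
    using P3[of 3 2 1 x y z] that by (auto simp: pats)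
  \<comment> \<open>The negative entry can stand before, inside or behind the inversion; each
    position is a pattern of length three.\<close>
  have neg_low: False
    if "0 < q" "0 < p'" "p' < q'" "q' \<le> int n" "q \<le> int n" "w q < 0" "w q' < w p'" "- w q < w q'" for q p' q'
  proof -
    have "q \<noteq> p'" "q \<noteq> q'" using that by auto
    then consider "q < p'" | "p' < q" "q < q'" | "q' < q" by linarith
    then show False
    proof cases
      case 1
      then show False using N1[of q p' q'] that by auto
    next
      case 2
      then show False using N2[of p' q q'] that by auto
    next
      case 3
      then show False using N3[of p' q' q] that by auto
    qed
  qed
  have pos: "0 < p"
    if A: "p < q" "w q < w p" "p' < q'" "w q' < w p'" "0 < p + p'" "0 < w q + w q'" for p q p' q'
  proof (rule ccontr)
    assume "\<not> 0 < p"
    \<comment> \<open>The place \<open>p\<close> is folded to \<open>m\<close>, which precedes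
      \<open>p'\<close> because the sum of the left ends is positive.\<close>
    define m where "m = - p"
    have m: "0 \<le> m" "m < p'" using \<open>\<not> 0 < p\<close> A by (auto simp: m_def)
    have bd: "q' \<le> int n" "q \<le> int n" "- int n \<le> p" using bound[of p q] bound[of p' q'] A by auto
    have wp: "w p = - w m" using wm[of m] by (simp add: m_def)
    have Aq: "w m < - w q" "- w q < w q'" using A wp by auto
    show False
    proof (cases "m = 0")
      case True
      then have "w q < 0" using Aq odd_perm_0[OF o] by simp
      moreover have "0 < q" using A True by (simp add: m_def)
      ultimately show False using neg_low[of q p' q'] m A bd Aq True by auto
    next
      case False
      then have m0: "0 < m" using m by simp
      have "\<not> (w m < 0 \<and> 0 < w q')" using N1[of m p' q'] m0 m A bd by auto
      then consider (a) "0 < w m" | (b) "w q' < 0" using nz[of m] nz[of q'] m0 m A by force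
      then show False
      proof cases
        case a
        then have wq: "w q < 0" using Aq by simp
        show False
        proof (cases "0 < q")
          case True
          then show False using neg_low[of q p' q'] m m0 A bd Aq wq by auto
        next
          case F: False
          moreover have "q \<noteq> 0" using wq odd_perm_0[OF o] by auto
          ultimately have l: "0 < - q" "- q < m" using A by (auto simp: m_def)
          show False
            using P4[of 2 1 4 3 "- q" m p' q'] l m A bd Aq a wm[of q] by (auto simp: pats)
        qed
      next
        case b
        then have y: "0 < w q" "w m < 0" "- w q' < w q" "w q < - w m" using Aq by auto
        have p'0: "w p' \<noteq> 0" "w p' \<noteq> w m" "w p' \<noteq> - w m" "w p' \<noteq> w q'" "w p' \<noteq> - w q'"
          using nz[of p'] ne[of m p'] ne[of p' q'] m m0 A by auto
        have mid: False if "- w q' < w p'" "w p' < - w m"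
          using N4[of m p' q'] that m m0 A bd b by auto
        \<comment> \<open>Only \<open>w p'\<close> is still free, apart from the place of
          \<open>q\<close>. Its three ranges, combined with the place of \<open>q\<close> relative
          to \<open>m\<close> and \<open>q'\<close>, yield the remaining signed patterns of length
          four.\<close>
        have tri: "w p' < 0 \<or> 0 < w p' \<and> w p' < - w q' \<or> - w m < w p'"
          using mid p'0 by (cases "- w q' < w p'"; cases "w p' < - w m") auto
        show False
        proof (cases "0 < q")
          case False
          moreover have "q \<noteq> 0" using y odd_perm_0[OF o] by auto
          ultimately have l: "0 < - q" "- q < m" using A by (auto simp: m_def)
          consider "w p' < 0" | "0 < w p'" "w p' < - w q'" | "- w m < w p'" using tri by blast
          then show False
          proof cases
            case 1
            then show False
              using P4[of "-3" "-4" "-1" "-2" "- q" m p' q'] l m A bd b y wm[of q] by (auto simp: pats)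
          next
            case 2
            then show False
              using P4[of "-3" "-4" 1 "-2" "- q" m p' q'] l m A bd b y wm[of q] by (auto simp: pats)
          next
            case 3
            then show False
              using P4[of "-2" "-3" 4 "-1" "- q" m p' q'] l m A bd b y wm[of q] by (auto simp: pats)
          qed
        next
          case q0: True
          have qn: "q \<noteq> m" "q \<noteq> q'" using y b by auto
          consider (lt) "q < m" | (mid) "m < q" "q < q'" | (gt) "q' < q" using qn by linarith
          then show False
          proof cases
            case lt
            consider "w p' < 0" | "0 < w p'" "w p' < - w q'" | "- w m < w p'" using tri by blast
            then show False
            proof cases
              case 1
              then show False
                using P4[of 3 "-4" "-1" "-2" q m p' q'] lt q0 m A bd b y by (auto simp: pats)
            next
              case 2
              then show False
                using P4[of 3 "-4" 1 "-2" q m p' q'] lt q0 m A bd b y by (auto simp: pats)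
            next
              case 3
              then show False
                using P4[of 2 "-3" 4 "-1" q m p' q'] lt q0 m A bd b y by (auto simp: pats)
            qed
          next
            case mid
            then show False using N4[of m q q'] m0 A bd b y by auto
          next
            case gt
            consider "w p' < 0" | "0 < w p'" "w p' < - w q'" | "- w m < w p'" using tri by blast
            then show False
            proof cases
              case 1
              then show False
                using P4[of "-4" "-1" "-2" 3 m p' q' q] gt m0 m A bd b y by (auto simp: pats)
            next
              case 2
              then show False
                using P4[of "-4" 1 "-2" 3 m p' q' q] gt m0 m A bd b y by (auto simp: pats)
            next
              case 3
              then show False using N1[of m p' q] gt m0 m A bd b y by auto
            qed
          qed
        qed
      qed
    qed
  qed
  show ?thesis unfolding vex_def
  proof (intro allI impI, elim conjE)
    fix p q p' q'
    assume A: "p < q" "w q < w p" "p' < q'" "w q' < w p'" "0 < p + p'" "0 < w q + w q'"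
    have p: "0 < p" "0 < p'" using pos[of p q p' q'] pos[of p' q' p q] A by auto
    have bd: "q' \<le> int n" "q \<le> int n" using bound[of p q] bound[of p' q'] A by auto
    have y: "0 < w q"
    proof (rule ccontr)
      assume "\<not> 0 < w q"
      then show False using neg_low[of q p' q'] nz[of q] p A bd by auto
    qed
    have y': "0 < w q'"
    proof (rule ccontr)
      assume "\<not> 0 < w q'"
      then show False using neg_low[of q' p q] nz[of q'] p A bd by auto
    qed
    have 1: "p < q'"
    proof (rule ccontr)
      assume n: "\<not> p < q'"
      show False
      proof (cases "q' = p")
        case True
        then show False using N5[of p' p q] p A bd y by auto
      next
        case False
        then have lt: "q' < p" using n by simp
        have "w p' \<noteq> w p" "w p' \<noteq> w q" "w q' \<noteq> w q"
          using ne(1)[of p' p] ne(1)[of p' q] ne(1)[of q' q] p A lt by auto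
        then consider "w p < w p'" | "w p' < w q" | "w q < w p'" "w p' < w p" "w q < w q'" | "w q < w p'" "w p' < w p" "w q' < w q"
          by linarith
        then show False
        proof cases
          case 1
          then show False using N5[of p' p q] p A bd y lt by auto
        next
          case 2
          then show False using P4[of 2 1 4 3 p' q' p q] p A bd y y' lt by (auto simp: pats)
        next
          case 3
          then show False using N5[of p' q' q] p A bd y lt by auto
        next
          case 4
          then show False using P4[of 3 1 4 2 p' q' p q] p A bd y y' lt by (auto simp: pats)
        qed
      qed
    qed
    have 2: "w q' < w p"
    proof (rule ccontr)
      assume n: "\<not> w q' < w p"
      have gt: "w p < w q'" using n ne(1)[of p q'] p 1 by auto
      have pn: "p \<noteq> p'" "q \<noteq> p'" "q \<noteq> q'" using A gt by auto
      then consider "p' < p" | "p < p'" "q < p'" | "p < p'" "p' < q" "q < q'" | "p < p'" "q' < q" by linarith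
      then show False
      proof cases
        case 1
        then show False using N5[of p' p q] p A bd y gt by auto
      next
        case 2
        then show False using P4[of 2 1 4 3 p q p' q'] p A bd y y' gt by (auto simp: pats)
      next
        case 3
        then show False using P4[of 2 4 1 3 p p' q q'] p A bd y y' gt by (auto simp: pats)
      next
        case 4
        then show False using N5[of p' q' q] p A bd y gt by auto
      qed
    qed
    show "0 < p \<and> 0 < w q \<and> p < q' \<and> w q' < w p" using p y 1 2 by blast
  qed
qed

section \<open>Set-valued tableaux\<close>

text \<open>Conditions on maxima and minima become conditions on all pairs of entries, which are
  inherited by subsets; any set of boxes is allowed as a shape, so that boxes can be
  removed.\<close>

definition tab :: "(nat \<times> nat) set \<Rightarrow> (nat \<times> nat \<Rightarrow> int set) \<Rightarrow> bool" where
  "tab D T \<longleftrightarrow> (\<forall>b. b \<notin> D \<longrightarrow> T b = {}) \<and> (\<forall>b\<in>D. finite (T b) \<and> T b \<noteq> {} \<and> 0 \<notin> T b) \<and>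
     (\<forall>i j. (i, j) \<in> D \<longrightarrow> (i + 1, j) \<in> D \<longrightarrow>
        (\<forall>x\<in>T (i, j). \<forall>y\<in>T (i + 1, j). prec_rank x < prec_rank y \<or> x = y \<and> x < 0)) \<and>
     (\<forall>i j. (i, j) \<in> D \<longrightarrow> (i, j + 1) \<in> D \<longrightarrow>
        (\<forall>x\<in>T (i, j). \<forall>y\<in>T (i, j + 1). prec_rank x < prec_rank y \<or> x = y \<and> 0 < x))"

lemma prec_rank_inj: "x \<noteq> 0 \<Longrightarrow> y \<noteq> 0 \<Longrightarrow> prec_rank x = prec_rank y \<longleftrightarrow> x = y"
  by (auto simp: prec_rank_def split: if_splits) presburger+

lemma prec_max_props:
  assumes "finite S" "S \<noteq> {}" shows "prec_max S \<in> S" "x \<in> S \<Longrightarrow> prec_rank x \<le> prec_rank (prec_max S)"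
proof -
  have "Max (prec_rank ` S) \<in> prec_rank ` S" using assms by simp
  then obtain m where "m \<in> S" "prec_rank m = Max (prec_rank ` S)" by auto
  then have "is_arg_max prec_rank (\<lambda>x. x \<in> S) m"
    using assms by (auto simp: is_arg_max_def not_less)
  then have "is_arg_max prec_rank (\<lambda>x. x \<in> S) (prec_max S)"
    unfolding prec_max_def arg_max_on_def arg_max_def by (rule someI)
  then show "prec_max S \<in> S" "x \<in> S \<Longrightarrow> prec_rank x \<le> prec_rank (prec_max S)"
    by (auto simp: is_arg_max_def not_less)
qed

lemma prec_min_props:
  assumes "finite S" "S \<noteq> {}" shows "prec_min S \<in> S" "x \<in> S \<Longrightarrow> prec_rank (prec_min S) \<le> prec_rank x"
proof -
  have "Min (prec_rank ` S) \<in> prec_rank ` S" using assms by simp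
  then obtain m where "m \<in> S" "prec_rank m = Min (prec_rank ` S)" by auto
  then have "is_arg_min prec_rank (\<lambda>x. x \<in> S) m"
    using assms by (auto simp: is_arg_min_def not_less)
  then have "is_arg_min prec_rank (\<lambda>x. x \<in> S) (prec_min S)"
    unfolding prec_min_def arg_min_on_def arg_min_def by (rule someI)
  then show "prec_min S \<in> S" "x \<in> S \<Longrightarrow> prec_rank (prec_min S) \<le> prec_rank x"
    by (auto simp: is_arg_min_def not_less)
qed

lemma max_min_cond:
  assumes A: "finite A" "A \<noteq> {}" "0 \<notin> A" and B: "finite B" "B \<noteq> {}" "0 \<notin> B"
  shows "(prec_rank (prec_max A) < prec_rank (prec_min B) \<or> prec_max A = prec_min B \<and> Q (prec_max A))
    \<longleftrightarrow> (\<forall>x\<in>A. \<forall>y\<in>B. prec_rank x < prec_rank y \<or> x = y \<and> Q x)"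
proof
  note mx = prec_max_props[OF A(1,2)] and mn = prec_min_props[OF B(1,2)]
  assume L: "prec_rank (prec_max A) < prec_rank (prec_min B) \<or> prec_max A = prec_min B \<and> Q (prec_max A)"
  show "\<forall>x\<in>A. \<forall>y\<in>B. prec_rank x < prec_rank y \<or> x = y \<and> Q x"
  proof (intro ballI)
    fix x y
    assume x: "x \<in> A" and y: "y \<in> B"
    show "prec_rank x < prec_rank y \<or> x = y \<and> Q x"
    proof (rule ccontr)
      assume n: "\<not> ?thesis"
      then have le: "prec_rank y \<le> prec_rank x" by simp
      then have e: "prec_max A = prec_min B" "Q (prec_max A)" using L mx(2)[OF x] mn(2)[OF y] by auto
      then have "prec_rank x = prec_rank (prec_max A)" "prec_rank y = prec_rank (prec_max A)"
        using le mx(2)[OF x] mn(2)[OF y] by auto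
      then have "x = prec_max A" "y = prec_max A"
        using prec_rank_inj[of x "prec_max A"] prec_rank_inj[of y "prec_max A"] x y A(3) B(3) mx(1) by metis+
      then show False using n e by simp
    qed
  qed
next
  assume "\<forall>x\<in>A. \<forall>y\<in>B. prec_rank x < prec_rank y \<or> x = y \<and> Q x"
  then show "prec_rank (prec_max A) < prec_rank (prec_min B) \<or> prec_max A = prec_min B \<and> Q (prec_max A)"
    using prec_max_props(1)[OF A(1,2)] prec_min_props(1)[OF B(1,2)] by blast
qed

lemma set_valued_tableaux_iff: "T \<in> set_valued_tableaux lam \<longleftrightarrow> tab (shifted_diagram lam) T"
proof -
  let ?D = "shifted_diagram lam"
  show ?thesis
  proof (cases "\<forall>b\<in>?D. finite (T b) \<and> T b \<noteq> {} \<and> 0 \<notin> T b")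
    case True
    have c: "(prec_rank (prec_max (T (i, j))) < prec_rank (prec_min (T (i + 1, j))) \<or>
            prec_max (T (i, j)) = prec_min (T (i + 1, j)) \<and> prec_max (T (i, j)) < 0) \<longleftrightarrow>
        (\<forall>x\<in>T (i, j). \<forall>y\<in>T (i + 1, j). prec_rank x < prec_rank y \<or> x = y \<and> x < 0)"
      if "(i, j) \<in> ?D" "(i + 1, j) \<in> ?D" for i j
      using max_min_cond[of "T (i, j)" "T (i + 1, j)" "\<lambda>x. x < 0"] True that by blast
    have r: "(prec_rank (prec_max (T (i, j))) < prec_rank (prec_min (T (i, j + 1))) \<or>
            prec_max (T (i, j)) = prec_min (T (i, j + 1)) \<and> prec_max (T (i, j)) > 0) \<longleftrightarrow>
        (\<forall>x\<in>T (i, j). \<forall>y\<in>T (i, j + 1). prec_rank x < prec_rank y \<or> x = y \<and> 0 < x)"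
      if "(i, j) \<in> ?D" "(i, j + 1) \<in> ?D" for i j
      using max_min_cond[of "T (i, j)" "T (i, j + 1)" "\<lambda>x. 0 < x"] True that by blast
    show ?thesis unfolding set_valued_tableaux_def tab_def mem_Collect_eq imp_conjL
      by (intro conj_cong refl all_cong1 imp_cong c r)
  next
    case False
    then show ?thesis unfolding set_valued_tableaux_def tab_def by blast
  qed
qed

text \<open>Tableaux in which the largest admissible letter, the one of rank \<open>L\<close>, occurs only in boxes
  of \<open>P\<close>.\<close>

definition tabs :: "(nat \<times> nat) set \<Rightarrow> int \<Rightarrow> (nat \<times> nat) set \<Rightarrow> (nat \<times> nat \<Rightarrow> int set) set" where
  "tabs D L P = {T. tab D T \<and> (\<forall>b. \<forall>x\<in>T b. prec_rank x \<le> L \<and> (prec_rank x = L \<longrightarrow> b \<in> P))}"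

definition wgt :: "(nat \<times> nat) set \<Rightarrow> (nat \<times> nat \<Rightarrow> int set) \<Rightarrow> ser" where
  "wgt D T = Poly_Mapping.single (\<Sum>b\<in>D. \<Sum>s\<in>T b. Poly_Mapping.single (nat \<bar>s\<bar>) 1)
     (beta ^ ((\<Sum>b\<in>D. card (T b)) - card D))"

definition tab_sum :: "(nat \<times> nat) set \<Rightarrow> int \<Rightarrow> (nat \<times> nat) set \<Rightarrow> ser" where
  "tab_sum D L P = (\<Sum>T\<in>tabs D L P. wgt D T)"

lemma tab_out: "tab D T \<Longrightarrow> a \<notin> D \<Longrightarrow> T a = {}"
  and tab_finite: "tab D T \<Longrightarrow> a \<in> D \<Longrightarrow> finite (T a)"
  and tab_nonempty: "tab D T \<Longrightarrow> a \<in> D \<Longrightarrow> T a \<noteq> {}"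
  unfolding tab_def by blast+

lemma tab_nz: "tab D T \<Longrightarrow> y \<in> T a \<Longrightarrow> y \<noteq> 0"
  unfolding tab_def by blast

lemma tab_dom: "tab D T \<Longrightarrow> y \<in> T a \<Longrightarrow> a \<in> D"
  unfolding tab_def by blast

lemma tab_below:
  "tab D T \<Longrightarrow> y \<in> T (i, j) \<Longrightarrow> z \<in> T (i + 1, j) \<Longrightarrow> prec_rank y < prec_rank z \<or> y = z \<and> y < 0"
  unfolding tab_def by blast

lemma tab_right:
  "tab D T \<Longrightarrow> y \<in> T (i, j) \<Longrightarrow> z \<in> T (i, j + 1) \<Longrightarrow> prec_rank y < prec_rank z \<or> y = z \<and> 0 < y"
  unfolding tab_def by blast

lemma tabsI:
  "tab D T \<Longrightarrow> (\<And>a y. y \<in> T a \<Longrightarrow> prec_rank y \<le> L \<and> (prec_rank y = L \<longrightarrow> a \<in> P)) \<Longrightarrow> T \<in> tabs D L P"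
  unfolding tabs_def by blast

lemma tabs_tab: "T \<in> tabs D L P \<Longrightarrow> tab D T"
  and tabs_le: "T \<in> tabs D L P \<Longrightarrow> y \<in> T a \<Longrightarrow> prec_rank y \<le> L"
  and tabs_mem: "T \<in> tabs D L P \<Longrightarrow> y \<in> T a \<Longrightarrow> prec_rank y = L \<Longrightarrow> a \<in> P"
  unfolding tabs_def by blast+

lemma prec_rank_abs_le: "x \<noteq> 0 \<Longrightarrow> \<bar>x\<bar> \<le> prec_rank x"
  by (auto simp: prec_rank_def)

lemma finite_tabs: assumes "finite D" shows "finite (tabs D L P)"
proof (rule finite_subset)
  show "tabs D L P \<subseteq> {T. \<forall>b. (b \<in> D \<longrightarrow> T b \<in> Pow {- L..L}) \<and> (b \<notin> D \<longrightarrow> T b = {})}"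
  proof
    fix T
    assume T: "T \<in> tabs D L P"
    have "x \<in> {- L..L}" if "b \<in> D" "x \<in> T b" for b x
    proof -
      have "x \<noteq> 0" "prec_rank x \<le> L" using tab_nz[OF tabs_tab[OF T]] tabs_le[OF T] that by blast+
      then show ?thesis using prec_rank_abs_le[of x] by auto
    qed
    moreover have "T b = {}" if "b \<notin> D" for b using tab_out[OF tabs_tab[OF T] that] .
    ultimately show "T \<in> {T. \<forall>b. (b \<in> D \<longrightarrow> T b \<in> Pow {- L..L}) \<and> (b \<notin> D \<longrightarrow> T b = {})}" by blast
  qed
  show "finite {T. \<forall>b. (b \<in> D \<longrightarrow> T b \<in> Pow {- L..L}) \<and> (b \<notin> D \<longrightarrow> T b = ({}::int set))}"
    by (rule finite_set_of_finite_funs[OF assms]) simp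
qed

lemma tab_card_ge: assumes "finite D" "tab D T" shows "card D \<le> (\<Sum>b\<in>D. card (T b))"
proof -
  have "(\<Sum>b\<in>D. 1) \<le> (\<Sum>b\<in>D. card (T b))"
    by (rule sum_mono) (use tab_finite[OF assms(2)] tab_nonempty[OF assms(2)] in \<open>simp add: card_gt_0_iff Suc_le_eq\<close>)
  then show ?thesis by simp
qed

lemma wgt_insert:
  assumes D: "finite D" "b \<in> D" and T: "tab D T" and x: "x \<notin> T b"
  shows "wgt D (T(b := insert x (T b))) = xv (nat \<bar>x\<bar>) * bR * wgt D T"
proof -
  let ?T = "T(b := insert x (T b))"
  have f: "finite (T b)" using tab_finite[OF T D(2)] .
  have m: "(\<Sum>a\<in>D. \<Sum>s\<in>?T a. Poly_Mapping.single (nat \<bar>s\<bar>) (1::nat))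
      = Poly_Mapping.single (nat \<bar>x\<bar>) 1 + (\<Sum>a\<in>D. \<Sum>s\<in>T a. Poly_Mapping.single (nat \<bar>s\<bar>) 1)"
    using D f x by (simp add: sum.remove[of D b] add.assoc)
  have c: "(\<Sum>a\<in>D. card (?T a)) = Suc (\<Sum>a\<in>D. card (T a))"
    using D f x by (simp add: sum.remove[of D b])
  show ?thesis unfolding wgt_def m c xv_def bR_def
    \<comment> \<open>The exponent of \<open>beta\<close> is a truncated difference; it grows by one
      only because it is not truncated here.\<close>
    using tab_card_ge[OF D(1) T] by (simp add: mult_single Suc_diff_le)
qed

lemma wgt_new:
  assumes D: "finite D" "b \<in> D" and T: "T b = {}"
  shows "wgt D (T(b := {x})) = xv (nat \<bar>x\<bar>) * wgt (D - {b}) T"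
proof -
  let ?T = "T(b := {x})"
  have m: "(\<Sum>a\<in>D. \<Sum>s\<in>?T a. Poly_Mapping.single (nat \<bar>s\<bar>) (1::nat))
      = Poly_Mapping.single (nat \<bar>x\<bar>) 1 + (\<Sum>a\<in>D - {b}. \<Sum>s\<in>T a. Poly_Mapping.single (nat \<bar>s\<bar>) 1)"
    using D by (simp add: sum.remove[of D b])
  have c: "(\<Sum>a\<in>D. card (?T a)) = Suc (\<Sum>a\<in>D - {b}. card (T a))"
    using D by (simp add: sum.remove[of D b])
  show ?thesis unfolding wgt_def m c card.remove[OF D] xv_def mult_single by simp
qed

text \<open>Allowing the largest letter in the corner \<open>b\<close> adds the tableaux that have
  it there. Erasing it leaves a tableau of the same shape, with a factor \<open>bR\<close> for the
  surplus letter, or a tableau without the box if the letter was alone. The result has the shape of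
  \<open>opx\<close>. The hypotheses \<open>left\<close> and \<open>above\<close> ensure that
  neighbours containing the same letter are compatible with it.\<close>

lemma corner_sum:
  assumes D: "finite D" and b: "b = (i0, j0)" "b \<in> D" and corner: "(i0, j0 + 1) \<notin> D" "(i0 + 1, j0) \<notin> D"
    and x: "x \<noteq> 0" and L: "L = prec_rank x" and P: "b \<notin> P"
    and left: "\<And>j. j0 = j + 1 \<Longrightarrow> (i0, j) \<in> P \<Longrightarrow> 0 < x" and above: "\<And>i. i0 = i + 1 \<Longrightarrow> (i, j0) \<in> P \<Longrightarrow> x < 0"
  shows "tab_sum D L (insert b P) =
    tab_sum D L P + xv (nat \<bar>x\<bar>) * (tab_sum (D - {b}) L P + bR * tab_sum D L P)"
proof -
  define A where "A = tabs D L P"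
  define B where "B = tabs (D - {b}) L P"
  define ins where "ins T = T(b := insert x (T b))" for T :: "nat \<times> nat \<Rightarrow> int set"
  have rk: "y = x" if "prec_rank y = L" "y \<noteq> 0" for y using prec_rank_inj[OF that(2) x] that L by simp
  have xb: "x \<notin> T b" if "T \<in> A \<or> T \<in> B" for T
    using that P tabs_mem[OF _ _ L[symmetric]] unfolding A_def B_def by blast
  have Bb: "T b = {}" if "T \<in> B" for T using that tab_out[OF tabs_tab] unfolding B_def by blast
  have nz: "y \<noteq> 0" if "T \<in> A \<or> T \<in> B \<or> T \<in> tabs D L (insert b P)" "y \<in> T a" for T a y
    using that tab_nz[OF tabs_tab] unfolding A_def B_def by blast
  have nbr: "prec_rank y < prec_rank x \<or> y = x \<and> (a = (i0, j0 - 1) \<and> 0 < j0 \<longrightarrow> 0 < x) \<and> (a = (i0 - 1, j0) \<and> 0 < i0 \<longrightarrow> x < 0)"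
    if "T \<in> A \<or> T \<in> B" "y \<in> T a" "a = (i0, j0 - 1) \<and> 0 < j0 \<or> a = (i0 - 1, j0) \<and> 0 < i0" for T a y
  proof (cases "prec_rank y = L")
    case True
    then have e: "y = x" using rk nz that by blast
    have aP: "a \<in> P" using True that(1,2) tabs_mem unfolding A_def B_def by blast
    have "0 < x" if "a = (i0, j0 - 1)" "0 < j0" using left[of "j0 - 1"] that aP by auto
    moreover have "x < 0" if "a = (i0 - 1, j0)" "0 < i0" using above[of "i0 - 1"] that aP by auto
    ultimately show ?thesis using e by blast
  next
    case False
    then have "prec_rank y < L" using that(1,2) tabs_le unfolding A_def B_def order_less_le by blast
    then show ?thesis using L by blast
  qed
  have insA: "ins T \<in> tabs D L (insert b P)" if TA: "T \<in> A" for T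
  proof -
    have T: "tab D T" and Tb: "\<And>a y. y \<in> T a \<Longrightarrow> prec_rank y \<le> L \<and> (prec_rank y = L \<longrightarrow> a \<in> P)"
      using TA unfolding A_def tabs_def by blast+
    have "tab D (ins T)"
      unfolding tab_def
    proof (intro conjI allI impI ballI)
      fix a assume "a \<notin> D" then show "ins T a = {}" using tab_out[OF T, of a] b(2) unfolding ins_def by (cases "a = b") simp_all
    next
      fix a assume "a \<in> D"
      then show "finite (ins T a)" "ins T a \<noteq> {}" "0 \<notin> ins T a" 
        using x tab_finite[OF T, of a] tab_nonempty[OF T, of a] tab_nz[OF T, of 0 a] by (auto simp: ins_def)
    next
      fix i j y z
      assume d: "(i, j) \<in> D" "(i + 1, j) \<in> D" and yz: "y \<in> ins T (i, j)" "z \<in> ins T (i + 1, j)"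
      have nb: "(i, j) \<noteq> b" using d corner b by auto
      then have y: "y \<in> T (i, j)" using yz by (simp add: ins_def)
      show "prec_rank y < prec_rank z \<or> y = z \<and> y < 0"
      proof (cases "z \<in> T (i + 1, j)")
        case True
        then show ?thesis using tab_below[OF T y] by blast
      next
        case False
        then have "z = x" "(i + 1, j) = b" using yz by (auto simp: ins_def split: if_splits)
        then show ?thesis using nbr[OF disjI1[OF TA] y] b by auto
      qed
    next
      fix i j y z
      assume d: "(i, j) \<in> D" "(i, j + 1) \<in> D" and yz: "y \<in> ins T (i, j)" "z \<in> ins T (i, j + 1)"
      have nb: "(i, j) \<noteq> b" using d corner b by auto
      then have y: "y \<in> T (i, j)" using yz by (simp add: ins_def)
      show "prec_rank y < prec_rank z \<or> y = z \<and> 0 < y"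
      proof (cases "z \<in> T (i, j + 1)")
        case True
        then show ?thesis using tab_right[OF T y] by blast
      next
        case False
        then have "z = x" "(i, j + 1) = b" using yz by (auto simp: ins_def split: if_splits)
        then show ?thesis using nbr[OF disjI1[OF TA] y] b by auto
      qed
    qed
    then show ?thesis
    proof (rule tabsI)
      fix a y
      assume "y \<in> ins T a"
      then have "y \<in> T a \<or> y = x \<and> a = b" unfolding ins_def by (cases "a = b") auto
      then show "prec_rank y \<le> L \<and> (prec_rank y = L \<longrightarrow> a \<in> insert b P)" using Tb L by blast
    qed
  qed
  have insB: "ins T \<in> tabs D L (insert b P)" if TB: "T \<in> B" for T
  proof -
    have T: "tab (D - {b}) T" and Tb: "\<And>a y. y \<in> T a \<Longrightarrow> prec_rank y \<le> L \<and> (prec_rank y = L \<longrightarrow> a \<in> P)"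
      using TB unfolding B_def tabs_def by blast+
    have "tab D (ins T)"
      unfolding tab_def
    proof (intro conjI allI impI ballI)
      fix a assume "a \<notin> D" then show "ins T a = {}" using tab_out[OF T, of a] b(2) unfolding ins_def by (cases "a = b") simp_all
    next
      fix a assume "a \<in> D"
      then show "finite (ins T a)" "ins T a \<noteq> {}" "0 \<notin> ins T a"

        using x Bb[OF TB] tab_finite[OF T, of a] tab_nonempty[OF T, of a] tab_nz[OF T, of 0 a] by (auto simp: ins_def)
    next
      fix i j y z
      assume d: "(i, j) \<in> D" "(i + 1, j) \<in> D" and yz: "y \<in> ins T (i, j)" "z \<in> ins T (i + 1, j)"
      have nb: "(i, j) \<noteq> b" using d corner b by auto
      then have y: "y \<in> T (i, j)" using yz by (simp add: ins_def)
      show "prec_rank y < prec_rank z \<or> y = z \<and> y < 0"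
      proof (cases "(i + 1, j) = b")
        case False
        then have "z \<in> T (i + 1, j)" using yz by (simp add: ins_def)
        then show ?thesis using tab_below[OF T y] by blast
      next
        case True
        then have "z = x" using yz Bb[OF TB] by (auto simp: ins_def)
        then show ?thesis using nbr[OF disjI2[OF TB] y] b True by auto
      qed
    next
      fix i j y z
      assume d: "(i, j) \<in> D" "(i, j + 1) \<in> D" and yz: "y \<in> ins T (i, j)" "z \<in> ins T (i, j + 1)"
      have nb: "(i, j) \<noteq> b" using d corner b by auto
      then have y: "y \<in> T (i, j)" using yz by (simp add: ins_def)
      show "prec_rank y < prec_rank z \<or> y = z \<and> 0 < y"
      proof (cases "(i, j + 1) = b")
        case False
        then have "z \<in> T (i, j + 1)" using yz by (simp add: ins_def)
        then show ?thesis using tab_right[OF T y] by blast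
      next
        case True
        then have "z = x" using yz Bb[OF TB] by (auto simp: ins_def)
        then show ?thesis using nbr[OF disjI2[OF TB] y] b True by auto
      qed
    qed
    then show ?thesis
    proof (rule tabsI)
      fix a y
      assume "y \<in> ins T a"
      then have "y \<in> T a \<or> y = x \<and> a = b" unfolding ins_def by (cases "a = b") auto
      then show "prec_rank y \<le> L \<and> (prec_rank y = L \<longrightarrow> a \<in> insert b P)" using Tb L by blast
    qed
  qed
  have split: "tabs D L (insert b P) = A \<union> (ins ` A \<union> ins ` B)"
  proof
    show "A \<union> (ins ` A \<union> ins ` B) \<subseteq> tabs D L (insert b P)"
      using insA insB unfolding A_def tabs_def by blast
    show "tabs D L (insert b P) \<subseteq> A \<union> (ins ` A \<union> ins ` B)"
    proof
      fix T
      assume TT: "T \<in> tabs D L (insert b P)"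
      then have T: "tab D T" and Tb: "\<And>a y. y \<in> T a \<Longrightarrow> prec_rank y \<le> L \<and> (prec_rank y = L \<longrightarrow> a \<in> insert b P)"
        unfolding tabs_def by blast+
      show "T \<in> A \<union> (ins ` A \<union> ins ` B)"
      proof (cases "x \<in> T b")
        case False
        have "T \<in> A"
        proof -
          have "a \<in> P" if y: "y \<in> T a" "prec_rank y = L" for a y
          proof -
            have "y = x" using rk[OF y(2)] nz TT y(1) by blast
            then show ?thesis using Tb[OF y(1)] y False by auto
          qed
          then show ?thesis using tabsI[OF T] Tb unfolding A_def by blast
        qed
        then show ?thesis by blast
      next
        case xT: True
        \<comment> \<open>Inverse of \<open>ins\<close>; whether the box becomes empty decides
          between the two families.\<close>
        define U where "U = T(b := T b - {x})"
        have UT: "ins U = T" using xT by (simp add: ins_def U_def insert_absorb)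
        have sub: "U a \<subseteq> T a" for a by (auto simp: U_def)
        have UP: "prec_rank y \<le> L \<and> (prec_rank y = L \<longrightarrow> a \<in> P)" if y: "y \<in> U a" for a y
        proof -
          have yT: "y \<in> T a" using y sub by blast
          have "a \<in> P" if r: "prec_rank y = L"
          proof -
            have "y = x" using rk[OF r] nz TT yT by blast
            then have "a \<noteq> b" using y by (auto simp: U_def)
            then show ?thesis using Tb[OF yT] r by auto
          qed
          then show ?thesis using Tb[OF yT] by blast
        qed
        show ?thesis
        proof (cases "T b = {x}")
          case True
          then have "U b = {}" by (simp add: U_def)
          moreover have Ua: "U a = T a" if "a \<noteq> b" for a using that by (simp add: U_def)
          ultimately have "tab (D - {b}) U" unfolding tab_def
          proof (intro conjI allI impI ballI)
            fix a assume "a \<notin> D - {b}"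
            then show "U a = {}" using \<open>U b = {}\<close> sub tab_out[OF T] by blast
          next
            fix a assume "a \<in> D - {b}"
            then have "a \<in> D" "U a = T a" using Ua by blast+
            then show "finite (U a)" "U a \<noteq> {}" "0 \<notin> U a"
              using tab_finite[OF T, of a] tab_nonempty[OF T, of a] tab_nz[OF T, of 0 a] by auto
          next
            fix i j y z
            assume "y \<in> U (i, j)" "z \<in> U (i + 1, j)"
            then show "prec_rank y < prec_rank z \<or> y = z \<and> y < 0" using tab_below[OF T] sub by blast
          next
            fix i j y z
            assume "y \<in> U (i, j)" "z \<in> U (i, j + 1)"
            then show "prec_rank y < prec_rank z \<or> y = z \<and> 0 < y" using tab_right[OF T] sub by blast
          qed
          then have "U \<in> B" using tabsI UP unfolding B_def by blast
          then show ?thesis using UT by blast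
        next
          case False
          have "tab D U" unfolding tab_def
          proof (intro conjI allI impI ballI)
            fix a assume "a \<notin> D" then show "U a = {}" using tab_out[OF T] sub[of a] by blast
          next
            fix a assume "a \<in> D"
            then show "finite (U a)" "U a \<noteq> {}" "0 \<notin> U a"
              using False xT tab_finite[OF T, of a] tab_nonempty[OF T, of a] tab_nz[OF T, of 0 a]
              by (auto simp: U_def)
          next
            fix i j y z
            assume "(i, j) \<in> D" "(i + 1, j) \<in> D" "y \<in> U (i, j)" "z \<in> U (i + 1, j)"
            then show "prec_rank y < prec_rank z \<or> y = z \<and> y < 0" using tab_below[OF T] sub by blast
          next
            fix i j y z
            assume "(i, j) \<in> D" "(i, j + 1) \<in> D" "y \<in> U (i, j)" "z \<in> U (i, j + 1)"
            then show "prec_rank y < prec_rank z \<or> y = z \<and> 0 < y" using tab_right[OF T] sub by blast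
          qed
          then have "U \<in> A" using tabsI UP unfolding A_def by blast
          then show ?thesis using UT by blast
        qed
      qed
    qed
  qed
  have inj: "inj_on ins (A \<union> B)"
  proof (rule inj_onI)
    fix T U
    assume TU: "T \<in> A \<union> B" "U \<in> A \<union> B" "ins T = ins U"
    show "T = U"
    proof
      fix a
      show "T a = U a"
      proof (cases "a = b")
        case True
        have "insert x (T b) = insert x (U b)" using fun_cong[OF TU(3), of b] by (simp add: ins_def)
        then show ?thesis using True xb[of T] xb[of U] TU(1,2) insert_ident[of x "T b" "U b"] by blast
      next
        case False
        then show ?thesis using fun_cong[OF TU(3), of a] by (simp add: ins_def)
      qed
    qed
  qed
  have AB: "A \<inter> B = {}" using Bb tab_nonempty[OF tabs_tab b(2)] unfolding A_def by blast
  have fin: "finite A" "finite B" unfolding A_def B_def using D by (simp_all add: finite_tabs)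
  have d1: "ins ` A \<inter> ins ` B = {}" 
    using inj_on_image_Int[OF inj Un_upper1 Un_upper2] AB by simp
  have d2: "A \<inter> (ins ` A \<union> ins ` B) = {}"
  proof -
    have "x \<in> T b" if "T \<in> ins ` A \<union> ins ` B" for T using that by (auto simp: ins_def)
    then show ?thesis using xb by blast
  qed
  have sA: "(\<Sum>T\<in>ins ` A. wgt D T) = xv (nat \<bar>x\<bar>) * bR * tab_sum D L P"
  proof -
    have "(\<Sum>T\<in>ins ` A. wgt D T) = (\<Sum>T\<in>A. wgt D (ins T))"
      using sum.reindex[OF inj_on_subset[OF inj Un_upper1], of "wgt D"] by simp
    also have "\<dots> = (\<Sum>T\<in>A. xv (nat \<bar>x\<bar>) * bR * wgt D T)"
    proof (rule sum.cong[OF refl])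
      fix T
      assume "T \<in> A"
      then show "wgt D (ins T) = xv (nat \<bar>x\<bar>) * bR * wgt D T"
        unfolding ins_def using xb wgt_insert[OF D b(2) tabs_tab] unfolding A_def by blast
    qed
    finally show ?thesis by (simp add: tab_sum_def A_def sum_distrib_left)
  qed
  have sB: "(\<Sum>T\<in>ins ` B. wgt D T) = xv (nat \<bar>x\<bar>) * tab_sum (D - {b}) L P"
  proof -
    have "(\<Sum>T\<in>ins ` B. wgt D T) = (\<Sum>T\<in>B. wgt D (ins T))"
      using sum.reindex[OF inj_on_subset[OF inj Un_upper2], of "wgt D"] by simp
    also have "\<dots> = (\<Sum>T\<in>B. xv (nat \<bar>x\<bar>) * wgt (D - {b}) T)"
    proof (rule sum.cong[OF refl])
      fix T
      assume "T \<in> B"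
      note e = Bb[OF this]
      show "wgt D (ins T) = xv (nat \<bar>x\<bar>) * wgt (D - {b}) T"
        using wgt_new[where T = T, OF D b(2) e] e by (simp add: ins_def)
    qed
    finally show ?thesis by (simp add: tab_sum_def B_def sum_distrib_left)
  qed
  have "tab_sum D L (insert b P) = (\<Sum>T\<in>A. wgt D T) + ((\<Sum>T\<in>ins ` A. wgt D T) + (\<Sum>T\<in>ins ` B. wgt D T))"
    unfolding tab_sum_def split using fin d1 d2 by (simp add: sum.union_disjoint)
  then show ?thesis unfolding sA sB by (simp add: tab_sum_def A_def algebra_simps)
qed

section \<open>The Grassmannian case\<close>

text \<open>The length of the diagonal of content \<open>c\<close>: the row of a part
  \<open>l\<close> ends at content \<open>l - 1\<close>.\<close>

definition num_parts_above :: "nat set \<Rightarrow> nat \<Rightarrow> nat" where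
  "num_parts_above \<Lambda> c = card {l \<in> \<Lambda>. c < l}"

definition shifted_shape :: "nat set \<Rightarrow> (nat \<times> nat) set" where
  "shifted_shape \<Lambda> = {(i, j). 1 \<le> i \<and> i \<le> j \<and> i \<le> num_parts_above \<Lambda> (j - i)}"

definition content :: "nat \<times> nat \<Rightarrow> nat" where
  "content a = snd a - fst a"

text \<open>Removal of the corner of content \<open>c\<close>, expressed on the set of parts; for
  \<open>c = 0\<close> the part 1 disappears.\<close>

definition lower_part :: "nat \<Rightarrow> nat set \<Rightarrow> nat set" where
  "lower_part c \<Lambda> = (\<Lambda> - {Suc c}) \<union> ({c} - {0})"

lemma num_parts_above_Suc: assumes "finite \<Lambda>" shows "num_parts_above \<Lambda> c = num_parts_above \<Lambda> (Suc c) + (if Suc c \<in> \<Lambda> then 1 else 0)"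
proof (cases "Suc c \<in> \<Lambda>")
  case True
  then have "{l \<in> \<Lambda>. c < l} = insert (Suc c) {l \<in> \<Lambda>. Suc c < l}" by auto
  then show ?thesis using True assms by (simp add: num_parts_above_def)
next
  case False
  then have "{l \<in> \<Lambda>. c < l} = {l \<in> \<Lambda>. Suc c < l}" by (auto simp: less_Suc_eq) (metis Suc_lessI)
  then show ?thesis using False by (simp add: num_parts_above_def)
qed

lemma num_parts_above_lower_part:
  assumes f: "finite \<Lambda>" and c: "Suc c \<in> \<Lambda>" "c \<notin> \<Lambda>"
  shows "num_parts_above (lower_part c \<Lambda>) d = (if d = c then num_parts_above \<Lambda> d - 1 else num_parts_above \<Lambda> d)"
proof -
  consider "d < c" | "d = c" | "c < d" by linarith
  then show ?thesis
  proof cases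
    case 1
    have "{l \<in> lower_part c \<Lambda>. d < l} = insert c ({l \<in> \<Lambda>. d < l} - {Suc c})" using 1 by (auto simp: lower_part_def)
    then have "num_parts_above (lower_part c \<Lambda>) d = Suc (card ({l \<in> \<Lambda>. d < l} - {Suc c}))" using c f by (simp add: num_parts_above_def)
    also have "\<dots> = num_parts_above \<Lambda> d" unfolding num_parts_above_def using c f 1 by (intro card_Suc_Diff1) auto
    finally show ?thesis using 1 by simp
  next
    case 2
    have "{l \<in> lower_part c \<Lambda>. d < l} = {l \<in> \<Lambda>. d < l} - {Suc c}" using 2 by (auto simp: lower_part_def)
    then show ?thesis using 2 c f by (simp add: num_parts_above_def)
  next
    case 3
    have "{l \<in> lower_part c \<Lambda>. d < l} = {l \<in> \<Lambda>. d < l}" using 3 by (auto simp: lower_part_def)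
    then show ?thesis using 3 by (simp add: num_parts_above_def)
  qed
qed

lemma num_parts_above_le_card: "finite \<Lambda> \<Longrightarrow> num_parts_above \<Lambda> c \<le> card \<Lambda>"
  unfolding num_parts_above_def by (rule card_mono) auto

lemma shifted_shape_content_less: "(i, j) \<in> shifted_shape \<Lambda> \<Longrightarrow> \<exists>l\<in>\<Lambda>. j - i < l"
proof -
  assume "(i, j) \<in> shifted_shape \<Lambda>"
  then have "card {l \<in> \<Lambda>. j - i < l} > 0" by (simp add: shifted_shape_def num_parts_above_def)
  then show "\<exists>l\<in>\<Lambda>. j - i < l" by (auto simp: card_gt_0_iff)
qed

lemma finite_shifted_shape: assumes "finite \<Lambda>" shows "finite (shifted_shape \<Lambda>)"
proof (rule finite_subset)
  show "shifted_shape \<Lambda> \<subseteq> {..card \<Lambda>} \<times> {..card \<Lambda> + Max (insert 0 \<Lambda>)}"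
  proof
    fix a
    assume a: "a \<in> shifted_shape \<Lambda>"
    obtain i j where ij: "a = (i, j)" by (cases a)
    obtain l where l: "l \<in> \<Lambda>" "j - i < l" using shifted_shape_content_less a ij by blast
    have "i \<le> card \<Lambda>" using a ij num_parts_above_le_card[OF assms, of "j - i"] unfolding shifted_shape_def by simp
    moreover have "l \<le> Max (insert 0 \<Lambda>)" using l assms by simp
    ultimately show "a \<in> {..card \<Lambda>} \<times> {..card \<Lambda> + Max (insert 0 \<Lambda>)}" using ij l(2) by simp
  qed
qed simp

lemma shifted_shape_corner_mem: "finite \<Lambda> \<Longrightarrow> Suc c \<in> \<Lambda> \<Longrightarrow> (num_parts_above \<Lambda> c, num_parts_above \<Lambda> c + c) \<in> shifted_shape \<Lambda>"
  using num_parts_above_Suc[of \<Lambda> c] by (simp add: shifted_shape_def)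

text \<open>The neighbours of a box lie on the diagonals of content \<open>c + 1\<close> and
  \<open>c - 1\<close>. Consecutive diagonal lengths differ by 0 or 1, according to the membership
  of one number in the set of parts.\<close>

lemma shifted_shape_corner:
  assumes f: "finite \<Lambda>" "0 \<notin> \<Lambda>" and a: "(i, j) \<in> shifted_shape \<Lambda>" and c: "j - i = c"
  shows "(i, j + 1) \<notin> shifted_shape \<Lambda> \<and> (i + 1, j) \<notin> shifted_shape \<Lambda> \<longleftrightarrow>
    Suc c \<in> \<Lambda> \<and> c \<notin> \<Lambda> \<and> i = num_parts_above \<Lambda> c \<and> j = num_parts_above \<Lambda> c + c"
proof -
  have ij: "1 \<le> i" "i \<le> num_parts_above \<Lambda> c" "j = i + c" using a c by (auto simp: shifted_shape_def)
  have r: "(i, j + 1) \<in> shifted_shape \<Lambda> \<longleftrightarrow> i \<le> num_parts_above \<Lambda> (Suc c)" using ij by (simp add: shifted_shape_def)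
  show ?thesis
  proof (cases c)
    case 0
    then have "(i + 1, j) \<notin> shifted_shape \<Lambda>" using ij by (simp add: shifted_shape_def)
    then show ?thesis using r ij num_parts_above_Suc[OF f(1), of c] 0 f(2) by auto
  next
    case (Suc d)
    then have "j - (i + 1) = d" using ij by simp
    then have "(i + 1, j) \<in> shifted_shape \<Lambda> \<longleftrightarrow> i + 1 \<le> num_parts_above \<Lambda> d" using ij Suc by (simp add: shifted_shape_def)
    then show ?thesis using r ij num_parts_above_Suc[OF f(1), of c] num_parts_above_Suc[OF f(1), of d] Suc by (auto split: if_splits)
  qed
qed

lemma shifted_shape_lower_part:
  assumes f: "finite \<Lambda>" and c: "Suc c \<in> \<Lambda>" "c \<notin> \<Lambda>"
  shows "shifted_shape \<Lambda> - {(num_parts_above \<Lambda> c, num_parts_above \<Lambda> c + c)} = shifted_shape (lower_part c \<Lambda>)"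
proof (rule set_eqI)
  fix a :: "nat \<times> nat"
  obtain i j where a: "a = (i, j)" by (cases a)
  show "a \<in> shifted_shape \<Lambda> - {(num_parts_above \<Lambda> c, num_parts_above \<Lambda> c + c)} \<longleftrightarrow> a \<in> shifted_shape (lower_part c \<Lambda>)"
    using num_parts_above_Suc[OF f, of c] c unfolding a shifted_shape_def num_parts_above_lower_part[OF f c] by auto
qed

lemma tabs_cong:
  assumes "\<And>T a y. T \<in> tabs D L (P \<union> Q) \<Longrightarrow> y \<in> T a \<Longrightarrow> prec_rank y = L \<Longrightarrow> a \<in> P \<longleftrightarrow> a \<in> Q"
  shows "tabs D L P = tabs D L Q"
proof -
  have 1: "tabs D L P \<subseteq> tabs D L (P \<union> Q)" "tabs D L Q \<subseteq> tabs D L (P \<union> Q)" unfolding tabs_def by blast+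
  show ?thesis
  proof (intro equalityI subsetI)
    fix T assume T: "T \<in> tabs D L P"
    show "T \<in> tabs D L Q"
      using tabsI[OF tabs_tab[OF T]] tabs_le[OF T] tabs_mem[OF T] assms[of T] T 1 by blast
  next
    fix T assume T: "T \<in> tabs D L Q"
    show "T \<in> tabs D L P"
      using tabsI[OF tabs_tab[OF T]] tabs_le[OF T] tabs_mem[OF T] assms[of T] T 1 by blast
  qed
qed

text \<open>Only a corner can receive the largest letter on a diagonal: otherwise the box on its
  right or below would have to repeat the letter. Repetition is possible to the right for positive
  and below for negative letters, and in both cases the contents are processed in an order in which
  that box comes later.\<close>

lemma tab_sum_content_step:
  assumes f: "finite \<Lambda>" "0 \<notin> \<Lambda>" and x: "x \<noteq> 0" and L: "L = prec_rank x"
    and P: "0 < x \<and> P = {a. content a < c} \<or> x < 0 \<and> P = {a. c < content a}"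
  shows "tab_sum (shifted_shape \<Lambda>) L (P \<union> {a. content a = c}) = tab_sum (shifted_shape \<Lambda>) L P + xv (nat \<bar>x\<bar>) *
    (if Suc c \<in> \<Lambda> \<and> c \<notin> \<Lambda> then tab_sum (shifted_shape (lower_part c \<Lambda>)) L P + bR * tab_sum (shifted_shape \<Lambda>) L P else 0)"
proof -
  let ?D = "shifted_shape \<Lambda>" and ?b = "(num_parts_above \<Lambda> c, num_parts_above \<Lambda> c + c)"
  have key: "a = ?b \<and> Suc c \<in> \<Lambda> \<and> c \<notin> \<Lambda>"
    if T: "T \<in> tabs ?D L (P \<union> {a. content a = c})" and y: "y \<in> T a" "prec_rank y = L" and a: "content a = c" for T a y
  proof -
    note t = tabs_tab[OF T]
    have yx: "y = x" using prec_rank_inj[OF tab_nz[OF t y(1)] x] y(2) L by simp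
    obtain i j where ij: "a = (i, j)" by (cases a)
    have aD: "(i, j) \<in> ?D" using tab_dom[OF t y(1)] ij by simp
    have le: "i \<le> j" "j = i + c" using aD a ij by (auto simp: shifted_shape_def content_def)
    have "(i, j + 1) \<notin> ?D"
    proof
      assume "(i, j + 1) \<in> ?D"
      then obtain z where z: "z \<in> T (i, j + 1)" using tab_nonempty[OF t] by blast
      have "z = x" "0 < x" using tab_right[OF t y(1)[unfolded ij] z] tabs_le[OF T z] L yx by auto
      then have "(i, j + 1) \<in> P \<union> {a. content a = c}" using tabs_mem[OF T z] L by simp
      then show False using P \<open>0 < x\<close> le by (auto simp: content_def)
    qed
    moreover have "(i + 1, j) \<notin> ?D"
    proof
      assume d: "(i + 1, j) \<in> ?D"
      then obtain z where z: "z \<in> T (i + 1, j)" using tab_nonempty[OF t] by blast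
      have "z = x" "x < 0" using tab_below[OF t y(1)[unfolded ij] z] tabs_le[OF T z] L yx by auto
      then have "(i + 1, j) \<in> P \<union> {a. content a = c}" using tabs_mem[OF T z] L by simp
      moreover have "i + 1 \<le> j" using d by (simp add: shifted_shape_def)
      ultimately show False using P \<open>x < 0\<close> le by (auto simp: content_def)
    qed
    ultimately show ?thesis using shifted_shape_corner[OF f aD] a ij by (simp add: content_def)
  qed
  show ?thesis
  proof (cases "Suc c \<in> \<Lambda> \<and> c \<notin> \<Lambda>")
    case True
    have bD: "?b \<in> ?D" using shifted_shape_corner_mem f True by blast
    have corner: "(num_parts_above \<Lambda> c, num_parts_above \<Lambda> c + c + 1) \<notin> ?D" "(num_parts_above \<Lambda> c + 1, num_parts_above \<Lambda> c + c) \<notin> ?D"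
      using shifted_shape_corner[OF f bD] True by simp_all
    have bP: "?b \<notin> P" using P by (auto simp: content_def)
    have "insert ?b P \<subseteq> P \<union> {a. content a = c}" by (auto simp: content_def)
    then have u: "P \<union> {a. content a = c} \<union> insert ?b P = P \<union> {a. content a = c}" by blast
    have "tabs ?D L (P \<union> {a. content a = c}) = tabs ?D L (insert ?b P)"
    proof (rule tabs_cong, unfold u)
      fix T a y
      assume A: "T \<in> tabs ?D L (P \<union> {a. content a = c})" "y \<in> T a" "prec_rank y = L"
      show "a \<in> P \<union> {a. content a = c} \<longleftrightarrow> a \<in> insert ?b P"
        using key[OF A] tabs_mem[OF A] by blast
    qed
    then have "tab_sum ?D L (P \<union> {a. content a = c}) = tab_sum ?D L (insert ?b P)" by (simp add: tab_sum_def)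
    also have "\<dots> = tab_sum ?D L P + xv (nat \<bar>x\<bar>) * (tab_sum (?D - {?b}) L P + bR * tab_sum ?D L P)"
    proof (rule corner_sum[OF finite_shifted_shape[OF f(1)] refl bD corner x L bP])
      fix j assume "num_parts_above \<Lambda> c + c = j + 1" "(num_parts_above \<Lambda> c, j) \<in> P"
      then show "0 < x" using P by (auto simp: content_def)
    next
      fix i assume "num_parts_above \<Lambda> c = i + 1" "(i, num_parts_above \<Lambda> c + c) \<in> P"
      then show "x < 0" using P by (auto simp: content_def)
    qed
    finally show ?thesis using True shifted_shape_lower_part[OF f(1), of c] by simp
  next
    case False
    have "tabs ?D L (P \<union> {a. content a = c}) = tabs ?D L P"
    proof (rule tabs_cong)
      fix T a y
      assume A: "T \<in> tabs ?D L (P \<union> {a. content a = c} \<union> P)" "y \<in> T a" "prec_rank y = L"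
      have u: "P \<union> {a. content a = c} \<union> P = P \<union> {a. content a = c}" by blast
      show "a \<in> P \<union> {a. content a = c} \<longleftrightarrow> a \<in> P"
        using key[OF A(1)[unfolded u] A(2,3)] tabs_mem[OF A] False by blast
    qed
    then have "tab_sum ?D L (P \<union> {a. content a = c}) = tab_sum ?D L P" by (simp add: tab_sum_def)
    then show ?thesis unfolding if_not_P[OF False] by simp
  qed
qed

lemma tab_sum_raise:
  assumes "\<And>a. a \<in> D \<Longrightarrow> a \<notin> P" shows "tab_sum D (L + 1) P = tab_sum D L UNIV"
proof -
  have "tabs D (L + 1) P = tabs D L UNIV"
  proof (intro equalityI subsetI)
    fix T assume T: "T \<in> tabs D (L + 1) P"
    have "prec_rank y \<le> L" if "y \<in> T a" for a y
      using tabs_le[OF T that] tabs_mem[OF T that] assms tab_dom[OF tabs_tab[OF T] that] by fastforce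
    then show "T \<in> tabs D L UNIV" using tabsI[OF tabs_tab[OF T]] by blast
  next
    fix T assume T: "T \<in> tabs D L UNIV"
    show "T \<in> tabs D (L + 1) P" using tabs_le[OF T] by (intro tabsI[OF tabs_tab[OF T]]) fastforce
  qed
  then show ?thesis by (simp add: tab_sum_def)
qed

lemma tab_sum_all: assumes "D \<subseteq> P" shows "tab_sum D L P = tab_sum D L UNIV"
proof -
  have "tabs D L P = tabs D L UNIV"
    by (rule tabs_cong) (use tab_dom[OF tabs_tab] assms in blast)
  then show ?thesis by (simp add: tab_sum_def)
qed

lemma tab_sum_empty: "tab_sum {} L P = 1"
proof -
  have "tabs {} L P = {\<lambda>b. {}}"
  proof (intro equalityI subsetI)
    fix T assume T: "T \<in> tabs {} L P"
    have "T = (\<lambda>b. {})" by (rule ext) (use tab_out[OF tabs_tab[OF T]] in simp)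
    then show "T \<in> {\<lambda>b. {}}" by simp
  next
    fix T :: "nat \<times> nat \<Rightarrow> int set" assume "T \<in> {\<lambda>b. {}}"
    then show "T \<in> tabs {} L P" unfolding tabs_def tab_def by simp
  qed
  then show ?thesis by (simp add: tab_sum_def wgt_def)
qed

lemma tab_sum_no_letters: assumes "D \<noteq> {}" shows "tab_sum D 0 P = 0"
proof -
  obtain a where a: "a \<in> D" using assms by blast
  have "tabs D 0 P = {}"
  proof (rule equals0I)
    fix T assume T: "T \<in> tabs D 0 P"
    obtain y where y: "y \<in> T a" using tab_nonempty[OF tabs_tab[OF T] a] by blast
    show False using tab_nz[OF tabs_tab[OF T] y] tabs_le[OF T y] prec_rank_abs_le[of y] by simp
  qed
  then show ?thesis by (simp add: tab_sum_def)
qed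

lemma shifted_shape_empty_iff: assumes "finite \<Lambda>" "0 \<notin> \<Lambda>" shows "shifted_shape \<Lambda> = {} \<longleftrightarrow> \<Lambda> = {}"
proof
  assume e: "shifted_shape \<Lambda> = {}"
  show "\<Lambda> = {}"
  proof (rule ccontr)
    assume "\<Lambda> \<noteq> {}"
    then obtain l where l: "l \<in> \<Lambda>" by blast
    then have "l = Suc (l - 1)" using assms(2) by (cases l) auto
    then show False using shifted_shape_corner_mem[OF assms(1), of "l - 1"] l e by simp
  qed
next
  assume "\<Lambda> = {}" then show "shifted_shape \<Lambda> = {}" by (auto simp: shifted_shape_def num_parts_above_def)
qed

section \<open>Grassmannian elements and strict partitions\<close>

text \<open>Equivalently, the inverse increases on the positive integers; this form is stable under
  the right multiplications performed by \<open>dd\<close>.\<close>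

definition grassmannian :: "(int \<Rightarrow> int) \<Rightarrow> bool" where
  "grassmannian w \<longleftrightarrow> odd_perm w \<and> (\<forall>p q. p < q \<longrightarrow> 0 < w p \<longrightarrow> 0 < w q \<longrightarrow> w p < w q)"

definition neg_positions :: "(int \<Rightarrow> int) \<Rightarrow> nat set" where
  "neg_positions w = {j. 0 < j \<and> w (int j) < 0}"

lemma grassmannian_odd: "grassmannian w \<Longrightarrow> odd_perm w"
  and grassmannian_less: "grassmannian w \<Longrightarrow> p < q \<Longrightarrow> 0 < w p \<Longrightarrow> 0 < w q \<Longrightarrow> w p < w q"
  unfolding grassmannian_def by blast+

lemma grassmannian_inv:
  assumes h: "odd_perm h" and inc: "\<And>x y. 0 < x \<Longrightarrow> x < y \<Longrightarrow> h x < h y" shows "grassmannian (inv h)"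
  unfolding grassmannian_def
proof (intro conjI allI impI)
  show "odd_perm (inv h)" using odd_perm_inv[OF h] .
  fix p q :: int
  assume pq: "p < q" and p: "0 < inv h p" and q: "0 < inv h q"
  show "inv h p < inv h q"
  proof (rule ccontr)
    assume "\<not> ?thesis"
    then have "h (inv h q) \<le> h (inv h p)" using inc[OF q, of "inv h p"] by (cases "inv h q = inv h p") auto
    then show False using pq by (simp add: odd_perm_f_inv[OF h])
  qed
qed

lemma zero_notin_neg_positions: "0 \<notin> neg_positions w" by (simp add: neg_positions_def)

lemma neg_positions_le: assumes "w \<in> signed_perms m" "j \<in> neg_positions w" shows "j \<le> m"
proof (rule ccontr)
  assume "\<not> j \<le> m"
  then have "w (int j) = int j" using assms(1) by (auto simp: signed_perms_def permutes_def)
  then show False using assms(2) by (simp add: neg_positions_def)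
qed

lemma finite_neg_positions: assumes "w \<in> signed_perms m" shows "finite (neg_positions w)"
  by (rule finite_subset[of _ "{..m}"]) (use neg_positions_le[OF assms] in auto)

text \<open>Positive entries increase with the position, and by oddness so do negative ones. A
  descent therefore passes from a positive to a negative entry; for \<open>c = 0\<close> the
  positive entry is the one at -1.\<close>

lemma grassmannian_desc: assumes g: "grassmannian w" shows "desc w c \<longleftrightarrow> Suc c \<in> neg_positions w \<and> c \<notin> neg_positions w"
proof -
  note o = grassmannian_odd[OF g]
  have m: "w (- x) = - w x" for x using odd_perm_minus[OF o] .
  have nz: "w x \<noteq> 0" if "x \<noteq> 0" for x using odd_perm_eq_0_iff[OF o] that by simp
  show ?thesis
  proof (cases "c = 0")
    case True
    then show ?thesis using m[of 1] by (simp add: neg_positions_def lo_def up_def)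
  next
    case False
    have 1: "w (int c) < w (int c + 1)" if "0 < w (int c)" "0 < w (int c + 1)"
      using grassmannian_less[OF g _ that] by simp
    have 2: "w (int c) < w (int c + 1)" if "w (int c) < 0" "w (int c + 1) < 0"
      using grassmannian_less[OF g, of "- (int c + 1)" "- int c"] that m[of "int c"] m[of "int c + 1"] by simp
    have e: "int (Suc c) = int c + 1" by simp
    show ?thesis using 1 2 nz[of "int c"] nz[of "int c + 1"] False
      unfolding neg_positions_def lo_def up_def mem_Collect_eq e by fastforce
  qed
qed

lemma grassmannian_comp_cox_gen: assumes g: "grassmannian w" and d: "desc w c" shows "grassmannian (w \<circ> cox_gen c)"
  unfolding grassmannian_def
proof (intro conjI allI impI)
  note o = grassmannian_odd[OF g]
  show "odd_perm (w \<circ> cox_gen c)" using odd_perm_comp[OF o odd_perm_cox_gen] .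
  fix p q
  assume pq: "p < q" and p: "0 < (w \<circ> cox_gen c) p" and q: "0 < (w \<circ> cox_gen c) q"
  let ?s = "cox_gen c"
  note so = odd_perm_cox_gen[of c]
  have nz: "p \<noteq> 0" "q \<noteq> 0" using p q odd_perm_0[OF o] odd_perm_0[OF so] by auto
  have ne: "?s p \<noteq> ?s q" using odd_perm_eq_iff[OF so] pq by simp
  show "(w \<circ> ?s) p < (w \<circ> ?s) q"
  proof (cases "?s p < ?s q")
    case True
    then show ?thesis using grassmannian_less[OF g True] p q by simp
  next
    case False
    then have "p = lo c \<and> q = up c \<or> p = - up c \<and> q = - lo c"
      using cox_gen_reverses[OF nz pq, of c] ne by simp
    then show ?thesis using d odd_perm_minus[OF o] odd_perm_minus[OF so] by auto
  qed
qed

lemma neg_positions_comp_cox_gen: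
  assumes g: "grassmannian w" and d: "desc w c" shows "neg_positions (w \<circ> cox_gen c) = lower_part c (neg_positions w)"
proof (rule set_eqI)
  fix j
  note o = grassmannian_odd[OF g]
  have L: "Suc c \<in> neg_positions w" "c \<notin> neg_positions w" using grassmannian_desc[OF g] d by auto
  have nz: "w x \<noteq> 0" if "x \<noteq> 0" for x using odd_perm_eq_0_iff[OF o] that by simp
  have "int (Suc c) = int c + 1" by simp
  then have w1: "w (int c + 1) < 0" using L(1) unfolding neg_positions_def by (simp add: add.commute)
  have w0: "w (int c) > 0" if "c \<noteq> 0" using L(2) that nz[of "int c"] by (simp add: neg_positions_def)
  consider "j = Suc c" | "j = c" "c \<noteq> 0" | "j = 0" | "j \<noteq> 0" "j \<noteq> c" "j \<noteq> Suc c" by blast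
  then show "j \<in> neg_positions (w \<circ> cox_gen c) \<longleftrightarrow> j \<in> lower_part c (neg_positions w)"
  proof cases
    case 1
    have "cox_gen c (int j) = lo c" unfolding cox_gen_up[symmetric] 1 by (simp add: up_def add.commute)
    then show ?thesis using 1 w0 w1 odd_perm_minus[OF o, of 1] by (auto simp: neg_positions_def lower_part_def lo_def)
  next
    case 2
    then have "cox_gen c (int j) = up c" unfolding cox_gen_lo[symmetric] by (simp add: lo_def)
    then show ?thesis using 2 w1 by (simp add: neg_positions_def lower_part_def up_def)
  next
    case 3
    then show ?thesis by (auto simp: neg_positions_def lower_part_def)
  next
    case 4
    then have "cox_gen c (int j) = int j" unfolding cox_gen_eq swp_def lo_def up_def by auto
    then show ?thesis using 4 by (simp add: neg_positions_def lower_part_def)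
  qed
qed

lemma grassmannian_neg_positions_empty: assumes w: "w \<in> signed_perms m" and g: "grassmannian w" and e: "neg_positions w = {}" shows "w = id"
  using no_desc_imp_id[OF w] grassmannian_desc[OF g] e by simp

section \<open>Comparison with tableaux, letter by letter\<close>

definition agree :: "nat \<Rightarrow> ((int \<Rightarrow> int) \<Rightarrow> ser) \<Rightarrow> (nat set \<Rightarrow> ser) \<Rightarrow> bool" where
  "agree m f G \<longleftrightarrow> (\<forall>w\<in>signed_perms m. grassmannian w \<longrightarrow> f w = G (neg_positions w))"

lemma agree_opx:
  assumes a: "agree m f G" and c: "c < m"
    and H: "\<And>\<Lambda>. finite \<Lambda> \<Longrightarrow> 0 \<notin> \<Lambda> \<Longrightarrow>
      H \<Lambda> = G \<Lambda> + x * (if Suc c \<in> \<Lambda> \<and> c \<notin> \<Lambda> then G (lower_part c \<Lambda>) + bR * G \<Lambda> else 0)"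
  shows "agree m (opx bR x c f) H"
  unfolding agree_def
proof (intro ballI impI)
  fix w
  assume w: "w \<in> signed_perms m" and g: "grassmannian w"
  have 1: "f w = G (neg_positions w)" using a w g unfolding agree_def by blast
  have 2: "f (w \<circ> cox_gen c) = G (lower_part c (neg_positions w))" if d: "desc w c"
    using a signed_perms_comp[OF w signed_perms_cox_gen[OF c]] grassmannian_comp_cox_gen[OF g d]
    unfolding agree_def neg_positions_comp_cox_gen[OF g d, symmetric] by blast
  show "opx bR x c f w = H (neg_positions w)"
    unfolding opx_def dd_def H[OF finite_neg_positions[OF w] zero_notin_neg_positions]
    using 1 2 grassmannian_odd[OF g] grassmannian_desc[OF g, of c] by auto
qed

lemma agree_negative:
  assumes "k \<le> m" "agree m f (\<lambda>\<Lambda>. tab_sum (shifted_shape \<Lambda>) (2 * int N + 1) {a. k \<le> content a})"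
  shows "agree m (fold (opx bR (xv (Suc N))) (rev [0..<k]) f) (\<lambda>\<Lambda>. tab_sum (shifted_shape \<Lambda>) (2 * int N + 1) UNIV)"
  using assms
proof (induction k arbitrary: f)
  case 0
  then show ?case by simp
next
  case (Suc k)
  have s: "{a. k \<le> content a} = {a. k < content a} \<union> {a. content a = k}" "{a. Suc k \<le> content a} = {a. k < content a}" by auto
  have n: "nat \<bar>- int (Suc N)\<bar> = Suc N" by simp
  have "agree m (opx bR (xv (Suc N)) k f) (\<lambda>\<Lambda>. tab_sum (shifted_shape \<Lambda>) (2 * int N + 1) {a. k \<le> content a})"
    unfolding s(1)
    by (rule agree_opx[OF Suc.prems(2)[unfolded s(2)]])
       (use Suc.prems(1) tab_sum_content_step[where x = "- int (Suc N)" and L = "2 * int N + 1", unfolded n]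
        in \<open>auto simp: prec_rank_def\<close>)
  then show ?case using Suc.IH Suc.prems(1) by simp
qed

lemma agree_positive:
  assumes "k \<le> m" "agree m f (\<lambda>\<Lambda>. tab_sum (shifted_shape \<Lambda>) (2 * int N + 2) {})"
  shows "agree m (fold (opx bR (xv (Suc N))) [0..<k] f) (\<lambda>\<Lambda>. tab_sum (shifted_shape \<Lambda>) (2 * int N + 2) {a. content a < k})"
  using assms(1)
proof (induction k)
  case 0
  then show ?case using assms(2) by simp
next
  case (Suc k)
  have s: "{a. content a < Suc k} = {a. content a < k} \<union> {a. content a = k}" by auto
  have n: "nat \<bar>int (Suc N)\<bar> = Suc N" by simp
  have i: "agree m (fold (opx bR (xv (Suc N))) [0..<k] f) (\<lambda>\<Lambda>. tab_sum (shifted_shape \<Lambda>) (2 * int N + 2) {a. content a < k})"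
    using Suc by simp
  have "agree m (opx bR (xv (Suc N)) k (fold (opx bR (xv (Suc N))) [0..<k] f))
     (\<lambda>\<Lambda>. tab_sum (shifted_shape \<Lambda>) (2 * int N + 2) {a. content a < Suc k})"
    unfolding s
    by (rule agree_opx[OF i])
       (use Suc.prems tab_sum_content_step[where x = "int (Suc N)" and L = "2 * int N + 2", unfolded n]
        in \<open>auto simp: prec_rank_def\<close>)
  then show ?case by simp
qed

lemma shifted_shape_neg_positions_content: assumes "w \<in> signed_perms m" "a \<in> shifted_shape (neg_positions w)" shows "content a < m"
proof -
  obtain i j where a: "a = (i, j)" by (cases a)
  obtain l where "l \<in> neg_positions w" "j - i < l" using shifted_shape_content_less assms(2) a by blast
  then show ?thesis using neg_positions_le[OF assms(1)] a by (force simp: content_def)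
qed

lemma agree_cong:
  "agree m f G \<Longrightarrow> (\<And>w. w \<in> signed_perms m \<Longrightarrow> G (neg_positions w) = H (neg_positions w)) \<Longrightarrow> agree m f H"
  unfolding agree_def by simp

text \<open>The next two ranks \<open>2 * int N + 1\<close> and \<open>2 * int N + 2\<close> belong
  to the letters \<open>- int (Suc N)\<close> and \<open>int (Suc N)\<close>, both of which
  contribute the variable with index \<open>Suc N\<close>.\<close>

lemma agree_FF: "agree m (FF m N) (\<lambda>\<Lambda>. tab_sum (shifted_shape \<Lambda>) (2 * int N) UNIV)"
proof (induction N)
  case 0
  show ?case unfolding agree_def
  proof (intro ballI impI)
    fix w
    assume w: "w \<in> signed_perms m" and g: "grassmannian w"
    have e: "w = id \<longleftrightarrow> neg_positions w = {}"
    proof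
      show "w = id \<Longrightarrow> neg_positions w = {}" by (simp add: neg_positions_def)
    qed (rule grassmannian_neg_positions_empty[OF w g])
    show "FF m 0 w = tab_sum (shifted_shape (neg_positions w)) (2 * int 0) UNIV"
    proof (cases "neg_positions w = {}")
      case True
      then have "shifted_shape (neg_positions w) = {}" using shifted_shape_empty_iff finite_neg_positions[OF w] zero_notin_neg_positions by blast
      then show ?thesis using True e by (simp add: FF_0 dlt_def tab_sum_empty)
    next
      case False
      then have "shifted_shape (neg_positions w) \<noteq> {}" using shifted_shape_empty_iff finite_neg_positions[OF w] zero_notin_neg_positions by blast
      then show ?thesis using False e by (simp add: FF_0 dlt_def tab_sum_no_letters)
    qed
  qed
next
  case (Suc N)
  let ?o = "opx bR (xv (Suc N))"
  \<comment> \<open>All contents are below \<open>m\<close>, so the new letter is not yet allowed in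
    any box.\<close>
  have "agree m (FF m N) (\<lambda>\<Lambda>. tab_sum (shifted_shape \<Lambda>) (2 * int N + 1) {a. m \<le> content a})"
    by (rule agree_cong[OF Suc.IH], rule tab_sum_raise[symmetric]) (use shifted_shape_neg_positions_content in fastforce)
  then have "agree m (fold ?o (rev [0..<m]) (FF m N)) (\<lambda>\<Lambda>. tab_sum (shifted_shape \<Lambda>) (2 * int N + 1) UNIV)"
    by (rule agree_negative[OF order_refl])
  then have "agree m (fold ?o (rev [0..<m]) (FF m N)) (\<lambda>\<Lambda>. tab_sum (shifted_shape \<Lambda>) (2 * int N + 1 + 1) {})"
    by (rule agree_cong) (rule tab_sum_raise[symmetric], simp)
  then have "agree m (fold ?o (rev [0..<m]) (FF m N)) (\<lambda>\<Lambda>. tab_sum (shifted_shape \<Lambda>) (2 * int N + 2) {})"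
    by (simp add: add.assoc)
  then have "agree m (fold ?o [0..<m] (fold ?o (rev [0..<m]) (FF m N)))
      (\<lambda>\<Lambda>. tab_sum (shifted_shape \<Lambda>) (2 * int N + 2) {a. content a < m})"
    by (rule agree_positive[OF order_refl])
  then have "agree m (FF m (Suc N)) (\<lambda>\<Lambda>. tab_sum (shifted_shape \<Lambda>) (2 * int N + 2) {a. content a < m})"
    by (simp add: FF_Suc factor_def)
  then have "agree m (FF m (Suc N)) (\<lambda>\<Lambda>. tab_sum (shifted_shape \<Lambda>) (2 * int N + 2) UNIV)"
    by (rule agree_cong) (rule tab_sum_all, use shifted_shape_neg_positions_content in blast)
  moreover have "2 * int N + 2 = 2 * int (Suc N)" by simp
  ultimately show ?case by metis
qed

section \<open>Strict partitions as lists and the coefficients of \<open>GQ\<close>\<close>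

lemma le_num_parts_above_iff:
  assumes "sorted_wrt (>) lam" "1 \<le> i"
  shows "i \<le> num_parts_above (set lam) c \<longleftrightarrow> i \<le> length lam \<and> c < lam ! (i - 1)"
  using assms
proof (induction lam arbitrary: i)
  case Nil
  then show ?case by (simp add: num_parts_above_def)
next
  case (Cons a lam)
  have lt: "l < a" if "l \<in> set lam" for l using Cons.prems that by simp
  show ?case
  proof (cases "c < a")
    case True
    have "{l \<in> set (a # lam). c < l} = insert a {l \<in> set lam. c < l}" using True by auto
    moreover have "a \<notin> set lam" using lt by blast
    ultimately have e: "num_parts_above (set (a # lam)) c = Suc (num_parts_above (set lam) c)" by (simp add: num_parts_above_def)
    show ?thesis
    proof (cases "i = 1")
      case True
      then show ?thesis using e \<open>c < a\<close> by simp
    next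
      case False
      then obtain k where k: "i = Suc k" "1 \<le> k" using Cons.prems by (cases i) auto
      then show ?thesis using e Cons.IH[of k] Cons.prems by (simp add: nth_Cons')
    qed
  next
    case False
    have "{l \<in> set (a # lam). c < l} = {}" using False lt by fastforce
    then have e: "num_parts_above (set (a # lam)) c = 0" by (simp only: num_parts_above_def card.empty)
    have "\<not> c < (a # lam) ! (i - 1)" if "i \<le> length (a # lam)"
    proof -
      have "(a # lam) ! (i - 1) \<in> set (a # lam)" using that Cons.prems(2) by (intro nth_mem) simp
      then show ?thesis using False lt by fastforce
    qed
    then show ?thesis using e Cons.prems(2) by auto
  qed
qed

lemma shifted_diagram_eq_shifted_shape:
  assumes "sorted_wrt (>) lam" shows "shifted_diagram lam = shifted_shape (set lam)"
proof (rule set_eqI)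
  fix a :: "nat \<times> nat"
  obtain i j where a: "a = (i, j)" by (cases a)
  show "a \<in> shifted_diagram lam \<longleftrightarrow> a \<in> shifted_shape (set lam)"
    using le_num_parts_above_iff[OF assms, of i "j - i"] unfolding a shifted_diagram_def shifted_shape_def by auto
qed

lemma card_shifted_diagram: "card (shifted_diagram lam) = sum_list lam"
proof -
  have e: "shifted_diagram lam = Sigma {1..length lam} (\<lambda>i. {i..lam ! (i - 1) + i - 1})"
    by (auto simp: shifted_diagram_def)
  have "card (shifted_diagram lam) = (\<Sum>i = 1..length lam. card {i..lam ! (i - 1) + i - 1})"
    unfolding e by (rule card_SigmaI) auto
  also have "\<dots> = (\<Sum>i = 1..length lam. lam ! (i - 1))" by (rule sum.cong) auto
  also have "\<dots> = (\<Sum>i<length lam. lam ! i)"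
    by (rule sum.reindex_bij_witness[of _ Suc "\<lambda>i. i - 1"]) auto
  finally show ?thesis by (simp add: sum_list_sum_nth atLeast0LessThan)
qed

lemma lookup_sum_single_ge:
  assumes "finite D" "a \<in> D" "finite (T a)" "y \<in> T a"
  shows "0 < Poly_Mapping.lookup (\<Sum>b\<in>D. \<Sum>s\<in>T b. Poly_Mapping.single (nat \<bar>s\<bar>) (1::nat)) (nat \<bar>y\<bar>)"
proof -
  have "0 < Poly_Mapping.lookup (Poly_Mapping.single (nat \<bar>y\<bar>) (1::nat)) (nat \<bar>y\<bar>)" by simp
  also have "\<dots> \<le> (\<Sum>s\<in>T a. Poly_Mapping.lookup (Poly_Mapping.single (nat \<bar>s\<bar>) (1::nat)) (nat \<bar>y\<bar>))"
    by (rule member_le_sum[OF assms(4) _ assms(3)]) simp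
  also have "\<dots> \<le> (\<Sum>b\<in>D. \<Sum>s\<in>T b. Poly_Mapping.lookup (Poly_Mapping.single (nat \<bar>s\<bar>) (1::nat)) (nat \<bar>y\<bar>))"
    by (rule member_le_sum[OF assms(2) _ assms(1)]) simp
  finally show ?thesis by (simp add: lookup_sum)
qed

text \<open>Each letter of a tableau contributes its variable to the monomial, so tableaux with
  letters beyond \<open>N\<close> cannot produce \<open>m\<close>.\<close>

lemma lookup_tab_sum:
  assumes m: "\<And>i. i \<in> Poly_Mapping.keys m \<Longrightarrow> i \<le> N" and D: "finite (shifted_diagram lam)"
  shows "Poly_Mapping.lookup (tab_sum (shifted_diagram lam) (2 * int N) UNIV) m = GQ lam m"
proof -
  let ?D = "shifted_diagram lam"
  have "{T \<in> tabs ?D (2 * int N) UNIV. tableau_monomial lam T = m} =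
      {T. T \<in> set_valued_tableaux lam \<and> tableau_monomial lam T = m}"
  proof (intro equalityI subsetI)
    fix T
    assume "T \<in> {T \<in> tabs ?D (2 * int N) UNIV. tableau_monomial lam T = m}"
    then show "T \<in> {T. T \<in> set_valued_tableaux lam \<and> tableau_monomial lam T = m}"
      using tabs_tab unfolding mem_Collect_eq set_valued_tableaux_iff by blast
  next
    fix T
    assume "T \<in> {T. T \<in> set_valued_tableaux lam \<and> tableau_monomial lam T = m}"
    then have t: "tab ?D T" and e: "tableau_monomial lam T = m"
      unfolding mem_Collect_eq set_valued_tableaux_iff by blast+
    have "prec_rank y \<le> 2 * int N" if y: "y \<in> T a" for a y
    proof -
      have a: "a \<in> ?D" using tab_dom[OF t y] .
      have "nat \<bar>y\<bar> \<in> Poly_Mapping.keys m"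
        using lookup_sum_single_ge[where T = T and a = a, OF D a tab_finite[OF t a] y] e
        unfolding tableau_monomial_def by (simp add: in_keys_iff)
      then have "\<bar>y\<bar> \<le> int N" using m[of "nat \<bar>y\<bar>"] by linarith
      then show ?thesis by (auto simp: prec_rank_def)
    qed
    then show "T \<in> {T \<in> tabs ?D (2 * int N) UNIV. tableau_monomial lam T = m}"
      using tabsI[OF t] e by blast
  qed
  then have "GQ lam m = (\<Sum>T | T \<in> tabs ?D (2 * int N) UNIV \<and> tableau_monomial lam T = m.
      beta ^ (tableau_size lam T - sum_list lam))"
    unfolding GQ_def by simp
  also have "\<dots> = (\<Sum>T\<in>tabs ?D (2 * int N) UNIV. if tableau_monomial lam T = m
      then beta ^ (tableau_size lam T - sum_list lam) else 0)"
    by (rule sum.inter_filter[OF finite_tabs[OF D]])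
  also have "\<dots> = (\<Sum>T\<in>tabs ?D (2 * int N) UNIV. Poly_Mapping.lookup (wgt ?D T) m)"
    by (rule sum.cong[OF refl])
       (simp add: wgt_def lookup_single when_def tableau_monomial_def tableau_size_def card_shifted_diagram)
  finally show ?thesis by (simp add: tab_sum_def lookup_sum)
qed

theorem theorem1p4:
  fixes n :: nat and w :: "int \<Rightarrow> int"
  assumes "w \<in> signed_perms n"
    and "vexillary n w"
  shows "\<exists>lam. strict_partition lam \<and> GC n w = GQ lam"
proof -
  note o = signed_perms_odd[OF assms(1)]
  have g: "inv w \<in> signed_perms n" using signed_perms_inv[OF assms(1)] .
  have v: "vex (inv w)" using vex_inv[OF o vexillary_imp_vex[OF assms]] .
  \<comment> \<open>Beyond \<open>n\<close> the permutation is the identity, so the reduction can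
    start with \<open>r = n\<close>.\<close>
  have "inv w x = x" if "int n < x" for x
    using g that by (auto simp: signed_perms_def permutes_def)
  then have "inv w x < inv w y" if "int n < x" "x < y" for x y using that by simp
  from vex_reduce[OF g v this] obtain m h where nm: "n \<le> m" and h: "h \<in> signed_perms m"
    and inc: "\<And>x y. 0 < x \<Longrightarrow> x < y \<Longrightarrow> h x < h y" and FF: "\<And>N. FF m N (inv (inv w)) = FF m N (inv h)"
    by blast
  have u: "inv h \<in> signed_perms m" "grassmannian (inv h)"
    using signed_perms_inv[OF h] grassmannian_inv[OF signed_perms_odd[OF h] inc] by blast+
  define lam where "lam = rev (sorted_list_of_set (neg_positions (inv h)))"
  have fin: "finite (neg_positions (inv h))" using finite_neg_positions[OF u(1)] .
  have s: "sorted_wrt (>) lam" "set lam = neg_positions (inv h)"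
    using fin by (simp_all add: lam_def sorted_wrt_rev)
  have D: "shifted_diagram lam = shifted_shape (neg_positions (inv h))" using shifted_diagram_eq_shifted_shape[OF s(1)] s(2) by simp
  have "strict_partition lam" using s by (auto simp: strict_partition_def neg_positions_def)
  moreover have "GC n w mo = GQ lam mo" for mo
  proof -
    define N where "N = Max (insert 0 (Poly_Mapping.keys mo))"
    have N: "i \<le> N" if "i \<in> Poly_Mapping.keys mo" for i using that by (simp add: N_def)
    have "GC n w mo = Poly_Mapping.lookup (FF n N w) mo" using GC_eq_lookup_FF[OF assms(1)] N by blast
    also have "FF n N w = FF m N (inv (inv w))"
      unfolding odd_perm_inv_inv[OF o] using FF_stable[OF nm assms(1)] by simp
    also have "\<dots> = tab_sum (shifted_diagram lam) (2 * int N) UNIV"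
      unfolding FF D using agree_FF[of m N] u unfolding agree_def by blast
    also have "Poly_Mapping.lookup \<dots> mo = GQ lam mo"
      by (rule lookup_tab_sum[OF N]) (simp_all add: D finite_shifted_shape[OF fin])
    finally show ?thesis .
  qed
  ultimately show ?thesis by blast
qed

end
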